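(* Let $R$ be a local Noetherian domain. Then $R$ is a bad stable domain if and only if there is a nonzero prime ideal $P$ of $\widehat R$ such that $P^2=0$ and $\widehat R/P$ is a DVR.
   Context: All rings are commutative with identity. A quasilocal ring is a ring with a unique maximal ideal. $\widehat R$ denotes the completion of $R$ in the topology given by powers of its maximal ideal. An ideal is stable if it is projective over its ring of endomorphisms; a domain is stable if every nonzero ideal is stable. A ring has finite normalization if its integral closure in its total ring of quotients is a finite module over it. A bad stable domain is a quasilocal stable domain of Krull dimension $1$ that does not have finite normalization. *)

theory Defs
  imports "HOL-Algebra.Algebra" "HOL-Library.Extended_Nat"
begin

section \<open>Quasilocal rings, Krull dimension, discrete valuation rings\<close>

definition quasilocal_ring :: "('a, 'b) ring_scheme \<Rightarrow> bool"
  where "quasilocal_ring R \<longleftrightarrow> cring R \<and> (\<exists>!M. maximalideal M R)"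

text \<open>Meaningful for quasilocal rings only.\<close>
definition max_ideal :: "('a, 'b) ring_scheme \<Rightarrow> 'a set"
  where "max_ideal R = (THE M. maximalideal M R)"

definition prime_chain :: "('a, 'b) ring_scheme \<Rightarrow> nat \<Rightarrow> (nat \<Rightarrow> 'a set) \<Rightarrow> bool"
  where "prime_chain R n p \<longleftrightarrow> (\<forall>i\<le>n. primeideal (p i) R) \<and> (\<forall>i<n. p i \<subset> p (Suc i))"

definition krull_dim :: "('a, 'b) ring_scheme \<Rightarrow> enat"
  where "krull_dim R = (SUP n \<in> {n. \<exists>p. prime_chain R n p}. enat n)"

definition dvr :: "('a, 'b) ring_scheme \<Rightarrow> bool"
  where "dvr R \<longleftrightarrow> principal_domain R \<and> quasilocal_ring R \<and> \<not> field R"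


section \<open>Completion\<close>

text \<open>Powers of ideals are taken in the multiplicative monoid of \<^const>\<open>ideals_set\<close>, whose
  neutral element is \<^term>\<open>carrier R\<close>.\<close>
abbreviation ideal_power :: "('a, 'b) ring_scheme \<Rightarrow> 'a set \<Rightarrow> nat \<Rightarrow> 'a set"
  where "ideal_power R I n \<equiv> I [^]\<^bsub>ideals_set R\<^esub> n"

text \<open>The inverse limit of the rings \<open>R / I^n\<close>. Elements of the quotients are cosets, and
  \<open>x (Suc n) \<subseteq> x n\<close> says that the projection \<open>R / I^(n+1) \<rightarrow> R / I^n\<close> maps
  \<open>x (Suc n)\<close> to \<open>x n\<close>.\<close>
definition adic_completion :: "('a, 'b) ring_scheme \<Rightarrow> 'a set \<Rightarrow> (nat \<Rightarrow> 'a set) ring"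
  where "adic_completion R I =
    \<lparr> carrier = {x. (\<forall>n. x n \<in> carrier (R Quot (ideal_power R I n))) \<and> (\<forall>n. x (Suc n) \<subseteq> x n)},
      monoid.mult = (\<lambda>x y n. x n \<otimes>\<^bsub>R Quot (ideal_power R I n)\<^esub> y n),
      one = (\<lambda>n. \<one>\<^bsub>R Quot (ideal_power R I n)\<^esub>),
      ring.zero = (\<lambda>n. \<zero>\<^bsub>R Quot (ideal_power R I n)\<^esub>),
      add = (\<lambda>x y n. x n \<oplus>\<^bsub>R Quot (ideal_power R I n)\<^esub> y n) \<rparr>"

definition completion :: "('a, 'b) ring_scheme \<Rightarrow> (nat \<Rightarrow> 'a set) ring"
  where "completion R = adic_completion R (max_ideal R)"


section \<open>Total ring of quotients and finite normalization\<close>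

definition nonzerodivisors :: "('a, 'b) ring_scheme \<Rightarrow> 'a set"
  where "nonzerodivisors R =
    {s \<in> carrier R. \<forall>a \<in> carrier R. a \<otimes>\<^bsub>R\<^esub> s = \<zero>\<^bsub>R\<^esub> \<longrightarrow> a = \<zero>\<^bsub>R\<^esub>}"

text \<open>The fraction \<open>a / s\<close> as an equivalence class of pairs; cross-multiplication is an
  equivalence relation here because all denominators are nonzerodivisors.\<close>
definition fraction :: "('a, 'b) ring_scheme \<Rightarrow> 'a \<Rightarrow> 'a \<Rightarrow> ('a \<times> 'a) set"
  where "fraction R a s =
    {(b, t). b \<in> carrier R \<and> t \<in> nonzerodivisors R \<and> a \<otimes>\<^bsub>R\<^esub> t = b \<otimes>\<^bsub>R\<^esub> s}"

text \<open>As for \<^const>\<open>rcoset_mult\<close>, the unions range over all choices of representatives;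
  all members of each union coincide.\<close>
definition total_quotient_ring :: "('a, 'b) ring_scheme \<Rightarrow> ('a \<times> 'a) set ring"
  where "total_quotient_ring R =
    \<lparr> carrier = {fraction R a s | a s. a \<in> carrier R \<and> s \<in> nonzerodivisors R},
      monoid.mult = (\<lambda>A B. \<Union>(a, s) \<in> A. \<Union>(b, t) \<in> B. fraction R (a \<otimes>\<^bsub>R\<^esub> b) (s \<otimes>\<^bsub>R\<^esub> t)),
      one = fraction R \<one>\<^bsub>R\<^esub> \<one>\<^bsub>R\<^esub>,
      ring.zero = fraction R \<zero>\<^bsub>R\<^esub> \<one>\<^bsub>R\<^esub>,
      add = (\<lambda>A B. \<Union>(a, s) \<in> A. \<Union>(b, t) \<in> B.
        fraction R (a \<otimes>\<^bsub>R\<^esub> t \<oplus>\<^bsub>R\<^esub> b \<otimes>\<^bsub>R\<^esub> s) (s \<otimes>\<^bsub>R\<^esub> t)) \<rparr>"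

definition base_ring :: "('a, 'b) ring_scheme \<Rightarrow> ('a \<times> 'a) set set"
  where "base_ring R = (\<lambda>a. fraction R a \<one>\<^bsub>R\<^esub>) ` carrier R"

text \<open>Polynomials are coefficient lists, leading coefficient first; \<open>p \<noteq> []\<close> is needed because
  the zero polynomial is \<open>[]\<close> and \<^term>\<open>hd []\<close> is unspecified.\<close>
definition integral_closure :: "('a, 'b) ring_scheme \<Rightarrow> 'a set \<Rightarrow> 'a set"
  where "integral_closure T K =
    {x \<in> carrier T. \<exists>p. p \<noteq> [] \<and> polynomial\<^bsub>T\<^esub> K p \<and>
       lead_coeff p = \<one>\<^bsub>T\<^esub> \<and> ring.eval T p x = \<zero>\<^bsub>T\<^esub>}"

definition finite_normalization :: "('a, 'b) ring_scheme \<Rightarrow> bool"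
  where "finite_normalization R \<longleftrightarrow>
    (\<exists>us. set us \<subseteq> carrier (total_quotient_ring R) \<and>
      integral_closure (total_quotient_ring R) (base_ring R) =
        ring.Span (total_quotient_ring R) (base_ring R) us)"


section \<open>Projective modules\<close>

text \<open>For modules, the ring multiplication and unit of the record are irrelevant.\<close>
definition free_module :: "('e, 'b) ring_scheme \<Rightarrow> 'i set \<Rightarrow> ('e, 'i \<Rightarrow> 'e) module"
  where "free_module E J =
    \<lparr> carrier = {f. (\<forall>i \<in> J. f i \<in> carrier E) \<and> (\<forall>i. i \<notin> J \<longrightarrow> f i = \<zero>\<^bsub>E\<^esub>) \<and>
                    finite {i. f i \<noteq> \<zero>\<^bsub>E\<^esub>}},
      monoid.mult = undefined,
      one = undefined,
      ring.zero = (\<lambda>_. \<zero>\<^bsub>E\<^esub>),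
      add = (\<lambda>f g i. f i \<oplus>\<^bsub>E\<^esub> g i),
      smult = (\<lambda>e f i. e \<otimes>\<^bsub>E\<^esub> f i) \<rparr>"

definition direct_summand ::
    "('e, 'm, 'b) module_scheme \<Rightarrow> ('e, 'c) ring_scheme \<Rightarrow> 'm set \<Rightarrow> bool"
  where "direct_summand F E P \<longleftrightarrow> submodule P E F \<and>
    (\<exists>Q. submodule Q E F \<and> P \<inter> Q = {\<zero>\<^bsub>F\<^esub>} \<and> P <+>\<^bsub>F\<^esub> Q = carrier F)"

text \<open>\<open>M\<close> is isomorphic to a direct summand of a free \<open>E\<close>-module. It is no restriction that the
  basis is indexed by a set of the type of elements of \<open>M\<close>: a module isomorphic to a direct
  summand of any free module is isomorphic to one of the free module on its own carrier, because
  the canonical surjection from the latter splits.\<close>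
definition projective_module ::
    "('e, 'c) ring_scheme \<Rightarrow> ('e, 'm, 'b) module_scheme \<Rightarrow> bool"
  where "projective_module E M \<longleftrightarrow>
    (\<exists>(J :: 'm set) P \<phi>. direct_summand (free_module E J) E P \<and>
      bij_betw \<phi> (carrier M) P \<and>
      (\<forall>x \<in> carrier M. \<forall>y \<in> carrier M.
         \<phi> (x \<oplus>\<^bsub>M\<^esub> y) = \<phi> x \<oplus>\<^bsub>free_module E J\<^esub> \<phi> y) \<and>
      (\<forall>e \<in> carrier E. \<forall>x \<in> carrier M.
         \<phi> (e \<odot>\<^bsub>M\<^esub> x) = e \<odot>\<^bsub>free_module E J\<^esub> \<phi> x))"


section \<open>Stable domains\<close>

text \<open>The ring of \<open>R\<close>-module endomorphisms of an ideal \<open>I\<close>, with composition as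
  multiplication; endomorphisms are \<^const>\<open>undefined\<close> outside \<open>I\<close>.\<close>
definition endo_ring :: "('a, 'b) ring_scheme \<Rightarrow> 'a set \<Rightarrow> ('a \<Rightarrow> 'a) ring"
  where "endo_ring R I =
    \<lparr> carrier = {f \<in> I \<rightarrow>\<^sub>E I. (\<forall>x \<in> I. \<forall>y \<in> I. f (x \<oplus>\<^bsub>R\<^esub> y) = f x \<oplus>\<^bsub>R\<^esub> f y) \<and>
                              (\<forall>r \<in> carrier R. \<forall>x \<in> I. f (r \<otimes>\<^bsub>R\<^esub> x) = r \<otimes>\<^bsub>R\<^esub> f x)},
      monoid.mult = (\<lambda>f g. compose I f g),
      one = (\<lambda>x \<in> I. x),
      ring.zero = (\<lambda>x \<in> I. \<zero>\<^bsub>R\<^esub>),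
      add = (\<lambda>f g. \<lambda>x \<in> I. f x \<oplus>\<^bsub>R\<^esub> g x) \<rparr>"

text \<open>\<open>I\<close> as a module over its endomorphism ring, which acts by evaluation.\<close>
definition endo_module :: "('a, 'b) ring_scheme \<Rightarrow> 'a set \<Rightarrow> ('a \<Rightarrow> 'a, 'a) module"
  where "endo_module R I =
    \<lparr> carrier = I, monoid.mult = undefined, one = undefined, ring.zero = \<zero>\<^bsub>R\<^esub>, add = add R,
      smult = (\<lambda>f x. f x) \<rparr>"

definition stable_ideal :: "('a, 'b) ring_scheme \<Rightarrow> 'a set \<Rightarrow> bool"
  where "stable_ideal R I \<longleftrightarrow> ideal I R \<and> projective_module (endo_ring R I) (endo_module R I)"

definition stable_domain :: "('a, 'b) ring_scheme \<Rightarrow> bool"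
  where "stable_domain R \<longleftrightarrow> domain R \<and> (\<forall>I. ideal I R \<and> I \<noteq> {\<zero>\<^bsub>R\<^esub>} \<longrightarrow> stable_ideal R I)"

definition bad_stable_domain :: "('a, 'b) ring_scheme \<Rightarrow> bool"
  where "bad_stable_domain R \<longleftrightarrow>
    quasilocal_ring R \<and> stable_domain R \<and> krull_dim R = 1 \<and> \<not> finite_normalization R"

end

theory Submission
  imports Defs
begin

text \<open>
  Let \<open>V\<close> be the ring of almost integral elements of the fraction field of \<open>R\<close>. If \<open>R\<close> is stable, the dual
  basis of a projective module and Nakayama's lemma show that every module between \<open>R\<close> and \<open>V\<close> generated by
  two elements over \<open>R\<close> is a ring. When \<open>V\<close> is not finite over \<open>R\<close>, multiplying a given element of \<open>V\<close> by one
  with much larger denominators gives \<open>V = R + \<mm>V\<close> and makes \<open>V\<close> a discrete valuation ring with a uniformizer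
  \<open>m \<in> \<mm>\<close>. The limits of the sequences \<open>a n \<in> R \<inter> m^n V\<close> then form the prime \<open>P\<close>: it has square zero since
  \<open>(m^n v)(m^n w) \<in> m^n (R m^n + R m^n v + R m^n w)\<close>, and the residue ring modulo \<open>P\<close> is the completion of \<open>V\<close>.

  Conversely, given \<open>P\<close>, choose \<open>i\<close> in an ideal \<open>I\<close> of \<open>R\<close> with least value in the residue ring of \<open>P\<close>. Since
  \<open>P\<^sup>2 = 0\<close>, products of elements of \<open>I\<close> lie in \<open>i I\<close>, so \<open>I\<close> is free of rank one over its endomorphism ring. A nonzero
  element of \<open>P\<close> yields integral fractions without a common denominator.
\<close>

subsection \<open>Polynomial identities in commutative rings\<close>

text \<open>Both directions work with an element \<open>m\<close> of \<open>\<mm>\<close> such that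
  \<open>\<mm>^2 = m \<mm>\<close>. Then \<open>\<mm>^(n + 1) = m^n \<mm>\<close>, so that a
  congruence modulo a power of \<open>\<mm>\<close> is a divisibility by a power of
  \<open>m\<close>; this is what carries statements between \<open>R\<close> and its completion. The
  obstacle to finding \<open>m\<close> in a bad stable domain is that \<open>V\<close> is not finite
  over \<open>R\<close>, so Nakayama's lemma says nothing on \<open>V\<close>, which is not even
  known to be local. What remains are equations: \<open>x y = a + b x + c y\<close> for
  \<open>x\<close>, \<open>y\<close> in \<open>V\<close>, in particular
  \<open>x^2 = a + b x\<close>. Units of \<open>V\<close> are detected by norms for these quadratic
  equations, and the missing finiteness becomes a tool, as it provides elements with arbitrarily
  large denominators. In the converse, \<open>P^2 = 0\<close> acts through squares: if a sequence
  has its limit in \<open>P\<close>, the square of its term \<open>n\<close> lies in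
  \<open>\<mm>^n\<close>. So a relation modulo \<open>P\<close> becomes a quadratic relation in
  \<open>R\<close>, with an error that is absorbed by a unit \<open>1 - m c\<close> or by a multiple
  of \<open>i^2\<close>.\<close>

definition ucar :: "('a, 'b) ring_scheme \<Rightarrow> 'a set"
  where "ucar R = (if cring R then carrier R else {undefined})"
definition uadd :: "('a, 'b) ring_scheme \<Rightarrow> 'a \<Rightarrow> 'a \<Rightarrow> 'a"
  where "uadd R x y = (if cring R then x \<oplus>\<^bsub>R\<^esub> y else undefined)"
definition umul :: "('a, 'b) ring_scheme \<Rightarrow> 'a \<Rightarrow> 'a \<Rightarrow> 'a"
  where "umul R x y = (if cring R then x \<otimes>\<^bsub>R\<^esub> y else undefined)"
definition uneg :: "('a, 'b) ring_scheme \<Rightarrow> 'a \<Rightarrow> 'a"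
  where "uneg R x = (if cring R then \<ominus>\<^bsub>R\<^esub> x else undefined)"
definition uzer :: "('a, 'b) ring_scheme \<Rightarrow> 'a"
  where "uzer R = (if cring R then \<zero>\<^bsub>R\<^esub> else undefined)"
definition uone :: "('a, 'b) ring_scheme \<Rightarrow> 'a"
  where "uone R = (if cring R then \<one>\<^bsub>R\<^esub> else undefined)"

lemmas uring_defs = ucar_def uadd_def umul_def uneg_def uzer_def uone_def

lemma ucar_closed:
  assumes "x \<in> ucar R" "y \<in> ucar R"
  shows "uadd R x y \<in> ucar R" "umul R x y \<in> ucar R" "uneg R x \<in> ucar R"
  using assms cring.cring_simprules(1,3,5)[of R] by (auto simp: uring_defs)

text \<open>For a record that is not a commutative ring the \<open>u\<close> operations are those of
  the zero ring on \<open>{undefined}\<close>. The laws therefore hold without the hypothesis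
  \<open>cring R\<close>, as a type of class \<open>comm_ring_1\<close> demands.\<close>

lemma ucar_axioms:
  assumes "x \<in> ucar R" "y \<in> ucar R" "z \<in> ucar R"
  shows "umul R (umul R x y) z = umul R x (umul R y z)"
    "umul R x y = umul R y x"
    "umul R (uone R) x = x"
    "uadd R (uadd R x y) z = uadd R x (uadd R y z)"
    "uadd R x y = uadd R y x"
    "uadd R (uzer R) x = x"
    "uadd R (uneg R x) x = uzer R"
    "umul R (uadd R x y) z = uadd R (umul R x z) (umul R y z)"
  using assms cring.cring_simprules(11,14,12,7,10,8,9,13)[of R] by (auto simp: uring_defs)

lemma uzer_closed: "uzer R \<in> ucar R" and uone_closed: "uone R \<in> ucar R"
  using cring.cring_simprules(2,6) by (auto simp: uring_defs)

text \<open>The product of all commutative rings on a type, made nontrivial by a factor \<open>\<int>\<close>. Being a type of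
  class \<open>comm_ring_1\<close>, it lets \<open>algebra_simps\<close> prove polynomial identities inside the locale \<open>cring\<close>.\<close>
typedef ('a, 'b) uring =
  "{f :: ('a, 'b) ring_scheme \<Rightarrow> 'a. \<forall>R. f R \<in> ucar R} \<times> (UNIV :: int set)"
  using uzer_closed by blast

setup_lifting type_definition_uring

instantiation uring :: (type, type) comm_ring_1
begin

lift_definition zero_uring :: "('a, 'b) uring" is "(uzer, 0)"
  by (simp add: uzer_closed)

lift_definition one_uring :: "('a, 'b) uring" is "(uone, 1)"
  by (simp add: uone_closed)

lift_definition plus_uring :: "('a, 'b) uring \<Rightarrow> ('a, 'b) uring \<Rightarrow> ('a, 'b) uring"
  is "\<lambda>p q. (\<lambda>R. uadd R (fst p R) (fst q R), snd p + snd q)"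
  by (auto simp: mem_Times_iff intro!: ucar_closed)

lift_definition times_uring :: "('a, 'b) uring \<Rightarrow> ('a, 'b) uring \<Rightarrow> ('a, 'b) uring"
  is "\<lambda>p q. (\<lambda>R. umul R (fst p R) (fst q R), snd p * snd q)"
  by (auto simp: mem_Times_iff intro!: ucar_closed)

lift_definition uminus_uring :: "('a, 'b) uring \<Rightarrow> ('a, 'b) uring"
  is "\<lambda>p. (\<lambda>R. uneg R (fst p R), - snd p)"
  by (auto simp: mem_Times_iff intro!: ucar_closed)

lift_definition minus_uring :: "('a, 'b) uring \<Rightarrow> ('a, 'b) uring \<Rightarrow> ('a, 'b) uring"
  is "\<lambda>p q. (\<lambda>R. uadd R (fst p R) (uneg R (fst q R)), snd p - snd q)"
  by (auto simp: mem_Times_iff intro!: ucar_closed)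

instance
proof
  fix a b c :: "('a, 'b) uring"
  show "a * b * c = a * (b * c)"
    by transfer (auto simp: fun_eq_iff mem_Times_iff intro!: ucar_axioms(1))
  show "a * b = b * a"
    by transfer (auto simp: fun_eq_iff mem_Times_iff intro!: ucar_axioms(2))
  show "1 * a = a"
    by transfer (auto simp: fun_eq_iff mem_Times_iff intro!: ucar_axioms(3))
  show "a + b + c = a + (b + c)"
    by transfer (auto simp: fun_eq_iff mem_Times_iff intro!: ucar_axioms(4))
  show "a + b = b + a"
    by transfer (auto simp: fun_eq_iff mem_Times_iff intro!: ucar_axioms(5))
  show "0 + a = a"
    by transfer (auto simp: fun_eq_iff mem_Times_iff intro!: ucar_axioms(6))
  show "- a + a = 0"
    by transfer (auto simp: fun_eq_iff mem_Times_iff intro!: ucar_axioms(7))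
  show "a - b = a + - b"
    by transfer (simp add: fun_eq_iff)
  show "(a + b) * c = a * c + b * c"
    by transfer (auto simp: fun_eq_iff mem_Times_iff distrib_right intro!: ucar_axioms(8))
  show "(0 :: ('a, 'b) uring) \<noteq> 1"
    by transfer simp
qed

end

text \<open>The element of the product that is \<open>a\<close> in the factor \<open>R\<close> and
  zero in all others. The test \<open>a \<in> ucar R\<close> makes the function total.\<close>

lift_definition lift_elem :: "('a, 'b) ring_scheme \<Rightarrow> 'a \<Rightarrow> ('a, 'b) uring"
  is "\<lambda>R a. (\<lambda>S. if S = R \<and> a \<in> ucar R then a else uzer S, 0)"
  by (auto intro: uzer_closed)

lift_definition proj_elem :: "('a, 'b) ring_scheme \<Rightarrow> ('a, 'b) uring \<Rightarrow> 'a"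
  is "\<lambda>R p. fst p R" .

context cring
begin

definition represents :: "('a, 'b) uring \<Rightarrow> 'a \<Rightarrow> bool"
  where "represents p a \<longleftrightarrow> proj_elem R p = a"

lemma represents_intros:
  "represents p a \<Longrightarrow> represents q b \<Longrightarrow> represents (p + q) (a \<oplus> b)"
  "represents p a \<Longrightarrow> represents q b \<Longrightarrow> represents (p - q) (a \<ominus> b)"
  "represents p a \<Longrightarrow> represents q b \<Longrightarrow> represents (p * q) (a \<otimes> b)"
  "represents p a \<Longrightarrow> represents (- p) (\<ominus> a)"
  "represents 0 \<zero>" "represents 1 \<one>"
  "represents p a \<Longrightarrow> represents (p ^ n) (a [^] n)" for n :: nat
proof -
  show *: "represents p a \<Longrightarrow> represents q b \<Longrightarrow> represents (p * q) (a \<otimes> b)" for p q a b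
    using is_cring by (simp add: represents_def proj_elem.rep_eq times_uring.rep_eq uring_defs)
  show **: "represents 1 \<one>"
    using is_cring by (simp add: represents_def proj_elem.rep_eq one_uring.rep_eq uring_defs)
  assume "represents p a"
  then show "represents (p ^ n) (a [^] n)"
    by (induction n) (use * ** in \<open>auto simp: power_Suc2 simp del: power_Suc\<close>)
qed (use is_cring in \<open>simp_all add: represents_def proj_elem.rep_eq plus_uring.rep_eq minus_uring.rep_eq
      uminus_uring.rep_eq zero_uring.rep_eq uring_defs a_minus_def\<close>)

lemma represents_lift:
  "a \<in> carrier R \<Longrightarrow> represents (lift_elem R a) a"
  using is_cring by (simp add: represents_def proj_elem.rep_eq lift_elem.rep_eq uring_defs)

lemmas reify = represents_intros represents_lift

text \<open>Applied backwards with unknown \<open>p\<close> and \<open>q\<close>: the rules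
  \<open>reify\<close> follow the syntax of \<open>a\<close> and \<open>b\<close> and build
  \<open>p\<close> and \<open>q\<close>. What is left is an equation in a type of class
  \<open>comm_ring_1\<close>, which simplification with \<open>algebra_simps\<close>
  settles.\<close>

lemma ring_eqI: "represents p a \<Longrightarrow> represents q b \<Longrightarrow> p = q \<Longrightarrow> a = b"
  by (simp add: represents_def)

end

subsection \<open>Almost integral elements\<close>

definition submod :: "('k, 'm) ring_scheme \<Rightarrow> 'k set \<Rightarrow> 'k set \<Rightarrow> bool"
  where "submod K B W \<longleftrightarrow> W \<subseteq> carrier K \<and> \<zero>\<^bsub>K\<^esub> \<in> W \<and>
    (\<forall>x \<in> W. \<forall>y \<in> W. x \<oplus>\<^bsub>K\<^esub> y \<in> W) \<and> (\<forall>b \<in> B. \<forall>x \<in> W. b \<otimes>\<^bsub>K\<^esub> x \<in> W)"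

text \<open>The sums of products \<open>\<theta> w\<close> with \<open>w \<in> W\<close> and \<open>\<theta> W \<subseteq> (W : W)\<close>.\<close>
inductive_set trace_set :: "('k, 'm) ring_scheme \<Rightarrow> 'k set \<Rightarrow> 'k set"
  for K and W where
    trace_zero: "\<zero>\<^bsub>K\<^esub> \<in> trace_set K W"
  | trace_step: "\<lbrakk> \<theta> \<in> carrier K; w \<in> W; \<And>x y. x \<in> W \<Longrightarrow> y \<in> W \<Longrightarrow> \<theta> \<otimes>\<^bsub>K\<^esub> x \<otimes>\<^bsub>K\<^esub> y \<in> W;
      s \<in> trace_set K W \<rbrakk> \<Longrightarrow> \<theta> \<otimes>\<^bsub>K\<^esub> w \<oplus>\<^bsub>K\<^esub> s \<in> trace_set K W"

text \<open>The complete integral closure of \<open>B\<close> in \<open>K\<close>: one denominator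
  \<open>d\<close> serves all powers of \<open>x\<close>. For a stable \<open>B\<close> it is the
  integral closure, by \<open>integral_closure_eq_V\<close>.\<close>

definition almost_integral :: "('k, 'm) ring_scheme \<Rightarrow> 'k set \<Rightarrow> 'k set"
  where "almost_integral K B =
    {x \<in> carrier K. \<exists>d \<in> B. d \<noteq> \<zero>\<^bsub>K\<^esub> \<and> (\<forall>k :: nat. d \<otimes>\<^bsub>K\<^esub> x [^]\<^bsub>K\<^esub> k \<in> B)}"

context field
begin

lemma nonzero_inv [simp]:
  assumes "x \<in> carrier R" "x \<noteq> \<zero>"
  shows "inv x \<in> carrier R" "x \<otimes> inv x = \<one>" "inv x \<otimes> x = \<one>" "inv x \<noteq> \<zero>"
proof -
  have u: "x \<in> Units R"
    using assms by (simp add: field_Units)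
  show "inv x \<in> carrier R" "x \<otimes> inv x = \<one>" "inv x \<otimes> x = \<one>"
    using u by auto
  then show "inv x \<noteq> \<zero>"
    using assms by auto
qed

end

locale fraction_subring = field K for K :: "('k, 'm) ring_scheme" (structure) +
  fixes B :: "'k set"
  assumes subring_B: "subring B K"
    and denom: "x \<in> carrier K \<Longrightarrow> \<exists>s \<in> B. s \<noteq> \<zero> \<and> s \<otimes> x \<in> B"
begin

abbreviation V where "V \<equiv> almost_integral K B"

lemma B_carrier [simp]: "b \<in> B \<Longrightarrow> b \<in> carrier K"
  using subringE(1)[OF subring_B] by auto

lemma B_closed [simp]:
  "\<zero> \<in> B" "\<one> \<in> B"
  "b \<in> B \<Longrightarrow> c \<in> B \<Longrightarrow> b \<oplus> c \<in> B"
  "b \<in> B \<Longrightarrow> c \<in> B \<Longrightarrow> b \<otimes> c \<in> B"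
  "b \<in> B \<Longrightarrow> \<ominus> b \<in> B"
  "b \<in> B \<Longrightarrow> c \<in> B \<Longrightarrow> b \<ominus> c \<in> B"
  using subringE[OF subring_B] by (auto simp: a_minus_def)

lemma B_pow [simp]: "b \<in> B \<Longrightarrow> b [^] (n::nat) \<in> B"
  by (induction n) auto

lemma submodD:
  assumes "submod K B W"
  shows "\<And>x. x \<in> W \<Longrightarrow> x \<in> carrier K" "\<zero> \<in> W" "\<And>x y. x \<in> W \<Longrightarrow> y \<in> W \<Longrightarrow> x \<oplus> y \<in> W"
    "\<And>b x. b \<in> B \<Longrightarrow> x \<in> W \<Longrightarrow> b \<otimes> x \<in> W" "\<And>x. x \<in> W \<Longrightarrow> \<ominus> x \<in> W"
    "\<And>x y. x \<in> W \<Longrightarrow> y \<in> W \<Longrightarrow> x \<ominus> y \<in> W"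
proof -
  note * = assms[unfolded submod_def]
  show c: "\<And>x. x \<in> W \<Longrightarrow> x \<in> carrier K" "\<zero> \<in> W" "\<And>x y. x \<in> W \<Longrightarrow> y \<in> W \<Longrightarrow> x \<oplus> y \<in> W"
    "\<And>b x. b \<in> B \<Longrightarrow> x \<in> W \<Longrightarrow> b \<otimes> x \<in> W"
    using * by auto
  show n: "\<ominus> x \<in> W" if "x \<in> W" for x
    using c(4)[of "\<ominus> \<one>" x] that c(1)[of x] by (simp add: l_minus)
  show "x \<ominus> y \<in> W" if "x \<in> W" "y \<in> W" for x y
    using c(3)[OF that(1) n[OF that(2)]] by (simp add: a_minus_def)
qed

lemma submodI:
  assumes "\<And>x. x \<in> W \<Longrightarrow> x \<in> carrier K" "\<zero> \<in> W" "\<And>x y. x \<in> W \<Longrightarrow> y \<in> W \<Longrightarrow> x \<oplus> y \<in> W"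
    "\<And>b x. b \<in> B \<Longrightarrow> x \<in> W \<Longrightarrow> b \<otimes> x \<in> W"
  shows "submod K B W"
  using assms by (auto simp: submod_def)

lemma V_carrier [simp]: "x \<in> V \<Longrightarrow> x \<in> carrier K"
  by (simp add: almost_integral_def)

text \<open>All \<open>h \<otimes> x [^] k\<close> stay in \<open>H\<close>, so \<open>h\<close> is
  a denominator of every power of \<open>x\<close>.\<close>

lemma V_I:
  assumes "x \<in> carrier K" "H \<subseteq> B" "h \<in> H" "h \<noteq> \<zero>" "\<And>h. h \<in> H \<Longrightarrow> x \<otimes> h \<in> H"
  shows "x \<in> V"
proof -
  have "h \<otimes> x [^] k \<in> H" for k :: nat
  proof (induction k)
    case 0
    then show ?case using assms by (metis B_carrier nat_pow_0 r_one subset_iff)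
  next
    case (Suc k)
    have "h \<in> carrier K"
      using assms by auto
    then have "h \<otimes> x [^] Suc k = x \<otimes> (h \<otimes> x [^] k)"
      using assms(1) by - (rule ring_eqI, (rule reify | (simp add: algebra_simps; fail))+)
    then show ?case
      using Suc assms(5) by simp
  qed
  then show ?thesis
    unfolding almost_integral_def using assms(1-4) by blast
qed

text \<open>If \<open>d\<close> and \<open>e\<close> are denominators of all powers of
  \<open>x\<close> and of \<open>y\<close>, then \<open>d \<otimes> e\<close> is one for all
  monomials in \<open>x\<close> and \<open>y\<close>. The elements of \<open>B\<close> with this
  property form the ideal \<open>H\<close>, and multiplication by \<open>x\<close> or
  \<open>y\<close> only shifts the exponents.\<close>

lemma V_common:
  assumes "x \<in> V" "y \<in> V"
  obtains H h where "submod K B H" "H \<subseteq> B" "h \<in> H" "h \<noteq> \<zero>"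
    "\<And>h. h \<in> H \<Longrightarrow> x \<otimes> h \<in> H" "\<And>h. h \<in> H \<Longrightarrow> y \<otimes> h \<in> H"
proof -
  have x: "x \<in> carrier K" and y: "y \<in> carrier K"
    using assms by auto
  obtain d e where de: "d \<in> B" "d \<noteq> \<zero>" "\<And>k::nat. d \<otimes> x [^] k \<in> B"
    "e \<in> B" "e \<noteq> \<zero>" "\<And>k::nat. e \<otimes> y [^] k \<in> B"
    using assms unfolding almost_integral_def by blast
  define H where "H = {r \<in> B. \<forall>(i::nat) (j::nat). x [^] i \<otimes> y [^] j \<otimes> r \<in> B}"
  have 1: "submod K B H"
  proof (rule submodI)
    fix r s assume rs: "r \<in> H" "s \<in> H"
    have "x [^] i \<otimes> y [^] j \<otimes> (r \<oplus> s) \<in> B" for i :: nat and j :: nat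
    proof -
      have rs': "r \<in> carrier K" "s \<in> carrier K"
        using rs by (auto simp: H_def)
      have "x [^] i \<otimes> y [^] j \<otimes> (r \<oplus> s) = x [^] i \<otimes> y [^] j \<otimes> r \<oplus> x [^] i \<otimes> y [^] j \<otimes> s"
        using x y rs' by - (rule ring_eqI, (rule reify | (simp add: algebra_simps; fail))+)
      then show ?thesis using rs by (simp add: H_def)
    qed
    then show "r \<oplus> s \<in> H" using rs by (auto simp: H_def)
  next
    fix b r assume br: "b \<in> B" "r \<in> H"
    have "x [^] i \<otimes> y [^] j \<otimes> (b \<otimes> r) \<in> B" for i :: nat and j :: nat
    proof -
      have br': "b \<in> carrier K" "r \<in> carrier K"
        using br by (auto simp: H_def)
      have "x [^] i \<otimes> y [^] j \<otimes> (b \<otimes> r) = b \<otimes> (x [^] i \<otimes> y [^] j \<otimes> r)"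
        using x y br' by - (rule ring_eqI, (rule reify | (simp add: algebra_simps; fail))+)
      then show ?thesis using br by (simp add: H_def)
    qed
    then show "b \<otimes> r \<in> H" using br by (auto simp: H_def)
  qed (use x y in \<open>auto simp: H_def\<close>)
  have 2: "d \<otimes> e \<in> H"
  proof -
    have "x [^] i \<otimes> y [^] j \<otimes> (d \<otimes> e) = (d \<otimes> x [^] i) \<otimes> (e \<otimes> y [^] j)" for i :: nat and j :: nat
      using x y B_carrier[OF de(1)] B_carrier[OF de(4)]
      by - (rule ring_eqI, (rule reify | (simp add: algebra_simps; fail))+)
    then show ?thesis using de by (simp add: H_def)
  qed
  have 3: "d \<otimes> e \<noteq> \<zero>"
    using de by (simp add: integral_iff)
  have 4: "x \<otimes> r \<in> H" "y \<otimes> r \<in> H" if "r \<in> H" for r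
  proof -
    have r: "r \<in> carrier K" "r \<in> B" using that by (auto simp: H_def)
    have e1: "x [^] i \<otimes> y [^] j \<otimes> (x \<otimes> r) = x [^] Suc i \<otimes> y [^] j \<otimes> r" for i :: nat and j :: nat
      using x y r(1) by - (rule ring_eqI, (rule reify | (simp add: algebra_simps; fail))+)
    have e2: "x [^] i \<otimes> y [^] j \<otimes> (y \<otimes> r) = x [^] i \<otimes> y [^] Suc j \<otimes> r" for i :: nat and j :: nat
      using x y r(1) by - (rule ring_eqI, (rule reify | (simp add: algebra_simps; fail))+)
    have "x [^] (1::nat) \<otimes> y [^] (0::nat) \<otimes> r \<in> B" "x [^] (0::nat) \<otimes> y [^] (1::nat) \<otimes> r \<in> B"
      using that unfolding H_def by blast+
    then have "x \<otimes> r \<in> B" "y \<otimes> r \<in> B"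
      using x y r by simp_all
    moreover have "x [^] i \<otimes> y [^] j \<otimes> (x \<otimes> r) \<in> B" "x [^] i \<otimes> y [^] j \<otimes> (y \<otimes> r) \<in> B" for i :: nat and j :: nat
      unfolding e1 e2 using that unfolding H_def by blast+
    ultimately show "x \<otimes> r \<in> H" "y \<otimes> r \<in> H"
      by (simp_all add: H_def)
  qed
  show thesis
    by (rule that[of H "d \<otimes> e"]) (use 1 2 3 4 in \<open>auto simp: H_def\<close>)
qed

lemma B_subset_V: "b \<in> B \<Longrightarrow> b \<in> V"
  by (rule V_I[of b B \<one>]) auto

lemma V_closed [simp]:
  assumes "x \<in> V" "y \<in> V"
  shows "x \<oplus> y \<in> V" "x \<otimes> y \<in> V" "x \<ominus> y \<in> V"
proof -
  obtain H h where H: "submod K B H" "H \<subseteq> B" "h \<in> H" "h \<noteq> \<zero>"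
    "\<And>h. h \<in> H \<Longrightarrow> x \<otimes> h \<in> H" "\<And>h. h \<in> H \<Longrightarrow> y \<otimes> h \<in> H"
    using V_common[OF assms] by metis
  have x: "x \<in> carrier K" and y: "y \<in> carrier K" and Hc: "h \<in> carrier K" if "h \<in> H" for h
    using assms that H(2) by auto
  have "(x \<oplus> y) \<otimes> h = x \<otimes> h \<oplus> y \<otimes> h" "x \<otimes> y \<otimes> h = x \<otimes> (y \<otimes> h)"
    "(x \<ominus> y) \<otimes> h = x \<otimes> h \<ominus> y \<otimes> h" if "h \<in> H" for h
    using x[OF that] y[OF that] Hc[OF that] by (simp_all add: l_distr l_minus m_assoc a_minus_def)
  then have "(x \<oplus> y) \<otimes> h \<in> H" "x \<otimes> y \<otimes> h \<in> H" "(x \<ominus> y) \<otimes> h \<in> H" if "h \<in> H" for h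
    using that H(5,6) submodD[OF H(1)] by auto
  then show "x \<oplus> y \<in> V" "x \<otimes> y \<in> V" "x \<ominus> y \<in> V"
    by (auto intro!: V_I[OF _ H(2,3,4)] simp: assms)
qed

lemma V_consts [simp]: "\<zero> \<in> V" "\<one> \<in> V"
  by (auto intro: B_subset_V)

lemma V_pow [simp]: "b \<in> V \<Longrightarrow> b [^] (n::nat) \<in> V"
  by (induction n) auto

text \<open>Stability is assumed for submodules of \<open>B\<close>, while modules such as
  \<open>B + B x + B y\<close> lie in \<open>B\<close> after multiplication by some
  \<open>d\<close>. A multiplier \<open>\<theta>\<close> for \<open>d W\<close> becomes the
  multiplier \<open>\<theta> \<otimes> d\<close> for \<open>W\<close>, and the sums of products
  agree.\<close>

lemma trace_scale:
  assumes W: "W \<subseteq> carrier K" and d: "d \<in> carrier K" "d \<noteq> \<zero>" and s: "s \<in> trace_set K ((\<otimes>) d ` W)"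
  shows "s \<in> trace_set K W"
  using s
proof (induction s rule: trace_set.induct)
  case trace_zero
  show ?case by (rule trace_set.trace_zero)
next
  case (trace_step \<theta> w s)
  obtain w' where w': "w' \<in> W" "w = d \<otimes> w'"
    using trace_step by auto
  have "\<theta> \<otimes> d \<otimes> x \<otimes> y \<in> W" if xy: "x \<in> W" "y \<in> W" for x y
  proof -
    have c: "x \<in> carrier K" "y \<in> carrier K"
      using xy W by auto
    have "\<theta> \<otimes> (d \<otimes> x) \<otimes> (d \<otimes> y) \<in> (\<otimes>) d ` W"
      using trace_step(3) xy by blast
    then obtain z where z: "z \<in> W" "\<theta> \<otimes> (d \<otimes> x) \<otimes> (d \<otimes> y) = d \<otimes> z"
      by auto
    have "\<theta> \<otimes> (d \<otimes> x) \<otimes> (d \<otimes> y) = d \<otimes> (\<theta> \<otimes> d \<otimes> x \<otimes> y)"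
      using c d trace_step(1) by - (rule ring_eqI, (rule reify | (simp add: algebra_simps; fail))+)
    then have "\<theta> \<otimes> d \<otimes> x \<otimes> y = z"
      using z d c trace_step(1) W by (auto simp: m_lcancel)
    then show ?thesis using z by simp
  qed
  then have "\<theta> \<otimes> d \<otimes> w' \<oplus> s \<in> trace_set K W"
    using trace_step w' d by (intro trace_set.trace_step) auto
  moreover have "\<theta> \<otimes> d \<otimes> w' = \<theta> \<otimes> w"
    using w' W trace_step(1) d by (auto simp: m_assoc)
  ultimately show ?case by simp
qed

end

section \<open>Nakayama's lemma over the endomorphism ring of a module\<close>

locale noetherian_fraction_subring = fraction_subring +
  assumes noetherian: "\<lbrakk> \<And>W. W \<in> C \<Longrightarrow> submod K B W \<and> W \<subseteq> B; C \<noteq> {} \<rbrakk>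
      \<Longrightarrow> \<exists>W \<in> C. \<forall>W' \<in> C. W \<subseteq> W' \<longrightarrow> W' = W"
begin

text \<open>Nakayama's lemma for the module \<open>H\<close> over \<open>(W : W)\<close> and the ideal \<open>Th\<close> of the
  \<open>\<theta>\<close> with \<open>\<theta> W \<subseteq> (W : W)\<close>: as \<open>H = Th H\<close>, the ideal \<open>Th\<close> is trivial. A submodule \<open>N\<close> of \<open>H\<close>
  maximal among those not containing any \<open>(1 - \<nu>) H\<close>, \<open>\<nu> \<in> Th\<close>, would contain \<open>Th H\<close>.\<close>
lemma mult_closed_of_trace:
  assumes W: "submod K B W" "\<one> \<in> W" "\<one> \<in> trace_set K W"
    and H: "submod K B H" "H \<subseteq> B" "h0 \<in> H" "h0 \<noteq> \<zero>"
    and WH: "\<And>w h. w \<in> W \<Longrightarrow> h \<in> H \<Longrightarrow> w \<otimes> h \<in> H"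
    and xy: "x \<in> W" "y \<in> W"
  shows "x \<otimes> y \<in> W"
proof -
  define E where "E = {e \<in> carrier K. \<forall>x \<in> W. e \<otimes> x \<in> W}"
  define Th where "Th = {\<theta> \<in> carrier K. \<forall>x \<in> W. \<forall>y \<in> W. \<theta> \<otimes> x \<otimes> y \<in> W}"
  note Wc = submodD[OF W(1)] and Hc = submodD[OF H(1)]
  \<comment> \<open>Since \<open>\<one> \<in> W\<close>, there are inclusions
    \<open>Th \<subseteq> E \<subseteq> W\<close>. So the ring \<open>E = (W : W)\<close> acts on
    \<open>H\<close> through \<open>WH\<close>.\<close>
  have E_add: "e \<oplus> f \<in> E" if "e \<in> E" "f \<in> E" for e f
    using that Wc by (auto simp: E_def l_distr)
  have E_mult: "e \<otimes> f \<in> E" if "e \<in> E" "f \<in> E" for e f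
    using that Wc by (auto simp: E_def m_assoc)
  have E_B: "b \<in> E" if "b \<in> B" for b
    using that Wc by (auto simp: E_def)
  have E_c: "e \<in> carrier K" if "e \<in> E" for e
    using that by (simp add: E_def)
  have Th_c: "t \<in> carrier K" if "t \<in> Th" for t
    using that by (simp add: Th_def)
  have Th_E: "t \<in> E" if "t \<in> Th" for t
  proof -
    have "t \<otimes> x \<in> W" if "x \<in> W" for x
    proof -
      have "t \<otimes> x \<otimes> \<one> \<in> W"
        using \<open>t \<in> Th\<close> that W(2) unfolding Th_def by blast
      then show ?thesis
        using Wc(1)[OF that] Th_c[OF \<open>t \<in> Th\<close>] by simp
    qed
    then show ?thesis using Th_c[OF that] by (simp add: E_def)
  qed
  have E_W: "e \<in> W" if "e \<in> E" for e
  proof -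
    have "e \<otimes> \<one> \<in> W" using that W(2) unfolding E_def by blast
    then show ?thesis using E_c[OF that] by simp
  qed
  have Th_add: "s \<oplus> t \<in> Th" if "s \<in> Th" "t \<in> Th" for s t
    using that Wc by (auto simp: Th_def l_distr)
  have Th_mult: "e \<otimes> t \<in> Th" if "e \<in> E" "t \<in> Th" for e t
  proof -
    have "e \<otimes> t \<otimes> x \<otimes> y \<in> W" if "x \<in> W" "y \<in> W" for x y
    proof -
      have "e \<otimes> (t \<otimes> x \<otimes> y) \<in> W"
        using \<open>e \<in> E\<close> \<open>t \<in> Th\<close> that unfolding Th_def E_def by blast
      moreover have "e \<otimes> (t \<otimes> x \<otimes> y) = e \<otimes> t \<otimes> x \<otimes> y"
        using Wc(1)[OF that(1)] Wc(1)[OF that(2)] E_c[OF \<open>e \<in> E\<close>] Th_c[OF \<open>t \<in> Th\<close>]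
        by - (rule ring_eqI, (rule reify | (simp add: algebra_simps; fail))+)
      ultimately show ?thesis by simp
    qed
    moreover have "e \<otimes> t \<in> carrier K"
      using E_c[OF that(1)] Th_c[OF that(2)] by simp
    ultimately show ?thesis unfolding Th_def by blast
  qed
  have Th_minus: "s \<ominus> t \<in> Th" if "s \<in> Th" "t \<in> Th" for s t
  proof -
    have "\<ominus> \<one> \<otimes> t \<in> Th"
      by (rule Th_mult[OF E_B that(2)]) simp
    then show ?thesis
      using Th_add[OF that(1)] Th_c[OF that(2)] by (simp add: l_minus a_minus_def)
  qed
  have Th_0: "\<zero> \<in> Th"
    using Wc by (auto simp: Th_def)
  have EH: "e \<otimes> h \<in> H" if "e \<in> E" "h \<in> H" for e h
    using WH E_W that by blast
  have "\<one> \<in> Th"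
  proof (rule ccontr)
    assume no1: "\<one> \<notin> Th"
    define C where "C = {N. submod K B N \<and> N \<subseteq> H \<and> (\<forall>e \<in> E. \<forall>n \<in> N. e \<otimes> n \<in> N) \<and>
      (\<forall>v \<in> Th. \<exists>h \<in> H. (\<one> \<ominus> v) \<otimes> h \<notin> N)}"
    have "{\<zero>} \<in> C"
    proof -
      have "(\<one> \<ominus> v) \<otimes> h0 \<noteq> \<zero>" if "v \<in> Th" for v
        using that no1 H(4) Hc(1)[OF H(3)] Th_c[OF that]
        by (metis a_minus_def integral minus_closed one_closed r_right_minus_eq)
      then have "\<forall>v \<in> Th. \<exists>h \<in> H. (\<one> \<ominus> v) \<otimes> h \<notin> {\<zero>}"
        using H(3) by blast
      moreover have "\<forall>e \<in> E. \<forall>n \<in> {\<zero>}. e \<otimes> n \<in> {\<zero>}"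
        by (simp add: E_def)
      moreover have "submod K B {\<zero>}"
        by (rule submodI) auto
      moreover have "{\<zero>} \<subseteq> H"
        using Hc(2) by simp
      ultimately show ?thesis
        unfolding C_def mem_Collect_eq by (intro conjI)
    qed
    moreover have "submod K B N \<and> N \<subseteq> B" if "N \<in> C" for N
      using that H(2) by (auto simp: C_def)
    ultimately obtain N where N: "N \<in> C" "\<And>N'. N' \<in> C \<Longrightarrow> N \<subseteq> N' \<Longrightarrow> N' = N"
      using noetherian[of C] by blast
    have N': "submod K B N" "N \<subseteq> H" "\<And>e n. e \<in> E \<Longrightarrow> n \<in> N \<Longrightarrow> e \<otimes> n \<in> N"
      "\<And>v. v \<in> Th \<Longrightarrow> \<exists>h \<in> H. (\<one> \<ominus> v) \<otimes> h \<notin> N"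
      using N(1) unfolding C_def by blast+
    note Nc = submodD[OF N'(1)]
    have ThH: "v \<otimes> h \<in> N" if v: "v \<in> Th" and h: "h \<in> H" for v h
    proof (rule ccontr)
      assume vh: "v \<otimes> h \<notin> N"
      \<comment> \<open>\<open>N1 = N + E (v h)\<close> is strictly larger than \<open>N\<close>, so
        by maximality it contains some \<open>(1 - v') H\<close>.\<close>
      define N1 where "N1 = {n \<oplus> e \<otimes> (v \<otimes> h) | n e. n \<in> N \<and> e \<in> E}"
      have vc: "v \<in> carrier K" and hc: "h \<in> carrier K"
        using Th_c[OF v] Hc(1)[OF h] by auto
      have N1I: "n \<oplus> e \<otimes> (v \<otimes> h) \<in> N1" if "n \<in> N" "e \<in> E" for n e
        using that unfolding N1_def by blast
      have N1E: "\<exists>n e. n \<in> N \<and> e \<in> E \<and> z = n \<oplus> e \<otimes> (v \<otimes> h)" if "z \<in> N1" for z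
        using that unfolding N1_def by blast
      have N_N1: "N \<subseteq> N1"
      proof
        fix n assume n: "n \<in> N"
        then show "n \<in> N1"
          using N1I[OF n E_B[of \<zero>]] Nc(1)[OF n] vc hc by simp
      qed
      have vh_N1: "v \<otimes> h \<in> N1"
        using N1I[OF Nc(2) E_B[of \<one>]] vc hc by simp
      have N1_E: "e \<otimes> z \<in> N1" if e: "e \<in> E" and z: "z \<in> N1" for e z
      proof -
        obtain n f where nf: "n \<in> N" "f \<in> E" "z = n \<oplus> f \<otimes> (v \<otimes> h)"
          using N1E[OF z] by blast
        have "e \<otimes> z = e \<otimes> n \<oplus> e \<otimes> f \<otimes> (v \<otimes> h)"
          unfolding nf(3) using E_c[OF e] E_c[OF nf(2)] Nc(1)[OF nf(1)] vc hc
          by - (rule ring_eqI, (rule reify | (simp add: algebra_simps; fail))+)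
        then show ?thesis using N1I N'(3)[OF e nf(1)] E_mult[OF e nf(2)] by simp
      qed
      have N1_sub: "submod K B N1"
      proof (rule submodI)
        fix z assume "z \<in> N1"
        then show "z \<in> carrier K"
          using N1E[OF \<open>z \<in> N1\<close>] E_c Nc(1) vc hc by auto
      next
        show "\<zero> \<in> N1" using N_N1 Nc(2) by auto
      next
        fix z z' assume "z \<in> N1" "z' \<in> N1"
        then obtain n f n' f' where nf: "n \<in> N" "f \<in> E" "z = n \<oplus> f \<otimes> (v \<otimes> h)"
          "n' \<in> N" "f' \<in> E" "z' = n' \<oplus> f' \<otimes> (v \<otimes> h)"
          using N1E by meson
        have "z \<oplus> z' = (n \<oplus> n') \<oplus> (f \<oplus> f') \<otimes> (v \<otimes> h)"
          unfolding nf(3,6) using E_c[OF nf(2)] Nc(1)[OF nf(1)] E_c[OF nf(5)] Nc(1)[OF nf(4)] vc hc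
          by - (rule ring_eqI, (rule reify | (simp add: algebra_simps; fail))+)
        then show "z \<oplus> z' \<in> N1" using N1I Nc(3)[OF nf(1,4)] E_add[OF nf(2,5)] by simp
      next
        fix b z assume "b \<in> B" "z \<in> N1"
        then show "b \<otimes> z \<in> N1" using N1_E E_B by blast
      qed
      have N1_H: "N1 \<subseteq> H"
      proof
        fix z assume "z \<in> N1"
        then obtain n f where nf: "n \<in> N" "f \<in> E" "z = n \<oplus> f \<otimes> (v \<otimes> h)"
          using N1E by blast
        then show "z \<in> H"
          using N'(2) EH[OF Th_E[OF v] h] EH[OF nf(2)] Hc(3) by auto
      qed
      have "N1 \<notin> C"
        using N(2)[of N1] N_N1 vh_N1 vh by auto
      then obtain v' where v': "v' \<in> Th" "\<And>h'. h' \<in> H \<Longrightarrow> (\<one> \<ominus> v') \<otimes> h' \<in> N1"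
        using N1_sub N1_H N1_E by (auto simp: C_def)
      have v'c: "v' \<in> carrier K" using Th_c[OF v'(1)] .
      obtain n e where ne: "n \<in> N" "e \<in> E" "(\<one> \<ominus> v') \<otimes> h = n \<oplus> e \<otimes> (v \<otimes> h)"
        using N1E[OF v'(2)[OF h]] by blast
      \<comment> \<open>Applying \<open>\<one> \<ominus> v'\<close> to \<open>h\<close> itself gives
        \<open>n \<oplus> e \<otimes> (v \<otimes> h)\<close>. Moving the last term to the left
        shows that \<open>\<one> \<ominus> w\<close> carries \<open>h\<close> into
        \<open>N\<close>.\<close>
      define w where "w = v' \<oplus> e \<otimes> v"
      have w: "w \<in> Th" unfolding w_def using Th_add[OF v'(1) Th_mult[OF ne(2) v]] .
      have cs: "e \<in> carrier K" "n \<in> carrier K" "w \<in> carrier K"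
        using E_c[OF ne(2)] Nc(1)[OF ne(1)] Th_c[OF w] by auto
      have "(\<one> \<ominus> w) \<otimes> h = (\<one> \<ominus> v') \<otimes> h \<ominus> e \<otimes> (v \<otimes> h)"
        unfolding w_def using cs vc hc v'c by - (rule ring_eqI, (rule reify | (simp add: algebra_simps; fail))+)
      also have "\<dots> = n"
        unfolding ne(3) using cs vc hc by - (rule ring_eqI, (rule reify | (simp add: algebra_simps; fail))+)
      finally have wh: "(\<one> \<ominus> w) \<otimes> h = n" .
      \<comment> \<open>\<open>\<one> \<ominus> u\<close> is the product of
        \<open>\<one> \<ominus> w\<close> and \<open>\<one> \<ominus> v'\<close>: the second factor
        maps \<open>H\<close> into \<open>N1\<close>, and the first then maps the generator
        \<open>v \<otimes> h\<close> into \<open>N\<close>.\<close>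
      define u where "u = w \<oplus> v' \<ominus> w \<otimes> v'"
      have u: "u \<in> Th"
        unfolding u_def by (rule Th_minus[OF Th_add[OF w v'(1)] Th_mult[OF Th_E[OF w] v'(1)]])
      have "(\<one> \<ominus> u) \<otimes> h' \<in> N" if h': "h' \<in> H" for h'
      proof -
        obtain n' e' where ne': "n' \<in> N" "e' \<in> E" "(\<one> \<ominus> v') \<otimes> h' = n' \<oplus> e' \<otimes> (v \<otimes> h)"
          using N1E[OF v'(2)[OF h']] by blast
        have cs': "e' \<in> carrier K" "n' \<in> carrier K" "h' \<in> carrier K"
          using E_c[OF ne'(2)] Nc(1)[OF ne'(1)] Hc(1)[OF h'] by auto
        have "(\<one> \<ominus> u) \<otimes> h' = (\<one> \<ominus> w) \<otimes> ((\<one> \<ominus> v') \<otimes> h')"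
          unfolding u_def using cs cs' v'c by - (rule ring_eqI, (rule reify | (simp add: algebra_simps; fail))+)
        also have "\<dots> = n' \<ominus> w \<otimes> n' \<oplus> e' \<otimes> v \<otimes> ((\<one> \<ominus> w) \<otimes> h)"
          unfolding ne'(3) using cs cs' vc hc by - (rule ring_eqI, (rule reify | (simp add: algebra_simps; fail))+)
        also have "\<dots> = n' \<ominus> w \<otimes> n' \<oplus> e' \<otimes> v \<otimes> n"
          unfolding wh ..
        also have "\<dots> \<in> N"
          by (rule Nc(3)[OF Nc(6)[OF ne'(1) N'(3)[OF Th_E[OF w] ne'(1)]]
                N'(3)[OF E_mult[OF ne'(2) Th_E[OF v]] ne(1)]])
        finally show ?thesis .
      qed
      then show False using N'(4)[OF u] by auto
    qed
    \<comment> \<open>As \<open>\<one>\<close> is a sum of products \<open>t \<otimes> w\<close>,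
      every \<open>h\<close> is a sum of terms \<open>t \<otimes> (w \<otimes> h)\<close> in
      \<open>N\<close>. So \<open>H = N\<close>, against the choice of \<open>N\<close> for
      \<open>v = \<zero>\<close>.\<close>
    have "s \<otimes> h \<in> N" if "s \<in> trace_set K W" "h \<in> H" for s h
      using that(1)
    proof (induction s rule: trace_set.induct)
      case trace_zero
      then show ?case using Nc(2) Hc(1)[OF that(2)] by simp
    next
      case (trace_step t w s)
      have "t \<in> Th" using trace_step(1,3) by (simp add: Th_def)
      then have "t \<otimes> (w \<otimes> h) \<in> N"
        by (rule ThH[OF _ WH[OF trace_step(2) that(2)]])
      moreover have "s \<in> carrier K"
        using trace_step(4) by (induction rule: trace_set.induct) (auto simp: Wc(1))
      then have "(t \<otimes> w \<oplus> s) \<otimes> h = t \<otimes> (w \<otimes> h) \<oplus> s \<otimes> h"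
        using trace_step(1) Wc(1)[OF trace_step(2)] Hc(1)[OF that(2)] by (simp add: l_distr m_assoc)
      ultimately show ?case
        using trace_step.IH Nc(3) by simp
    qed
    from this[OF W(3)] have "h \<in> N" if "h \<in> H" for h
      using that Hc(1)[OF that] by (metis l_one)
    moreover obtain h where "h \<in> H" "(\<one> \<ominus> \<zero>) \<otimes> h \<notin> N"
      using N'(4)[OF Th_0] by auto
    ultimately show False
      using Hc(1) by (simp add: a_minus_def)
  qed
  then have "\<one> \<otimes> x \<otimes> y \<in> W"
    using xy unfolding Th_def by blast
  then show ?thesis using Wc(1)[OF xy(1)] by simp
qed

end

subsection \<open>Subrings all of whose ideals are stable\<close>

definition nonunits :: "('k, 'm) ring_scheme \<Rightarrow> 'k set \<Rightarrow> 'k set"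
  where "nonunits K B = {x \<in> B. \<forall>y \<in> B. x \<otimes>\<^bsub>K\<^esub> y \<noteq> \<one>\<^bsub>K\<^esub>}"

locale stable_subring = noetherian_fraction_subring +
  assumes stable: "\<lbrakk> submod K B W; W \<subseteq> B; W \<noteq> {\<zero>} \<rbrakk> \<Longrightarrow> \<one> \<in> trace_set K W"
begin

lemma span2_submod: "x \<in> carrier K \<Longrightarrow> y \<in> carrier K \<Longrightarrow>
    submod K B {b \<otimes> x \<oplus> c \<otimes> y | b c. b \<in> B \<and> c \<in> B}"
proof (rule submodI)
  fix u v assume x: "x \<in> carrier K" "y \<in> carrier K"
    and u: "u \<in> {b \<otimes> x \<oplus> c \<otimes> y | b c. b \<in> B \<and> c \<in> B}" "v \<in> {b \<otimes> x \<oplus> c \<otimes> y | b c. b \<in> B \<and> c \<in> B}"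
  then obtain b c b' c' where bc: "b \<in> B" "c \<in> B" "b' \<in> B" "c' \<in> B" "u = b \<otimes> x \<oplus> c \<otimes> y" "v = b' \<otimes> x \<oplus> c' \<otimes> y"
    by blast
  have "u \<oplus> v = (b \<oplus> b') \<otimes> x \<oplus> (c \<oplus> c') \<otimes> y"
    unfolding bc using x bc(1-4)[THEN B_carrier]
    by - (rule ring_eqI, (rule reify | (simp add: algebra_simps; fail))+)
  then show "u \<oplus> v \<in> {b \<otimes> x \<oplus> c \<otimes> y | b c. b \<in> B \<and> c \<in> B}"
    using bc B_closed(3) by blast
next
  fix d u assume x: "x \<in> carrier K" "y \<in> carrier K"
    and u: "d \<in> B" "u \<in> {b \<otimes> x \<oplus> c \<otimes> y | b c. b \<in> B \<and> c \<in> B}"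
  then obtain b c where bc: "b \<in> B" "c \<in> B" "u = b \<otimes> x \<oplus> c \<otimes> y"
    by blast
  have "d \<otimes> u = (d \<otimes> b) \<otimes> x \<oplus> (d \<otimes> c) \<otimes> y"
    unfolding bc using x bc(1,2)[THEN B_carrier] B_carrier[OF u(1)]
    by - (rule ring_eqI, (rule reify | (simp add: algebra_simps; fail))+)
  then show "d \<otimes> u \<in> {b \<otimes> x \<oplus> c \<otimes> y | b c. b \<in> B \<and> c \<in> B}"
    using bc u B_closed(4) by blast
next
  assume "x \<in> carrier K" "y \<in> carrier K"
  then have "\<zero> = \<zero> \<otimes> x \<oplus> \<zero> \<otimes> y" by simp
  then show "\<zero> \<in> {b \<otimes> x \<oplus> c \<otimes> y | b c. b \<in> B \<and> c \<in> B}"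
    using B_closed(1) by blast
qed auto

text \<open>The module \<open>B + Bx + By\<close> is a ring: \<open>mult_closed_of_trace\<close> applies to it after clearing denominators.\<close>
lemma product_in_span:
  assumes x: "x \<in> V" and y: "y \<in> V"
  shows "\<exists>a \<in> B. \<exists>b \<in> B. \<exists>c \<in> B. x \<otimes> y = a \<oplus> b \<otimes> x \<oplus> c \<otimes> y"
proof -
  have xc: "x \<in> carrier K" and yc: "y \<in> carrier K"
    using x y by auto
  define W where "W = {a \<oplus> u | a u. a \<in> B \<and> u \<in> {b \<otimes> x \<oplus> c \<otimes> y | b c. b \<in> B \<and> c \<in> B}}"
  note Sp = submodD[OF span2_submod[OF xc yc]]
  have WI: "a \<oplus> (b \<otimes> x \<oplus> c \<otimes> y) \<in> W" if "a \<in> B" "b \<in> B" "c \<in> B" for a b c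
    using that unfolding W_def by blast
  have WE: "\<exists>a b c. a \<in> B \<and> b \<in> B \<and> c \<in> B \<and> w = a \<oplus> (b \<otimes> x \<oplus> c \<otimes> y)" if "w \<in> W" for w
    using that unfolding W_def by blast
  have W: "submod K B W"
  proof (rule submodI)
    fix u v assume "u \<in> W" "v \<in> W"
    then obtain a b c a' b' c' where e: "a \<in> B" "b \<in> B" "c \<in> B" "a' \<in> B" "b' \<in> B" "c' \<in> B"
      "u = a \<oplus> (b \<otimes> x \<oplus> c \<otimes> y)" "v = a' \<oplus> (b' \<otimes> x \<oplus> c' \<otimes> y)"
      using WE by meson
    have "u \<oplus> v = (a \<oplus> a') \<oplus> ((b \<oplus> b') \<otimes> x \<oplus> (c \<oplus> c') \<otimes> y)"
      unfolding e using xc yc e(1-6)[THEN B_carrier]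
      by - (rule ring_eqI, (rule reify | (simp add: algebra_simps; fail))+)
    then show "u \<oplus> v \<in> W" using WI e by simp
  next
    fix d u assume d: "d \<in> B" "u \<in> W"
    then obtain a b c where e: "a \<in> B" "b \<in> B" "c \<in> B" "u = a \<oplus> (b \<otimes> x \<oplus> c \<otimes> y)"
      using WE by meson
    have "d \<otimes> u = (d \<otimes> a) \<oplus> ((d \<otimes> b) \<otimes> x \<oplus> (d \<otimes> c) \<otimes> y)"
      unfolding e using xc yc e(1-3)[THEN B_carrier] B_carrier[OF d(1)]
      by - (rule ring_eqI, (rule reify | (simp add: algebra_simps; fail))+)
    then show "d \<otimes> u \<in> W" using WI e d by simp
  next
    show "\<zero> \<in> W" using WI[of \<zero> \<zero> \<zero>] xc yc by simp
  next
    fix u assume "u \<in> W"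
    then show "u \<in> carrier K" using WE[of u] xc yc by auto
  qed
  have W1: "\<one> \<in> W" and Wx: "x \<in> W" and Wy: "y \<in> W"
    using WI[of \<one> \<zero> \<zero>] WI[of \<zero> \<one> \<zero>] WI[of \<zero> \<zero> \<one>] xc yc by simp_all
  obtain H h where H: "submod K B H" "H \<subseteq> B" "h \<in> H" "h \<noteq> \<zero>"
    "\<And>h. h \<in> H \<Longrightarrow> x \<otimes> h \<in> H" "\<And>h. h \<in> H \<Longrightarrow> y \<otimes> h \<in> H"
    using V_common[OF x y] by metis
  note Hc = submodD[OF H(1)]
  have WH: "w \<otimes> h \<in> H" if w: "w \<in> W" and h: "h \<in> H" for w h
  proof -
    obtain a b c where e: "a \<in> B" "b \<in> B" "c \<in> B" "w = a \<oplus> (b \<otimes> x \<oplus> c \<otimes> y)"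
      using WE[OF w] by blast
    have "w \<otimes> h = a \<otimes> h \<oplus> (b \<otimes> (x \<otimes> h) \<oplus> c \<otimes> (y \<otimes> h))"
      unfolding e(4) using xc yc e(1-3)[THEN B_carrier] Hc(1)[OF h]
      by - (rule ring_eqI, (rule reify | (simp add: algebra_simps; fail))+)
    then show ?thesis using e H(5)[OF h] H(6)[OF h] h Hc(3,4) by simp
  qed
  have hB: "h \<in> B" and hc: "h \<in> carrier K"
    using H by auto
  \<comment> \<open>An element \<open>h\<close> of \<open>H\<close> is a common denominator of
    \<open>W\<close>, because \<open>W\<close> maps \<open>H\<close> into
    \<open>H \<subseteq> B\<close>.\<close>
  have hW: "(\<otimes>) h ` W \<subseteq> B"
  proof
    fix u assume "u \<in> (\<otimes>) h ` W"
    then obtain w where w: "w \<in> W" "u = h \<otimes> w" by auto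
    then have "u = w \<otimes> h" using hc submodD(1)[OF W w(1)] by (simp add: m_comm)
    then show "u \<in> B" using WH[OF w(1) H(3)] H(2) by auto
  qed
  have "submod K B ((\<otimes>) h ` W)"
  proof (rule submodI)
    fix u v assume "u \<in> (\<otimes>) h ` W" "v \<in> (\<otimes>) h ` W"
    then obtain u' v' where e: "u' \<in> W" "v' \<in> W" "u = h \<otimes> u'" "v = h \<otimes> v'" by auto
    then have "u \<oplus> v = h \<otimes> (u' \<oplus> v')"
      using hc submodD(1)[OF W] by (simp add: r_distr)
    then show "u \<oplus> v \<in> (\<otimes>) h ` W" using submodD(3)[OF W e(1,2)] by auto
  next
    fix b u assume "b \<in> B" "u \<in> (\<otimes>) h ` W"
    then obtain u' where e: "b \<in> B" "u' \<in> W" "u = h \<otimes> u'" by auto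
    then have "b \<otimes> u = h \<otimes> (b \<otimes> u')"
      using hc submodD(1)[OF W] by (simp add: m_lcomm)
    then show "b \<otimes> u \<in> (\<otimes>) h ` W" using submodD(4)[OF W e(1,2)] by auto
  next
    have "\<zero> = h \<otimes> \<zero>" using hc by simp
    then show "\<zero> \<in> (\<otimes>) h ` W" using submodD(2)[OF W] by blast
  qed (use hW in auto)
  moreover have "(\<otimes>) h ` W \<noteq> {\<zero>}"
    using imageI[OF W1, of "(\<otimes>) h"] H(4) hc by auto
  ultimately have "\<one> \<in> trace_set K ((\<otimes>) h ` W)"
    using stable hW by blast
  then have "\<one> \<in> trace_set K W"
    using trace_scale[OF _ hc H(4)] submodD(1)[OF W] by blast
  from mult_closed_of_trace[OF W W1 this H(1,2,3,4) WH Wx Wy]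
  obtain a b c where e: "a \<in> B" "b \<in> B" "c \<in> B" "x \<otimes> y = a \<oplus> (b \<otimes> x \<oplus> c \<otimes> y)"
    using WE by blast
  then have "x \<otimes> y = a \<oplus> b \<otimes> x \<oplus> c \<otimes> y"
    using xc yc by (simp add: a_assoc)
  then show ?thesis using e by blast
qed

lemma quadratic:
  assumes x: "x \<in> V"
  shows "\<exists>a \<in> B. \<exists>b \<in> B. x \<otimes> x = a \<oplus> b \<otimes> x"
proof -
  obtain a b c where e: "a \<in> B" "b \<in> B" "c \<in> B" "x \<otimes> x = a \<oplus> b \<otimes> x \<oplus> c \<otimes> x"
    using product_in_span[OF x x] by blast
  then have "x \<otimes> x = a \<oplus> (b \<oplus> c) \<otimes> x"
    using x by (simp add: l_distr a_assoc)
  then show ?thesis using e B_closed(3) by blast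
qed

text \<open>The identity of \<open>product_in_span\<close>, multiplied by
  \<open>w \<otimes> w\<close>, with only one factor \<open>w\<close> taken out. If
  \<open>w\<close>, \<open>w \<otimes> v\<close> and \<open>w \<otimes> v'\<close> lie in
  \<open>B\<close>, it shows that \<open>w\<close> divides the product of the last two within
  \<open>B\<close>, although \<open>v\<close> and \<open>v'\<close> may lie outside.\<close>

lemma product_in_span_scaled:
  assumes w: "w \<in> carrier K" and v: "v \<in> V" "v' \<in> V"
  shows "\<exists>a \<in> B. \<exists>b \<in> B. \<exists>c \<in> B. (w \<otimes> v) \<otimes> (w \<otimes> v') = w \<otimes> (a \<otimes> w \<oplus> b \<otimes> (w \<otimes> v) \<oplus> c \<otimes> (w \<otimes> v'))"
proof -
  obtain a b c where e: "a \<in> B" "b \<in> B" "c \<in> B" "v \<otimes> v' = a \<oplus> b \<otimes> v \<oplus> c \<otimes> v'"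
    using product_in_span[OF v] by blast
  have "(w \<otimes> v) \<otimes> (w \<otimes> v') = w \<otimes> w \<otimes> (v \<otimes> v')"
    using w v[THEN V_carrier] by - (rule ring_eqI, (rule reify | (simp add: algebra_simps; fail))+)
  also have "\<dots> = w \<otimes> (a \<otimes> w \<oplus> b \<otimes> (w \<otimes> v) \<oplus> c \<otimes> (w \<otimes> v'))"
    unfolding e(4) using w v[THEN V_carrier] e(1-3)[THEN B_carrier]
    by - (rule ring_eqI, (rule reify | (simp add: algebra_simps; fail))+)
  finally show ?thesis using e(1-3) by blast
qed

end

section \<open>Local stable rings whose almost integral elements have no common denominator\<close>

locale bad_stable_subring = stable_subring +
  assumes local: "\<lbrakk> x \<in> nonunits K B; y \<in> nonunits K B \<rbrakk> \<Longrightarrow> x \<oplus> y \<in> nonunits K B"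
    and dim_one: "\<lbrakk> x \<in> nonunits K B; s \<in> B; s \<noteq> \<zero> \<rbrakk> \<Longrightarrow> \<exists>l :: nat. \<exists>b \<in> B. x [^] l = s \<otimes> b"
    and not_finite: "\<lbrakk> d \<in> B; d \<noteq> \<zero> \<rbrakk> \<Longrightarrow> \<exists>z \<in> almost_integral K B. d \<otimes> z \<notin> B"
begin

abbreviation M where "M \<equiv> nonunits K B"

lemma M_I: "x \<in> B \<Longrightarrow> (\<And>y. y \<in> B \<Longrightarrow> x \<otimes> y \<noteq> \<one>) \<Longrightarrow> x \<in> M"
  and M_D: "x \<in> M \<Longrightarrow> y \<in> B \<Longrightarrow> x \<otimes> y \<noteq> \<one>"
  and M_unit: "b \<in> B \<Longrightarrow> b \<notin> M \<Longrightarrow> \<exists>c \<in> B. b \<otimes> c = \<one>"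
  by (auto simp: nonunits_def)

lemma M_B [simp]: "x \<in> M \<Longrightarrow> x \<in> B"
  unfolding nonunits_def by blast

lemma M_mult [simp]:
  assumes b: "b \<in> B" and x: "x \<in> M"
  shows "b \<otimes> x \<in> M" "x \<otimes> b \<in> M"
proof -
  show "b \<otimes> x \<in> M"
  proof (rule M_I)
    fix y assume y: "y \<in> B"
    have "b \<otimes> x \<otimes> y = x \<otimes> (b \<otimes> y)"
      using B_carrier[OF b] B_carrier[OF M_B[OF x]] B_carrier[OF y]
      by - (rule ring_eqI, (rule reify | (simp add: algebra_simps; fail))+)
    then show "b \<otimes> x \<otimes> y \<noteq> \<one>"
      using M_D[OF x, of "b \<otimes> y"] b y by simp
  qed (use b x in simp)
  then show "x \<otimes> b \<in> M"
    using m_comm b x by simp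
qed

lemma M_zero [simp]: "\<zero> \<in> M"
  by (rule M_I) auto

lemma M_one [simp]: "\<one> \<notin> M"
  using M_D[of \<one> \<one>] by auto

lemma M_minus [simp]: "x \<in> M \<Longrightarrow> \<ominus> x \<in> M"
  using M_mult(1)[of "\<ominus> \<one>" x] by (simp add: l_minus)

lemma M_diff [simp]: "x \<in> M \<Longrightarrow> y \<in> M \<Longrightarrow> x \<ominus> y \<in> M"
  by (simp add: a_minus_def local)

text \<open>Here \<open>z\<close> is an integral element that is deep relative to \<open>x\<close>, in the sense that
  \<open>m^l\<close> is a denominator of \<open>x\<close> but not of \<open>z\<close>.\<close>
lemma deep_element:
  assumes x: "x \<in> V" and m: "m \<in> M" and mx: "m [^] l \<otimes> x \<in> B"
    and z: "z \<in> V" and mz: "m [^] Suc l \<otimes> z \<notin> B"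
  shows "\<exists>t \<in> B. (\<exists>v \<in> V. x \<ominus> t = m \<otimes> v) \<or>
    (\<exists>a \<in> M. \<exists>b \<in> M. (x \<ominus> t) \<otimes> (x \<ominus> t) = a \<oplus> b \<otimes> (x \<ominus> t) \<and> m [^] l \<otimes> (a \<otimes> z) \<in> B)"
proof -
  obtain r s t where rst: "r \<in> B" "s \<in> B" "t \<in> B" "x \<otimes> z = r \<oplus> s \<otimes> x \<oplus> t \<otimes> z"
    using product_in_span[OF x z] by blast
  \<comment> \<open>Shifting \<open>x\<close> by \<open>t\<close> removes the term in
    \<open>z\<close>: afterwards \<open>n \<otimes> z\<close> lies in
    \<open>B + B n\<close>.\<close>
  define n where "n = x \<ominus> t"
  define r' where "r' = r \<oplus> s \<otimes> t"
  have n: "n \<in> V" unfolding n_def using x rst B_subset_V by simp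
  have r': "r' \<in> B" using rst by (simp add: r'_def)
  obtain a b where ab: "a \<in> B" "b \<in> B" "n \<otimes> n = a \<oplus> b \<otimes> n"
    using quadratic[OF n] by blast
  have mB: "m \<in> B" using m by simp
  note cs = V_carrier[OF x] V_carrier[OF z] rst(1-3)[THEN B_carrier] V_carrier[OF n] B_carrier[OF r']
    ab(1,2)[THEN B_carrier] B_carrier[OF mB]
  have nz: "n \<otimes> z = r' \<oplus> s \<otimes> n"
  proof -
    have "n \<otimes> z = x \<otimes> z \<ominus> t \<otimes> z"
      unfolding n_def using cs by - (rule ring_eqI, (rule reify | (simp add: algebra_simps; fail))+)
    also have "\<dots> = r' \<oplus> s \<otimes> n"
      unfolding rst(4) n_def r'_def using cs by - (rule ring_eqI, (rule reify | (simp add: algebra_simps; fail))+)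
    finally show ?thesis .
  qed
  have mn: "m [^] l \<otimes> n \<in> B"
  proof -
    have "m [^] l \<otimes> n = m [^] l \<otimes> x \<ominus> m [^] l \<otimes> t"
      unfolding n_def using cs by - (rule ring_eqI, (rule reify | (simp add: algebra_simps; fail))+)
    then show ?thesis using mx mB rst by simp
  qed
  \<comment> \<open>Computing \<open>n n z\<close> in two ways leaves an expression for
    \<open>a \<otimes> z\<close> that is linear in \<open>n\<close> over \<open>B\<close>, so the
    denominator \<open>m [^] l\<close> of \<open>n\<close> suffices for it.\<close>
  have az: "m [^] l \<otimes> (a \<otimes> z) \<in> B"
  proof -
    have "a \<otimes> z = (a \<oplus> b \<otimes> n) \<otimes> z \<ominus> b \<otimes> (n \<otimes> z)"
      using cs by - (rule ring_eqI, (rule reify | (simp add: algebra_simps; fail))+)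
    also have "\<dots> = n \<otimes> (n \<otimes> z) \<ominus> b \<otimes> (n \<otimes> z)"
      unfolding ab(3)[symmetric] using cs by (simp add: m_assoc)
    also have "\<dots> = r' \<otimes> n \<oplus> s \<otimes> (n \<otimes> n) \<ominus> b \<otimes> (r' \<oplus> s \<otimes> n)"
      unfolding nz using cs by - (rule ring_eqI, (rule reify | (simp add: algebra_simps; fail))+)
    also have "\<dots> = r' \<otimes> n \<oplus> s \<otimes> a \<ominus> b \<otimes> r'"
      unfolding ab(3) using cs by - (rule ring_eqI, (rule reify | (simp add: algebra_simps; fail))+)
    finally have "m [^] l \<otimes> (a \<otimes> z) = m [^] l \<otimes> (r' \<otimes> n \<oplus> s \<otimes> a \<ominus> b \<otimes> r')"
      by simp
    also have "\<dots> = r' \<otimes> (m [^] l \<otimes> n) \<oplus> m [^] l \<otimes> (s \<otimes> a \<ominus> b \<otimes> r')"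
      using cs by - (rule ring_eqI, (rule reify | (simp add: algebra_simps; fail))+)
    finally show ?thesis using mn mB r' rst ab by simp
  qed
  have mz': "m [^] l \<otimes> z \<notin> B"
  proof
    assume "m [^] l \<otimes> z \<in> B"
    then have "m \<otimes> (m [^] l \<otimes> z) \<in> B" using mB by simp
    moreover have "m \<otimes> (m [^] l \<otimes> z) = m [^] Suc l \<otimes> z"
      using cs by - (rule ring_eqI, (rule reify | (simp add: algebra_simps; fail))+)
    ultimately show False using mz by simp
  qed
  have aM: "a \<in> M"
  proof (rule ccontr)
    assume "a \<notin> M"
    then obtain c where c: "c \<in> B" "a \<otimes> c = \<one>" using M_unit ab by blast
    have "c \<otimes> (m [^] l \<otimes> (a \<otimes> z)) = (a \<otimes> c) \<otimes> (m [^] l \<otimes> z)"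
      using cs B_carrier[OF c(1)] by - (rule ring_eqI, (rule reify | (simp add: algebra_simps; fail))+)
    then have "c \<otimes> (m [^] l \<otimes> (a \<otimes> z)) = m [^] l \<otimes> z"
      using cs c by simp
    then show False using mz' az c(1) by (metis B_closed(4))
  qed
  show ?thesis
  proof (cases "b \<in> M")
    case True
    then show ?thesis using aM ab(3) az rst(3) unfolding n_def by blast
  next
    case False
    \<comment> \<open>For a unit \<open>b\<close> the quadratic equation of
      \<open>n \<oplus> m \<otimes> z\<close> is compared with those of \<open>n\<close> and
      \<open>z\<close>. The result is \<open>cn\<close>, a linear relation between \<open>n\<close>
      and \<open>m \<otimes> z\<close> over \<open>B\<close>.\<close>
    obtain p q where pq: "p \<in> B" "q \<in> B" "z \<otimes> z = p \<oplus> q \<otimes> z"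
      using quadratic[OF z] by blast
    have "n \<oplus> m \<otimes> z \<in> V" using n z mB B_subset_V by simp
    then obtain f g where fg: "f \<in> B" "g \<in> B"
      "(n \<oplus> m \<otimes> z) \<otimes> (n \<oplus> m \<otimes> z) = f \<oplus> g \<otimes> (n \<oplus> m \<otimes> z)"
      using quadratic by blast
    note cs2 = cs pq(1,2)[THEN B_carrier] fg(1,2)[THEN B_carrier]
    have sq: "(n \<oplus> m \<otimes> z) \<otimes> (n \<oplus> m \<otimes> z) =
      a \<oplus> b \<otimes> n \<oplus> (m \<otimes> (r' \<oplus> s \<otimes> n) \<oplus> m \<otimes> (r' \<oplus> s \<otimes> n)) \<oplus> m \<otimes> m \<otimes> (p \<oplus> q \<otimes> z)"
      unfolding nz[symmetric] ab(3)[symmetric] pq(3)[symmetric] using cs2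
      by - (rule ring_eqI, (rule reify | (simp add: algebra_simps; fail))+)
    define c where "c = b \<oplus> (m \<otimes> s \<oplus> m \<otimes> s) \<ominus> g"
    define k where "k = f \<ominus> a \<ominus> (m \<otimes> r' \<oplus> m \<otimes> r') \<ominus> m \<otimes> m \<otimes> p"
    define e where "e = g \<ominus> m \<otimes> q"
    have B': "c \<in> B" "k \<in> B" "e \<in> B"
      using mB r' rst ab pq fg by (auto simp: c_def k_def e_def)
    have cn: "c \<otimes> n = k \<oplus> e \<otimes> (m \<otimes> z)"
    proof -
      have "c \<otimes> n \<ominus> (k \<oplus> e \<otimes> (m \<otimes> z)) =
        (a \<oplus> b \<otimes> n \<oplus> (m \<otimes> (r' \<oplus> s \<otimes> n) \<oplus> m \<otimes> (r' \<oplus> s \<otimes> n)) \<oplus> m \<otimes> m \<otimes> (p \<oplus> q \<otimes> z))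
        \<ominus> (f \<oplus> g \<otimes> (n \<oplus> m \<otimes> z))"
        unfolding c_def k_def e_def using cs2 by - (rule ring_eqI, (rule reify | (simp add: algebra_simps; fail))+)
      also have "\<dots> = \<zero>"
        unfolding sq[symmetric] fg(3)[symmetric] using cs2 by (simp add: a_minus_def r_neg)
      finally show ?thesis using cs2 B'[THEN B_carrier] by simp
    qed
    \<comment> \<open>If \<open>g\<close> were a unit, so would be the coefficient \<open>e\<close>
      of \<open>m \<otimes> z\<close>, and by the relation \<open>m [^] l\<close>, a denominator of
      \<open>n\<close>, would be one of \<open>m \<otimes> z\<close>.\<close>
    have gM: "g \<in> M"
    proof (rule ccontr)
      assume g: "g \<notin> M"
      have "g = e \<oplus> m \<otimes> q" unfolding e_def using cs2
        by - (rule ring_eqI, (rule reify | (simp add: algebra_simps; fail))+)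
      then have "e \<notin> M" using g m pq local by auto
      then obtain e' where e': "e' \<in> B" "e \<otimes> e' = \<one>" using M_unit B' by blast
      have "m \<otimes> z = (e \<otimes> e') \<otimes> (m \<otimes> z)" using e' cs2 by simp
      also have "\<dots> = e' \<otimes> (k \<oplus> e \<otimes> (m \<otimes> z) \<ominus> k)"
        using cs2 B'[THEN B_carrier] B_carrier[OF e'(1)]
        by - (rule ring_eqI, (rule reify | (simp add: algebra_simps; fail))+)
      also have "\<dots> = e' \<otimes> (c \<otimes> n \<ominus> k)" by (simp add: cn)
      finally have *: "m \<otimes> z = e' \<otimes> (c \<otimes> n \<ominus> k)" .
      have "m [^] Suc l \<otimes> z = m [^] l \<otimes> (m \<otimes> z)"
        using cs2 by - (rule ring_eqI, (rule reify | (simp add: algebra_simps; fail))+)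
      also have "\<dots> = e' \<otimes> (c \<otimes> (m [^] l \<otimes> n) \<ominus> m [^] l \<otimes> k)"
        unfolding * using cs2 B'[THEN B_carrier] B_carrier[OF e'(1)]
        by - (rule ring_eqI, (rule reify | (simp add: algebra_simps; fail))+)
      finally show False using mz mn B' e' mB by simp
    qed
    \<comment> \<open>The coefficient \<open>c\<close> differs from the unit \<open>b\<close> by a
      nonunit. So the relation can be solved for \<open>n\<close>, which puts \<open>n\<close> into
      \<open>B + m V\<close>.\<close>
    have "b = c \<ominus> (m \<otimes> s \<oplus> m \<otimes> s) \<oplus> g" unfolding c_def using cs2
      by - (rule ring_eqI, (rule reify | (simp add: algebra_simps; fail))+)
    then have "c \<notin> M" using False gM m rst local by auto
    then obtain c' where c': "c' \<in> B" "c \<otimes> c' = \<one>" using M_unit B' by blast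
    have "n = (c \<otimes> c') \<otimes> n" using c' cs2 by simp
    also have "\<dots> = c' \<otimes> (c \<otimes> n)" using cs2 B'[THEN B_carrier] B_carrier[OF c'(1)]
      by - (rule ring_eqI, (rule reify | (simp add: algebra_simps; fail))+)
    finally have *: "n = c' \<otimes> (k \<oplus> e \<otimes> (m \<otimes> z))" by (simp add: cn)
    have "x \<ominus> (t \<oplus> c' \<otimes> k) = n \<ominus> c' \<otimes> k"
      unfolding n_def using cs2 B'[THEN B_carrier] B_carrier[OF c'(1)]
      by - (rule ring_eqI, (rule reify | (simp add: algebra_simps; fail))+)
    also have "\<dots> = m \<otimes> (c' \<otimes> e \<otimes> z)"
      unfolding * using cs2 B'[THEN B_carrier] B_carrier[OF c'(1)]
      by - (rule ring_eqI, (rule reify | (simp add: algebra_simps; fail))+)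
    finally have "x \<ominus> (t \<oplus> c' \<otimes> k) = m \<otimes> (c' \<otimes> e \<otimes> z)" .
    moreover have "c' \<otimes> e \<otimes> z \<in> V" using c' B' z B_subset_V by simp
    moreover have "t \<oplus> c' \<otimes> k \<in> B" using c' B' rst by simp
    ultimately show ?thesis by blast
  qed
qed

section \<open>Units and nonunits of \<open>V\<close>\<close>

lemma nonunit_exists: "\<exists>m \<in> M. m \<noteq> \<zero>"
proof -
  obtain z where z: "z \<in> V" "\<one> \<otimes> z \<notin> B"
    using not_finite[of \<one>] by auto
  obtain s where s: "s \<in> B" "s \<noteq> \<zero>" "s \<otimes> z \<in> B"
    using denom[of z] z by auto
  have "s \<in> M"
  proof (rule ccontr)
    assume "s \<notin> M"
    then obtain c where c: "c \<in> B" "s \<otimes> c = \<one>" using M_unit s by blast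
    have "c \<otimes> (s \<otimes> z) = (s \<otimes> c) \<otimes> z"
      using V_carrier[OF z(1)] B_carrier[OF s(1)] B_carrier[OF c(1)]
      by - (rule ring_eqI, (rule reify | (simp add: algebra_simps; fail))+)
    then show False using c z s B_closed(4)[OF c(1) s(3)] by simp
  qed
  then show ?thesis using s by blast
qed

lemma power_denom:
  assumes m: "m \<in> M" and x: "x \<in> carrier K"
  shows "\<exists>l :: nat. m [^] l \<otimes> x \<in> B"
proof -
  obtain s where s: "s \<in> B" "s \<noteq> \<zero>" "s \<otimes> x \<in> B"
    using denom[OF x] by auto
  obtain l :: nat and b where l: "b \<in> B" "m [^] l = s \<otimes> b"
    using dim_one[OF m s(1,2)] by blast
  have "m [^] l \<otimes> x = b \<otimes> (s \<otimes> x)"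
    unfolding l using x B_carrier[OF l(1)] B_carrier[OF s(1)]
    by - (rule ring_eqI, (rule reify | (simp add: algebra_simps; fail))+)
  then show ?thesis using l s by (metis B_closed(4))
qed

lemma deep_exists:
  assumes m: "m \<in> M" "m \<noteq> \<zero>"
  shows "\<exists>z \<in> V. m [^] (l::nat) \<otimes> z \<notin> B"
proof (rule not_finite)
  show "m [^] l \<noteq> \<zero>"
    using m B_carrier[OF M_B] by (induction l) (auto simp: integral_iff)
qed (use m in simp)

text \<open>Some \<open>t \<in> B\<close> leaves \<open>n = x \<ominus> t\<close> with
  \<open>n \<otimes> n \<in> M + M n\<close>: both cases of \<open>deep_element\<close> give this,
  and a suitable \<open>z\<close> exists as no power of \<open>m\<close> is a common denominator of
  \<open>V\<close>. A unit \<open>t\<close> would make \<open>x\<close> a unit; for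
  \<open>t \<in> M\<close> the square of \<open>t \<oplus> n\<close> is expanded.\<close>

lemma V_nonunit:
  assumes x: "x \<in> V" and nu: "\<And>y. y \<in> V \<Longrightarrow> x \<otimes> y \<noteq> \<one>"
  shows "\<exists>a \<in> M. \<exists>b \<in> M. x \<otimes> x = a \<oplus> b \<otimes> x"
proof -
  obtain m where m: "m \<in> M" "m \<noteq> \<zero>" using nonunit_exists by blast
  obtain l :: nat where l: "m [^] l \<otimes> x \<in> B" using power_denom[OF m(1) V_carrier[OF x]] by blast
  obtain z where z: "z \<in> V" "m [^] Suc l \<otimes> z \<notin> B" using deep_exists[OF m] by blast
  obtain t where t: "t \<in> B" "(\<exists>v \<in> V. x \<ominus> t = m \<otimes> v) \<or>
    (\<exists>a \<in> M. \<exists>b \<in> M. (x \<ominus> t) \<otimes> (x \<ominus> t) = a \<oplus> b \<otimes> (x \<ominus> t) \<and> m [^] l \<otimes> (a \<otimes> z) \<in> B)"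
    using deep_element[OF x m(1) l z] by blast
  have mc: "m \<in> carrier K" using m by auto
  define n where "n = x \<ominus> t"
  have nc: "n \<in> carrier K" and nV: "n \<in> V" using x t B_subset_V by (simp_all add: n_def)
  obtain a b where ab: "a \<in> M" "b \<in> M" "n \<otimes> n = a \<oplus> b \<otimes> n"
    using t(2)
  proof
    assume "\<exists>v \<in> V. x \<ominus> t = m \<otimes> v"
    then obtain v where v: "v \<in> V" "n = m \<otimes> v" by (auto simp: n_def)
    obtain p q where pq: "p \<in> B" "q \<in> B" "v \<otimes> v = p \<oplus> q \<otimes> v"
      using quadratic[OF v(1)] by blast
    have "n \<otimes> n = m \<otimes> m \<otimes> (v \<otimes> v)"
      unfolding v(2) using mc V_carrier[OF v(1)]
      by - (rule ring_eqI, (rule reify | (simp add: algebra_simps; fail))+)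
    also have "\<dots> = (m \<otimes> p) \<otimes> m \<oplus> (m \<otimes> q) \<otimes> n"
      unfolding pq(3) v(2) using mc V_carrier[OF v(1)] pq(1,2)[THEN B_carrier]
      by - (rule ring_eqI, (rule reify | (simp add: algebra_simps; fail))+)
    finally show thesis by (rule that[rotated -1]) (use m pq in auto)
  qed (use that in \<open>auto simp: n_def\<close>)
  note cs = nc ab(1,2)[THEN M_B, THEN B_carrier] B_carrier[OF t(1)] V_carrier[OF x]
  have xn: "x = t \<oplus> n" unfolding n_def using cs
    by - (rule ring_eqI, (rule reify | (simp add: algebra_simps; fail))+)
  have tM: "t \<in> M"
  proof (rule ccontr)
    assume t': "t \<notin> M"
    \<comment> \<open>The norm of \<open>x = t \<oplus> n\<close> for the quadratic equation of
      \<open>n\<close>: the conjugate of \<open>n\<close> is \<open>b \<ominus> n\<close>, and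
      \<open>x \<otimes> (t \<oplus> b \<ominus> n) = u\<close>. It is a unit of \<open>B\<close>
      since \<open>t\<close> is one while \<open>a\<close> and \<open>b\<close> lie in
      \<open>M\<close>.\<close>
    define u where "u = t \<otimes> t \<oplus> t \<otimes> b \<ominus> a"
    have uB: "u \<in> B" using t ab by (simp add: u_def)
    have tt: "t \<otimes> t = u \<oplus> (a \<ominus> t \<otimes> b)" unfolding u_def using cs
      by - (rule ring_eqI, (rule reify | (simp add: algebra_simps; fail))+)
    have "t \<otimes> t \<notin> M"
    proof
      assume tt: "t \<otimes> t \<in> M"
      obtain t1 where t1: "t1 \<in> B" "t \<otimes> t1 = \<one>" using M_unit[OF t(1) t'] by blast
      have "t1 \<otimes> (t \<otimes> t) = t \<otimes> t1 \<otimes> t" using cs B_carrier[OF t1(1)]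
        by - (rule ring_eqI, (rule reify | (simp add: algebra_simps; fail))+)
      then have "t1 \<otimes> (t \<otimes> t) = t" using t1 cs by simp
      then show False using M_mult(1)[OF t1(1) tt] t' by simp
    qed
    then have "u \<notin> M" using tt ab t local[of u "a \<ominus> t \<otimes> b"] by auto
    then obtain c where c: "c \<in> B" "u \<otimes> c = \<one>" using M_unit uB by blast
    have "x \<otimes> (t \<oplus> b \<ominus> n) = t \<otimes> t \<oplus> t \<otimes> b \<oplus> b \<otimes> n \<ominus> n \<otimes> n"
      unfolding xn using cs by - (rule ring_eqI, (rule reify | (simp add: algebra_simps; fail))+)
    also have "\<dots> = u" unfolding ab(3) u_def using cs
      by - (rule ring_eqI, (rule reify | (simp add: algebra_simps; fail))+)
    finally have "x \<otimes> ((t \<oplus> b \<ominus> n) \<otimes> c) = \<one>"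
      using c cs B_carrier[OF c(1)] by (simp add: m_assoc[symmetric])
    moreover have "(t \<oplus> b \<ominus> n) \<otimes> c \<in> V" using t ab c nV B_subset_V by simp
    ultimately show False using nu by blast
  qed
  have "x \<otimes> x = t \<otimes> t \<oplus> t \<otimes> n \<oplus> t \<otimes> n \<oplus> n \<otimes> n"
    unfolding xn using cs by - (rule ring_eqI, (rule reify | (simp add: algebra_simps; fail))+)
  also have "\<dots> = (t \<otimes> t \<oplus> a \<ominus> t \<otimes> t \<ominus> t \<otimes> t \<ominus> b \<otimes> t) \<oplus> (t \<oplus> t \<oplus> b) \<otimes> x"
    unfolding ab(3) xn using cs by - (rule ring_eqI, (rule reify | (simp add: algebra_simps; fail))+)
  finally have "x \<otimes> x = (t \<otimes> t \<oplus> a \<ominus> t \<otimes> t \<ominus> t \<otimes> t \<ominus> b \<otimes> t) \<oplus> (t \<oplus> t \<oplus> b) \<otimes> x" .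
  moreover have "t \<otimes> t \<oplus> a \<ominus> t \<otimes> t \<ominus> t \<otimes> t \<ominus> b \<otimes> t \<in> M" "t \<oplus> t \<oplus> b \<in> M"
    using tM ab by (simp_all add: local)
  ultimately show ?thesis by blast
qed

text \<open>Again by a norm: \<open>(\<one> \<ominus> x) \<otimes> (\<one> \<ominus> b \<oplus> x) =
  \<one> \<ominus> b \<ominus> a\<close>, a unit of \<open>B\<close> as \<open>a\<close> and
  \<open>b\<close> are nonunits.\<close>

lemma V_one_minus_unit:
  assumes x: "x \<in> V" and nu: "\<And>y. y \<in> V \<Longrightarrow> x \<otimes> y \<noteq> \<one>"
  shows "\<exists>y \<in> V. (\<one> \<ominus> x) \<otimes> y = \<one>"
proof -
  obtain a b where ab: "a \<in> M" "b \<in> M" "x \<otimes> x = a \<oplus> b \<otimes> x"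
    using V_nonunit[OF assms] by blast
  note cs = V_carrier[OF x] ab(1,2)[THEN M_B, THEN B_carrier]
  have "\<one> = (\<one> \<ominus> b \<ominus> a) \<oplus> (b \<oplus> a)" using cs
    by - (rule ring_eqI, (rule reify | (simp add: algebra_simps; fail))+)
  moreover have "b \<oplus> a \<in> M" using ab local by simp
  ultimately have "\<one> \<ominus> b \<ominus> a \<notin> M" using local M_one by metis
  then obtain c where c: "c \<in> B" "(\<one> \<ominus> b \<ominus> a) \<otimes> c = \<one>" using M_unit[of "\<one> \<ominus> b \<ominus> a"] ab by auto
  have "(\<one> \<ominus> x) \<otimes> (\<one> \<ominus> b \<oplus> x) = \<one> \<ominus> b \<oplus> b \<otimes> x \<ominus> x \<otimes> x"
    using cs by - (rule ring_eqI, (rule reify | (simp add: algebra_simps; fail))+)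
  also have "\<dots> = \<one> \<ominus> b \<ominus> a" unfolding ab(3) using cs
    by - (rule ring_eqI, (rule reify | (simp add: algebra_simps; fail))+)
  finally have "(\<one> \<ominus> x) \<otimes> ((\<one> \<ominus> b \<oplus> x) \<otimes> c) = \<one>"
    using c cs B_carrier[OF c(1)] by (simp add: m_assoc[symmetric])
  moreover have "(\<one> \<ominus> b \<oplus> x) \<otimes> c \<in> V" using x ab c B_subset_V by simp
  ultimately show ?thesis by blast
qed

text \<open>Locality of \<open>V\<close> in additive form. If \<open>x \<otimes> u\<close> is not a
  unit, then \<open>\<one> \<ominus> x \<otimes> u\<close>, which is \<open>y \<otimes> u\<close>,
  is one.\<close>

lemma V_local:
  assumes x: "x \<in> V" and y: "y \<in> V" and u: "u \<in> V" "(x \<oplus> y) \<otimes> u = \<one>"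
  shows "(\<exists>v \<in> V. x \<otimes> v = \<one>) \<or> (\<exists>v \<in> V. y \<otimes> v = \<one>)"
proof (cases "\<exists>v \<in> V. (x \<otimes> u) \<otimes> v = \<one>")
  case True
  then obtain v where "v \<in> V" "(x \<otimes> u) \<otimes> v = \<one>" by blast
  then have "x \<otimes> (u \<otimes> v) = \<one>" "u \<otimes> v \<in> V" using x u by (simp_all add: m_assoc)
  then show ?thesis by blast
next
  case False
  then obtain v where v: "v \<in> V" "(\<one> \<ominus> x \<otimes> u) \<otimes> v = \<one>"
    using V_one_minus_unit[of "x \<otimes> u"] x u by auto
  have "\<one> \<ominus> x \<otimes> u = (x \<oplus> y) \<otimes> u \<ominus> x \<otimes> u" by (simp add: u)
  also have "\<dots> = y \<otimes> u" using x y u V_carrier[OF x] V_carrier[OF y] V_carrier[OF u(1)]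
    by - (rule ring_eqI, (rule reify | (simp add: algebra_simps; fail))+)
  finally have "y \<otimes> (u \<otimes> v) = \<one>" using v y u by (simp add: m_assoc)
  moreover have "u \<otimes> v \<in> V" using u v by simp
  ultimately show ?thesis by blast
qed

text \<open>In a local ring a sum that is a unit has a unit among its terms. Applied to the
  expression of \<open>\<one>\<close> as a sum of products \<open>\<theta> \<otimes> w\<close> in
  \<open>V\<close>, this gives a single \<open>w\<close> with
  \<open>x = w \<otimes> (\<theta> \<otimes> x \<otimes> u)\<close> for all
  \<open>x \<in> W\<close>.\<close>

lemma generator_exists:
  assumes W: "submod K B W" "W \<subseteq> B" "W \<noteq> {\<zero>}"
  shows "\<exists>w \<in> W. w \<noteq> \<zero> \<and> (\<forall>x \<in> W. \<exists>v \<in> V. x = w \<otimes> v)"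
proof -
  note Wc = submodD[OF W(1)]
  obtain h where h: "h \<in> W" "h \<noteq> \<zero>" using W Wc(2) by blast
  have EV: "e \<in> V" if "e \<in> carrier K" "\<And>x. x \<in> W \<Longrightarrow> e \<otimes> x \<in> W" for e
    by (rule V_I[OF that(1) W(2) h that(2)])
  have EV': "\<theta> \<otimes> x \<in> V" if "\<theta> \<in> carrier K" "\<And>x y. x \<in> W \<Longrightarrow> y \<in> W \<Longrightarrow> \<theta> \<otimes> x \<otimes> y \<in> W" "x \<in> W" for \<theta> x
    by (rule EV) (use that Wc(1) in auto)
  have *: "s \<in> V \<and> ((\<exists>u \<in> V. s \<otimes> u = \<one>) \<longrightarrow> (\<exists>\<theta> w u. \<theta> \<in> carrier K \<and> w \<in> W \<and>
      (\<forall>x \<in> W. \<theta> \<otimes> x \<in> V) \<and> u \<in> V \<and> \<theta> \<otimes> w \<otimes> u = \<one>))" if "s \<in> trace_set K W" for s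
    using that
  proof (induction s rule: trace_set.induct)
    case trace_zero
    then show ?case by auto
  next
    case (trace_step \<theta> w s)
    have tV: "\<theta> \<otimes> x \<in> V" if "x \<in> W" for x
      using EV'[OF trace_step(1,3) that] by blast
    show ?case
    proof (intro conjI impI)
      show "\<theta> \<otimes> w \<oplus> s \<in> V" using tV[OF trace_step(2)] trace_step.IH by simp
      assume "\<exists>u \<in> V. (\<theta> \<otimes> w \<oplus> s) \<otimes> u = \<one>"
      then obtain u where "u \<in> V" "(\<theta> \<otimes> w \<oplus> s) \<otimes> u = \<one>" by blast
      from V_local[OF tV[OF trace_step(2)] _ this] trace_step.IH
      consider v where "v \<in> V" "\<theta> \<otimes> w \<otimes> v = \<one>" | "\<exists>u \<in> V. s \<otimes> u = \<one>" by blast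
      then show "\<exists>\<theta> w u. \<theta> \<in> carrier K \<and> w \<in> W \<and> (\<forall>x \<in> W. \<theta> \<otimes> x \<in> V) \<and> u \<in> V \<and> \<theta> \<otimes> w \<otimes> u = \<one>"
        by cases (use tV trace_step(1,2) trace_step.IH in blast)+
    qed
  qed
  have "\<one> \<otimes> \<one> = \<one>" by simp
  then obtain \<theta> w u where t: "\<theta> \<in> carrier K" "w \<in> W" "\<forall>x \<in> W. \<theta> \<otimes> x \<in> V" "u \<in> V" "\<theta> \<otimes> w \<otimes> u = \<one>"
    using *[OF stable[OF W]] V_consts(2) by meson
  have "w \<noteq> \<zero>" using t by auto
  moreover have "\<exists>v \<in> V. x = w \<otimes> v" if x: "x \<in> W" for x
  proof
    have "x = (\<theta> \<otimes> w \<otimes> u) \<otimes> x" using t(5) Wc(1)[OF x] by simp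
    also have "\<dots> = w \<otimes> (\<theta> \<otimes> x \<otimes> u)"
      using t(1) Wc(1)[OF t(2)] Wc(1)[OF x] V_carrier[OF t(4)]
      by - (rule ring_eqI, (rule reify | (simp add: algebra_simps; fail))+)
    finally show "x = w \<otimes> (\<theta> \<otimes> x \<otimes> u)" .
    show "\<theta> \<otimes> x \<otimes> u \<in> V" using t x by simp
  qed
  ultimately show ?thesis using t by blast
qed

text \<open>The ideal \<open>B x + B y\<close> has a member \<open>w\<close> that generates it over
  \<open>V\<close>. Writing \<open>w\<close> as a combination of \<open>x = w v\<close> and
  \<open>y = w v'\<close> gives \<open>b v + c v' = \<one>\<close>, so by locality \<open>v\<close>
  or \<open>v'\<close> is a unit, and \<open>x\<close> or \<open>y\<close> is itself a
  generator.\<close>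

lemma V_valuation_B:
  assumes x: "x \<in> B" and y: "y \<in> B"
  shows "(\<exists>v \<in> V. x = y \<otimes> v) \<or> (\<exists>v \<in> V. y = x \<otimes> v)"
proof (cases "x = \<zero> \<and> y = \<zero>")
  case True
  then have "x = y \<otimes> \<zero>" by simp
  then show ?thesis using V_consts(1) by blast
next
  case False
  have xc: "x \<in> carrier K" and yc: "y \<in> carrier K" using x y by auto
  define W where "W = {b \<otimes> x \<oplus> c \<otimes> y | b c. b \<in> B \<and> c \<in> B}"
  have W: "submod K B W" unfolding W_def by (rule span2_submod[OF xc yc])
  have WB: "W \<subseteq> B" using x y by (auto simp: W_def)
  have "\<one> \<otimes> x \<oplus> \<zero> \<otimes> y \<in> W" "\<zero> \<otimes> x \<oplus> \<one> \<otimes> y \<in> W"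
    unfolding W_def using B_closed(1,2) by blast+
  then have xW: "x \<in> W" and yW: "y \<in> W" using xc yc by simp_all
  then have "W \<noteq> {\<zero>}" using False by auto
  then obtain w where w: "w \<in> W" "w \<noteq> \<zero>" "\<forall>x \<in> W. \<exists>v \<in> V. x = w \<otimes> v"
    using generator_exists[OF W WB] by blast
  obtain v v' where v: "v \<in> V" "v' \<in> V" "x = w \<otimes> v" "y = w \<otimes> v'" using w(3) xW yW by blast
  obtain b c where bc: "b \<in> B" "c \<in> B" "w = b \<otimes> x \<oplus> c \<otimes> y" using w(1) unfolding W_def by blast
  note cs = bc(1,2)[THEN B_carrier] v(1,2)[THEN V_carrier] submodD(1)[OF W w(1)]
  have "w \<otimes> (b \<otimes> v \<oplus> c \<otimes> v') = b \<otimes> (w \<otimes> v) \<oplus> c \<otimes> (w \<otimes> v')"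
    using cs by - (rule ring_eqI, (rule reify | (simp add: algebra_simps; fail))+)
  also have "\<dots> = w \<otimes> \<one>" using bc v cs by simp
  finally have "b \<otimes> v \<oplus> c \<otimes> v' = \<one>" using w(2) cs by (subst (asm) m_lcancel) auto
  then have "(b \<otimes> v \<oplus> c \<otimes> v') \<otimes> \<one> = \<one>" by simp
  from V_local[OF _ _ V_consts(2) this]
  consider u where "u \<in> V" "b \<otimes> v \<otimes> u = \<one>" | u where "u \<in> V" "c \<otimes> v' \<otimes> u = \<one>"
    using bc v B_subset_V by auto
  then show ?thesis
  proof cases
    case (1 u)
    have uc: "u \<in> carrier K" using 1 by simp
    have "y = y \<otimes> (b \<otimes> v \<otimes> u)" using 1 yc by simp
    also have "\<dots> = x \<otimes> (b \<otimes> u \<otimes> v')" unfolding v using cs uc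
      by - (rule ring_eqI, (rule reify | (simp add: algebra_simps; fail))+)
    finally have "y = x \<otimes> (b \<otimes> u \<otimes> v')" .
    moreover have "b \<otimes> u \<otimes> v' \<in> V" using 1 bc v B_subset_V by simp
    ultimately show ?thesis by blast
  next
    case (2 u)
    have uc: "u \<in> carrier K" using 2 by simp
    have "x = x \<otimes> (c \<otimes> v' \<otimes> u)" using 2 xc by simp
    also have "\<dots> = y \<otimes> (c \<otimes> u \<otimes> v)" unfolding v using cs uc
      by - (rule ring_eqI, (rule reify | (simp add: algebra_simps; fail))+)
    finally have "x = y \<otimes> (c \<otimes> u \<otimes> v)" .
    moreover have "c \<otimes> u \<otimes> v \<in> V" using 2 bc v B_subset_V by simp
    ultimately show ?thesis by blast
  qed
qed

lemma V_valuation: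
  assumes x: "x \<in> carrier K" and y: "y \<in> carrier K"
  shows "(\<exists>v \<in> V. x = y \<otimes> v) \<or> (\<exists>v \<in> V. y = x \<otimes> v)"
proof -
  obtain s t where st: "s \<in> B" "s \<noteq> \<zero>" "s \<otimes> x \<in> B" "t \<in> B" "t \<noteq> \<zero>" "t \<otimes> y \<in> B"
    using denom[OF x] denom[OF y] by blast
  have d: "s \<otimes> t \<in> carrier K" "s \<otimes> t \<noteq> \<zero>" using st by (auto simp: integral_iff)
  have "s \<otimes> t \<otimes> x = t \<otimes> (s \<otimes> x)" "s \<otimes> t \<otimes> y = s \<otimes> (t \<otimes> y)"
    using st x y by (simp_all add: m_ac)
  then have "s \<otimes> t \<otimes> x \<in> B" "s \<otimes> t \<otimes> y \<in> B" using st by simp_all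
  from V_valuation_B[OF this]
  consider v where "v \<in> V" "s \<otimes> t \<otimes> x = s \<otimes> t \<otimes> y \<otimes> v" | v where "v \<in> V" "s \<otimes> t \<otimes> y = s \<otimes> t \<otimes> x \<otimes> v"
    by blast
  then show ?thesis
    by cases (use d x y in \<open>auto simp: m_assoc[of "s \<otimes> t"] m_lcancel\<close>)
qed

text \<open>The generator \<open>m\<close> of the ideal of nonunits is the candidate. If
  \<open>x\<close> were not in \<open>B + m V\<close>, then \<open>deep_element\<close> would give
  \<open>n = x \<ominus> t\<close> outside \<open>m V\<close> with
  \<open>n \<otimes> n = a \<oplus> b \<otimes> n\<close> and \<open>m^l a z \<in> B\<close>. As
  divisibility in \<open>V\<close> is total, \<open>n\<close> divides \<open>m\<close>; this leads
  to \<open>m^2 \<in> a V\<close> and to \<open>m^4 \<in> a B\<close>, so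
  \<open>m^(4 + l) z \<in> B\<close>, contrary to the choice of \<open>z\<close>.\<close>

theorem uniformizer_exists:
  "\<exists>m \<in> M. m \<noteq> \<zero> \<and> (\<forall>x \<in> M. \<exists>v \<in> V. x = m \<otimes> v) \<and> (\<forall>x \<in> V. \<exists>t \<in> B. \<exists>v \<in> V. x = t \<oplus> m \<otimes> v)"
proof -
  have "submod K B M" by (rule submodI) (auto simp: local)
  moreover have "M \<noteq> {\<zero>}" using nonunit_exists by blast
  ultimately obtain m where m: "m \<in> M" "m \<noteq> \<zero>" "\<And>x. x \<in> M \<Longrightarrow> \<exists>v \<in> V. x = m \<otimes> v"
    using generator_exists[of M] by (meson M_B subsetI)
  have mc: "m \<in> carrier K" using m by auto
  have approx: "\<exists>t \<in> B. \<exists>v \<in> V. x \<ominus> t = m \<otimes> v" if x: "x \<in> V" for x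
  proof (rule ccontr)
    assume contra: "\<not> ?thesis"
    obtain l :: nat where l: "m [^] l \<otimes> x \<in> B" using power_denom[OF m(1) V_carrier[OF x]] by blast
    \<comment> \<open>\<open>deep_element\<close> asks for the exponent \<open>Suc l\<close>. It is
      raised to \<open>4 + l\<close> because \<open>m^4\<close> will turn out to be a multiple of
      \<open>a\<close> in \<open>B\<close>.\<close>
    obtain z where z: "z \<in> V" "m [^] (4 + l) \<otimes> z \<notin> B" using deep_exists[OF m(1,2)] by blast
    have zc: "z \<in> carrier K" using z by simp
    have "m [^] Suc l \<otimes> z \<notin> B"
    proof
      assume "m [^] Suc l \<otimes> z \<in> B"
      then have "m [^] (3::nat) \<otimes> (m [^] Suc l \<otimes> z) \<in> B" using m by simp
      moreover have "m [^] (3::nat) \<otimes> (m [^] Suc l \<otimes> z) = m [^] (4 + l) \<otimes> z"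
        using mc zc
        by - (rule ring_eqI, (rule reify | (simp add: power_add eval_nat_numeral algebra_simps; fail))+)
      ultimately show False using z by simp
    qed
    from deep_element[OF x m(1) l z(1) this] contra obtain t a b where
      t: "t \<in> B" "a \<in> M" "b \<in> M" "(x \<ominus> t) \<otimes> (x \<ominus> t) = a \<oplus> b \<otimes> (x \<ominus> t)" "m [^] l \<otimes> (a \<otimes> z) \<in> B"
      by blast
    define n where "n = x \<ominus> t"
    have n: "n \<in> V" "n \<in> carrier K" using t x B_subset_V by (simp_all add: n_def)
    have nm: "n \<noteq> m \<otimes> v" if "v \<in> V" for v using contra that t by (auto simp: n_def)
    then obtain g where g: "g \<in> V" "m = n \<otimes> g" using V_valuation[OF n(2) mc] by blast
    have g_nu: "g \<otimes> y \<noteq> \<one>" if y: "y \<in> V" for y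
    proof
      assume "g \<otimes> y = \<one>"
      moreover have "m \<otimes> y = n \<otimes> (g \<otimes> y)" using g n y by (simp add: m_assoc)
      ultimately have "n = m \<otimes> y" using n by simp
      then show False using nm y by blast
    qed
    obtain h where h: "h \<in> V" "b = m \<otimes> h" using m(3)[OF t(3)] by blast
    note cs = n(2) g(1)[THEN V_carrier] h(1)[THEN V_carrier] t(2)[THEN M_B, THEN B_carrier] mc zc
    have "g \<otimes> h \<otimes> y \<noteq> \<one>" if "y \<in> V" for y
      using g_nu[of "h \<otimes> y"] that h g by (simp add: m_assoc)
    then obtain u where u: "u \<in> V" "(\<one> \<ominus> g \<otimes> h) \<otimes> u = \<one>"
      using V_one_minus_unit[of "g \<otimes> h"] g h by auto
    have uc: "u \<in> carrier K" using u by simp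
    \<comment> \<open>Up to the unit \<open>\<one> \<ominus> g \<otimes> h\<close> of
      \<open>V\<close>, the element \<open>a\<close> is the square of \<open>n\<close>.\<close>
    have "a = a \<oplus> b \<otimes> n \<ominus> n \<otimes> g \<otimes> h \<otimes> n"
      unfolding h(2) g(2)[symmetric] using cs by - (rule ring_eqI, (rule reify | (simp add: algebra_simps; fail))+)
    also have "\<dots> = n \<otimes> n \<ominus> n \<otimes> g \<otimes> h \<otimes> n"
      using t(4) by (simp add: n_def)
    also have "\<dots> = n \<otimes> n \<otimes> (\<one> \<ominus> g \<otimes> h)"
      using cs by - (rule ring_eqI, (rule reify | (simp add: algebra_simps; fail))+)
    finally have a: "a = n \<otimes> n \<otimes> (\<one> \<ominus> g \<otimes> h)" .
    have "m \<otimes> m = n \<otimes> n \<otimes> g \<otimes> g \<otimes> ((\<one> \<ominus> g \<otimes> h) \<otimes> u)"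
      unfolding u(2) using cs by (simp add: g(2) m_ac)
    also have "\<dots> = a \<otimes> (g \<otimes> g \<otimes> u)"
      unfolding a using cs uc by - (rule ring_eqI, (rule reify | (simp add: algebra_simps; fail))+)
    finally have mm: "m \<otimes> m = a \<otimes> (g \<otimes> g \<otimes> u)" .
    have gu: "g \<otimes> g \<otimes> u \<in> V" using g u by simp
    \<comment> \<open>\<open>product_in_span_scaled\<close> with the factor \<open>a\<close>: since
      \<open>m \<otimes> m\<close> is \<open>a\<close> times an element of \<open>V\<close>, its
      square is \<open>a\<close> times an element of \<open>B\<close>.\<close>
    obtain p q r where pqr: "p \<in> B" "q \<in> B" "r \<in> B"
      "(m \<otimes> m) \<otimes> (m \<otimes> m) = a \<otimes> (p \<otimes> a \<oplus> q \<otimes> (m \<otimes> m) \<oplus> r \<otimes> (m \<otimes> m))"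
      using product_in_span_scaled[OF cs(4) gu gu] unfolding mm[symmetric] by blast
    define f where "f = p \<otimes> a \<oplus> q \<otimes> (m \<otimes> m) \<oplus> r \<otimes> (m \<otimes> m)"
    have f: "f \<in> B" using pqr m t by (simp add: f_def)
    have fc: "f \<in> carrier K" using f by simp
    have "m [^] (4 + l) \<otimes> z = m [^] l \<otimes> ((m \<otimes> m) \<otimes> (m \<otimes> m)) \<otimes> z"
      using cs by (simp add: nat_pow_mult[symmetric] numeral_eq_Suc m_ac)
    also have "\<dots> = f \<otimes> (m [^] l \<otimes> (a \<otimes> z))"
      unfolding pqr(4) f_def[symmetric] using cs fc
      by - (rule ring_eqI, (rule reify | (simp add: algebra_simps; fail))+)
    finally show False using z f t by simp
  qed
  have "\<exists>t \<in> B. \<exists>v \<in> V. x = t \<oplus> m \<otimes> v" if x: "x \<in> V" for x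
  proof -
    obtain t v where tv: "t \<in> B" "v \<in> V" "x \<ominus> t = m \<otimes> v" using approx[OF x] by blast
    have "x = t \<oplus> (x \<ominus> t)" using V_carrier[OF x] B_carrier[OF tv(1)]
      by - (rule ring_eqI, (rule reify | (simp add: algebra_simps; fail))+)
    then show ?thesis using tv by metis
  qed
  then show ?thesis
    by (intro bexI[OF _ m(1)] conjI ballI m(2) m(3))
qed

end

subsection \<open>Noetherian local rings and fraction fields\<close>

lemma (in cring) cring_idealI:
  assumes "I \<subseteq> carrier R" "\<zero> \<in> I" "\<And>x y. x \<in> I \<Longrightarrow> y \<in> I \<Longrightarrow> x \<oplus> y \<in> I"
    "\<And>r x. r \<in> carrier R \<Longrightarrow> x \<in> I \<Longrightarrow> r \<otimes> x \<in> I"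
  shows "ideal I R"
proof (rule idealI)
  show "ring R" by (rule ring_axioms)
  have "\<ominus> x \<in> I" if "x \<in> I" for x
    using assms(4)[of "\<ominus> \<one>" x] that assms(1) by (auto simp: l_minus)
  then show "subgroup I (add_monoid R)"
    using assms(1-3) by (intro add.subgroupI) (auto simp: a_inv_def)
  show "x \<otimes> a \<in> I" "a \<otimes> x \<in> I" if "a \<in> I" "x \<in> carrier R" for a x
    using assms(4)[OF that(2,1)] m_comm[of x a] that assms(1) by auto
qed

lemma (in ring) idealD:
  assumes "ideal I R"
  shows "\<And>x. x \<in> I \<Longrightarrow> x \<in> carrier R" "\<zero> \<in> I" "\<And>x y. x \<in> I \<Longrightarrow> y \<in> I \<Longrightarrow> x \<oplus> y \<in> I"
    "\<And>r x. r \<in> carrier R \<Longrightarrow> x \<in> I \<Longrightarrow> r \<otimes> x \<in> I" "\<And>x y. x \<in> I \<Longrightarrow> y \<in> I \<Longrightarrow> x \<ominus> y \<in> I"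
    "\<And>r x. r \<in> carrier R \<Longrightarrow> x \<in> I \<Longrightarrow> x \<otimes> r \<in> I" "\<And>x. x \<in> I \<Longrightarrow> \<ominus> x \<in> I"
proof -
  interpret ideal I R by (rule assms)
  show "\<And>x. x \<in> I \<Longrightarrow> x \<in> carrier R" "\<zero> \<in> I" "\<And>x y. x \<in> I \<Longrightarrow> y \<in> I \<Longrightarrow> x \<oplus> y \<in> I"
    "\<And>r x. r \<in> carrier R \<Longrightarrow> x \<in> I \<Longrightarrow> r \<otimes> x \<in> I" "\<And>r x. r \<in> carrier R \<Longrightarrow> x \<in> I \<Longrightarrow> x \<otimes> r \<in> I"
    using a_subset I_l_closed I_r_closed by auto
  show *: "\<And>x. x \<in> I \<Longrightarrow> \<ominus> x \<in> I" by simp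
  show "\<And>x y. x \<in> I \<Longrightarrow> y \<in> I \<Longrightarrow> x \<ominus> y \<in> I"
    using * by (simp add: a_minus_def)
qed

lemma (in cring) ideal_add_principal:
  assumes J: "ideal J R" and u: "u \<in> carrier R"
  shows "ideal {j \<oplus> r \<otimes> u | j r. j \<in> J \<and> r \<in> carrier R} R"
    "J \<subseteq> {j \<oplus> r \<otimes> u | j r. j \<in> J \<and> r \<in> carrier R}" "u \<in> {j \<oplus> r \<otimes> u | j r. j \<in> J \<and> r \<in> carrier R}"
proof -
  note Jc = idealD[OF J]
  let ?S = "{j \<oplus> r \<otimes> u | j r. j \<in> J \<and> r \<in> carrier R}"
  have SI: "j \<oplus> r \<otimes> u \<in> ?S" if "j \<in> J" "r \<in> carrier R" for j r using that by blast
  show "ideal ?S R"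
  proof (rule cring_idealI)
    show "?S \<subseteq> carrier R" using Jc u by auto
    have "\<zero> = \<zero> \<oplus> \<zero> \<otimes> u" using u by simp
    then show "\<zero> \<in> ?S" using SI[OF Jc(2) zero_closed] by simp
  next
    fix x y assume "x \<in> ?S" "y \<in> ?S"
    then obtain j r j' r' where e: "j \<in> J" "r \<in> carrier R" "x = j \<oplus> r \<otimes> u" "j' \<in> J" "r' \<in> carrier R" "y = j' \<oplus> r' \<otimes> u"
      by blast
    have "x \<oplus> y = (j \<oplus> j') \<oplus> (r \<oplus> r') \<otimes> u"
      unfolding e(3,6) using Jc(1)[OF e(1)] Jc(1)[OF e(4)] e(2,5) u
      by - (rule ring_eqI, (rule reify | (simp add: algebra_simps; fail))+)
    then show "x \<oplus> y \<in> ?S" using SI[OF Jc(3)[OF e(1,4)]] e by simp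
  next
    fix s x assume s: "s \<in> carrier R" and "x \<in> ?S"
    then obtain j r where e: "j \<in> J" "r \<in> carrier R" "x = j \<oplus> r \<otimes> u" by blast
    have "s \<otimes> x = s \<otimes> j \<oplus> (s \<otimes> r) \<otimes> u"
      unfolding e(3) using Jc(1)[OF e(1)] e(2) u s
      by - (rule ring_eqI, (rule reify | (simp add: algebra_simps; fail))+)
    then show "s \<otimes> x \<in> ?S" using SI[OF Jc(4)[OF s e(1)]] e s by simp
  qed
  show "J \<subseteq> ?S"
  proof
    fix j assume "j \<in> J"
    then show "j \<in> ?S" using SI[OF \<open>j \<in> J\<close> zero_closed] u Jc(1) by simp
  qed
  show "u \<in> ?S" using SI[OF Jc(2) one_closed] u by simp
qed

lemma (in noetherian_ring) maximal_ideal_in_family: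
  assumes "S \<noteq> {}" "\<And>I. I \<in> S \<Longrightarrow> ideal I R"
  shows "\<exists>I \<in> S. \<forall>J \<in> S. I \<subseteq> J \<longrightarrow> J = I"
proof (rule subset_Zorn_nonempty[OF assms(1)])
  fix C assume C: "C \<noteq> {}" "subset.chain S C"
  then have "subset.chain {I. ideal I R} C"
    using assms(2) unfolding pred_on.chain_def by auto
  from ideal_chain_is_trivial[OF C(1) this] show "\<Union>C \<in> S"
    using C(2) unfolding pred_on.chain_def by auto
qed

lemma (in cring) PIdl_ideal: "a \<in> carrier R \<Longrightarrow> ideal (PIdl a) R"
  by (rule cgenideal_ideal)

lemma (in cring) PIdl_iff: "x \<in> PIdl a \<longleftrightarrow> (\<exists>r \<in> carrier R. x = r \<otimes> a)"
  by (auto simp: cgenideal_def)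

locale noetherian_local_ring = noetherian_ring + cring +
  assumes quasilocal: "quasilocal_ring R"
begin

abbreviation \<mm> where "\<mm> \<equiv> max_ideal R"

lemma max_ideal_maximal: "maximalideal \<mm> R"
  using quasilocal theI'[of "\<lambda>M. maximalideal M R"] unfolding quasilocal_ring_def max_ideal_def by blast

lemma max_ideal_unique: "maximalideal I R \<Longrightarrow> I = \<mm>"
  using quasilocal max_ideal_maximal unfolding quasilocal_ring_def by auto

lemma max_ideal_ideal: "ideal \<mm> R"
  using max_ideal_maximal by (rule maximalideal.axioms)

lemma one_notin_max: "\<one> \<notin> \<mm>"
  using maximalideal.I_notcarr[OF max_ideal_maximal] ideal.one_imp_carrier[OF max_ideal_ideal] by blast

text \<open>The chain condition supplies a maximal ideal above every proper ideal, and by uniqueness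
  it is \<open>\<mm>\<close>.\<close>

lemma ideal_subset_max:
  assumes I: "ideal I R" "\<one> \<notin> I"
  shows "I \<subseteq> \<mm>"
proof -
  define S where "S = {J. ideal J R \<and> \<one> \<notin> J \<and> I \<subseteq> J}"
  have "S \<noteq> {}" using I by (auto simp: S_def)
  moreover have "ideal J R" if "J \<in> S" for J using that by (simp add: S_def)
  ultimately obtain J where JS: "J \<in> S" "\<forall>L \<in> S. J \<subseteq> L \<longrightarrow> L = J"
    using maximal_ideal_in_family[of S] by metis
  then have J: "ideal J R" "\<one> \<notin> J" "I \<subseteq> J" by (simp_all add: S_def)
  have "maximalideal J R"
  proof (rule maximalidealI[OF J(1)])
    show "carrier R \<noteq> J" using J(2) by auto
    fix L assume L: "ideal L R" "J \<subseteq> L" "L \<subseteq> carrier R"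
    show "L = J \<or> L = carrier R"
    proof (cases "\<one> \<in> L")
      case True
      then show ?thesis using ideal.one_imp_carrier[OF L(1)] by auto
    next
      case False
      then have "L \<in> S" using L J(3) by (simp add: S_def subset_trans[OF J(3)])
      then show ?thesis using JS(2) L(2) by simp
    qed
  qed
  then show ?thesis using max_ideal_unique J(3) by auto
qed

lemma max_carrier: "a \<in> \<mm> \<Longrightarrow> a \<in> carrier R"
  using idealD(1)[OF max_ideal_ideal] by blast

lemma unit_iff: "a \<in> carrier R \<Longrightarrow> a \<notin> \<mm> \<longleftrightarrow> (\<exists>b \<in> carrier R. a \<otimes> b = \<one>)"
proof
  assume a: "a \<in> carrier R" "a \<notin> \<mm>"
  then have "\<one> \<in> PIdl a"
    using ideal_subset_max[OF PIdl_ideal[OF a(1)]] cgenideal_self[OF a(1)] by auto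
  then obtain b where "b \<in> carrier R" "\<one> = b \<otimes> a" using PIdl_iff by auto
  then show "\<exists>b \<in> carrier R. a \<otimes> b = \<one>" using m_comm a by metis
next
  assume a: "a \<in> carrier R" "\<exists>b \<in> carrier R. a \<otimes> b = \<one>"
  then obtain b where "b \<in> carrier R" "a \<otimes> b = \<one>" by blast
  then show "a \<notin> \<mm>"
    using one_notin_max idealD(6)[OF max_ideal_ideal, of b a] by auto
qed

lemma one_minus_max:
  assumes "a \<in> \<mm>"
  shows "\<exists>b \<in> carrier R. (\<one> \<ominus> a) \<otimes> b = \<one>"
proof -
  have c: "a \<in> carrier R" using assms max_carrier by blast
  have "\<one> \<ominus> a \<notin> \<mm>"
  proof
    assume h: "\<one> \<ominus> a \<in> \<mm>"
    have "(\<one> \<ominus> a) \<oplus> a = \<one>" using c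
      by - (rule ring_eqI, (rule reify | (simp add: algebra_simps; fail))+)
    then show False using idealD(3)[OF max_ideal_ideal h assms] one_notin_max by simp
  qed
  then show ?thesis using unit_iff[of "\<one> \<ominus> a"] c by auto
qed

end

section \<open>The field of fractions\<close>

context domain
begin

abbreviation frac where "frac \<equiv> fraction R"
abbreviation Q where "Q \<equiv> total_quotient_ring R"

lemma nzd_iff: "s \<in> nonzerodivisors R \<longleftrightarrow> s \<in> carrier R \<and> s \<noteq> \<zero>"
proof
  assume "s \<in> nonzerodivisors R"
  then show "s \<in> carrier R \<and> s \<noteq> \<zero>"
    using one_not_zero one_closed r_null unfolding nonzerodivisors_def by blast
qed (auto simp: nonzerodivisors_def integral_iff)

lemma frac_mem: "(b, t) \<in> frac a s \<longleftrightarrow> b \<in> carrier R \<and> t \<in> carrier R \<and> t \<noteq> \<zero> \<and> a \<otimes> t = b \<otimes> s"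
  by (auto simp: fraction_def nzd_iff)

lemma frac_eq_iff:
  assumes "a \<in> carrier R" "b \<in> carrier R" "s \<in> carrier R" "s \<noteq> \<zero>" "t \<in> carrier R" "t \<noteq> \<zero>"
  shows "frac a s = frac b t \<longleftrightarrow> a \<otimes> t = b \<otimes> s"
proof
  assume "frac a s = frac b t"
  then have "(b, t) \<in> frac a s" using assms by (simp add: frac_mem)
  then show "a \<otimes> t = b \<otimes> s" by (simp add: frac_mem)
next
  have *: "frac a s \<subseteq> frac b t" if h: "a \<in> carrier R" "b \<in> carrier R" "s \<in> carrier R" "s \<noteq> \<zero>"
    "t \<in> carrier R" "t \<noteq> \<zero>" "a \<otimes> t = b \<otimes> s" for a b s t
  proof (rule subrelI)
    fix c u assume "(c, u) \<in> frac a s"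
    then have cu: "c \<in> carrier R" "u \<in> carrier R" "u \<noteq> \<zero>" "a \<otimes> u = c \<otimes> s" by (auto simp: frac_mem)
    have "s \<otimes> (b \<otimes> u) = (b \<otimes> s) \<otimes> u" using h(1,2,3,5) cu(1,2)
      by - (rule ring_eqI, (rule reify | (simp add: algebra_simps; fail))+)
    also have "\<dots> = (a \<otimes> u) \<otimes> t" unfolding h(7)[symmetric] using h(1,2,3,5) cu(1,2)
      by - (rule ring_eqI, (rule reify | (simp add: algebra_simps; fail))+)
    also have "\<dots> = s \<otimes> (c \<otimes> t)" unfolding cu(4) using h(1,2,3,5) cu(1,2)
      by - (rule ring_eqI, (rule reify | (simp add: algebra_simps; fail))+)
    finally have "b \<otimes> u = c \<otimes> t" using h cu by (subst (asm) m_lcancel) auto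
    then show "(c, u) \<in> frac b t" using cu by (simp add: frac_mem)
  qed
  assume "a \<otimes> t = b \<otimes> s"
  then show "frac a s = frac b t"
    using *[of a b s t] *[of b a t s] assms by auto
qed

lemma Q_simps:
  "carrier Q = {frac a s | a s. a \<in> carrier R \<and> s \<in> carrier R \<and> s \<noteq> \<zero>}"
  "\<one>\<^bsub>Q\<^esub> = frac \<one> \<one>" "\<zero>\<^bsub>Q\<^esub> = frac \<zero> \<one>"
  by (auto simp: total_quotient_ring_def nzd_iff)

lemma Q_E:
  assumes "x \<in> carrier Q"
  obtains a s where "a \<in> carrier R" "s \<in> carrier R" "s \<noteq> \<zero>" "x = frac a s"
  using assms by (auto simp: Q_simps)

lemma Q_I: "a \<in> carrier R \<Longrightarrow> s \<in> carrier R \<Longrightarrow> s \<noteq> \<zero> \<Longrightarrow> frac a s \<in> carrier Q"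
  by (auto simp: Q_simps)

lemma Q_mult:
  assumes h: "a \<in> carrier R" "b \<in> carrier R" "s \<in> carrier R" "s \<noteq> \<zero>" "t \<in> carrier R" "t \<noteq> \<zero>"
  shows "frac a s \<otimes>\<^bsub>Q\<^esub> frac b t = frac (a \<otimes> b) (s \<otimes> t)"
proof -
  have "frac (a' \<otimes> b') (s' \<otimes> t') = frac (a \<otimes> b) (s \<otimes> t)"
    if "(a', s') \<in> frac a s" "(b', t') \<in> frac b t" for a' s' b' t'
  proof -
    have m: "a' \<in> carrier R" "s' \<in> carrier R" "s' \<noteq> \<zero>" "a \<otimes> s' = a' \<otimes> s"
      "b' \<in> carrier R" "t' \<in> carrier R" "t' \<noteq> \<zero>" "b \<otimes> t' = b' \<otimes> t"
      using that by (auto simp: frac_mem)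
    have "(a' \<otimes> b') \<otimes> (s \<otimes> t) = (a' \<otimes> s) \<otimes> (b' \<otimes> t)" using h(1,2,3,5) m(1,2,5,6)
      by - (rule ring_eqI, (rule reify | (simp add: algebra_simps; fail))+)
    also have "\<dots> = (a \<otimes> b) \<otimes> (s' \<otimes> t')" unfolding m(4,8)[symmetric] using h(1,2,3,5) m(1,2,5,6)
      by - (rule ring_eqI, (rule reify | (simp add: algebra_simps; fail))+)
    finally show ?thesis using h m by (subst frac_eq_iff) (auto simp: integral_iff)
  qed
  then have "(\<Union>y \<in> frac b t. case y of (b', t') \<Rightarrow> frac (a' \<otimes> b') (s' \<otimes> t')) = frac (a \<otimes> b) (s \<otimes> t)"
    if "(a', s') \<in> frac a s" for a' s'
    using that h frac_mem[of b t b t] by (intro SUP_eq_const) (auto simp del: frac_mem)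
  then show ?thesis
    unfolding total_quotient_ring_def using h frac_mem[of a s a s] by simp (intro SUP_eq_const, auto)
qed

lemma Q_add:
  assumes h: "a \<in> carrier R" "b \<in> carrier R" "s \<in> carrier R" "s \<noteq> \<zero>" "t \<in> carrier R" "t \<noteq> \<zero>"
  shows "frac a s \<oplus>\<^bsub>Q\<^esub> frac b t = frac (a \<otimes> t \<oplus> b \<otimes> s) (s \<otimes> t)"
proof -
  have "frac (a' \<otimes> t' \<oplus> b' \<otimes> s') (s' \<otimes> t') = frac (a \<otimes> t \<oplus> b \<otimes> s) (s \<otimes> t)"
    if "(a', s') \<in> frac a s" "(b', t') \<in> frac b t" for a' s' b' t'
  proof -
    have m: "a' \<in> carrier R" "s' \<in> carrier R" "s' \<noteq> \<zero>" "a \<otimes> s' = a' \<otimes> s"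
      "b' \<in> carrier R" "t' \<in> carrier R" "t' \<noteq> \<zero>" "b \<otimes> t' = b' \<otimes> t"
      using that by (auto simp: frac_mem)
    have "(a' \<otimes> t' \<oplus> b' \<otimes> s') \<otimes> (s \<otimes> t) = (a' \<otimes> s) \<otimes> (t' \<otimes> t) \<oplus> (b' \<otimes> t) \<otimes> (s' \<otimes> s)"
      using h(1,2,3,5) m(1,2,5,6) by - (rule ring_eqI, (rule reify | (simp add: algebra_simps; fail))+)
    also have "\<dots> = (a \<otimes> t \<oplus> b \<otimes> s) \<otimes> (s' \<otimes> t')"
      unfolding m(4,8)[symmetric] using h(1,2,3,5) m(1,2,5,6)
      by - (rule ring_eqI, (rule reify | (simp add: algebra_simps; fail))+)
    finally show ?thesis using h m by (subst frac_eq_iff) (auto simp: integral_iff)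
  qed
  then have "(\<Union>y \<in> frac b t. case y of (b', t') \<Rightarrow> frac (a' \<otimes> t' \<oplus> b' \<otimes> s') (s' \<otimes> t')) =
      frac (a \<otimes> t \<oplus> b \<otimes> s) (s \<otimes> t)" if "(a', s') \<in> frac a s" for a' s'
    using that h frac_mem[of b t b t] by (intro SUP_eq_const) (auto simp del: frac_mem)
  then show ?thesis
    unfolding total_quotient_ring_def using h frac_mem[of a s a s] by simp (intro SUP_eq_const, auto)
qed

lemma Q_cring: "cring Q"
proof (rule cringI)
  show "abelian_group Q"
  proof (rule abelian_groupI)
    fix x y z assume x: "x \<in> carrier Q" and y: "y \<in> carrier Q" and z: "z \<in> carrier Q"
    obtain a s b t c u where e: "a \<in> carrier R" "s \<in> carrier R" "b \<in> carrier R" "t \<in> carrier R"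
      "c \<in> carrier R" "u \<in> carrier R" "s \<noteq> \<zero>" "t \<noteq> \<zero>" "u \<noteq> \<zero>" "x = frac a s" "y = frac b t" "z = frac c u"
      using x y z by (elim Q_E) blast
    have "((a \<otimes> t \<oplus> b \<otimes> s) \<otimes> u \<oplus> c \<otimes> (s \<otimes> t)) \<otimes> (s \<otimes> (t \<otimes> u)) = (a \<otimes> (t \<otimes> u) \<oplus> (b \<otimes> u \<oplus> c \<otimes> t) \<otimes> s) \<otimes> (s \<otimes> t \<otimes> u)"
      using e(1-6) by - (rule ring_eqI, (rule reify | (simp add: algebra_simps; fail))+)
    then show "x \<oplus>\<^bsub>Q\<^esub> y \<oplus>\<^bsub>Q\<^esub> z = x \<oplus>\<^bsub>Q\<^esub> (y \<oplus>\<^bsub>Q\<^esub> z)"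
      using e by (simp add: Q_add integral_iff frac_eq_iff)
  next
    fix x y assume x: "x \<in> carrier Q" and y: "y \<in> carrier Q"
    obtain a s b t where e: "a \<in> carrier R" "s \<in> carrier R" "b \<in> carrier R" "t \<in> carrier R"
      "s \<noteq> \<zero>" "t \<noteq> \<zero>" "x = frac a s" "y = frac b t"
      using x y by (elim Q_E) blast
    show "x \<oplus>\<^bsub>Q\<^esub> y \<in> carrier Q" using e by (simp add: Q_add integral_iff Q_I)
    show "x \<oplus>\<^bsub>Q\<^esub> y = y \<oplus>\<^bsub>Q\<^esub> x"
      using e by (simp add: Q_add integral_iff a_comm m_comm)
    have "frac (\<ominus> a) s \<oplus>\<^bsub>Q\<^esub> x = \<zero>\<^bsub>Q\<^esub>"
      using e by (simp add: Q_add Q_simps integral_iff frac_eq_iff l_minus l_neg)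
    then show "\<exists>y \<in> carrier Q. y \<oplus>\<^bsub>Q\<^esub> x = \<zero>\<^bsub>Q\<^esub>"
      using e Q_I by (intro bexI) auto
    show "\<zero>\<^bsub>Q\<^esub> \<oplus>\<^bsub>Q\<^esub> x = x" using e by (simp add: Q_simps Q_add)
  qed (use Q_I in \<open>simp add: Q_simps(3)\<close>)
  show "comm_monoid Q"
  proof (rule comm_monoidI)
    fix x y z assume x: "x \<in> carrier Q" and y: "y \<in> carrier Q" and z: "z \<in> carrier Q"
    obtain a s b t c u where e: "a \<in> carrier R" "s \<in> carrier R" "b \<in> carrier R" "t \<in> carrier R"
      "c \<in> carrier R" "u \<in> carrier R" "s \<noteq> \<zero>" "t \<noteq> \<zero>" "u \<noteq> \<zero>" "x = frac a s" "y = frac b t" "z = frac c u"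
      using x y z by (elim Q_E) blast
    show "x \<otimes>\<^bsub>Q\<^esub> y \<otimes>\<^bsub>Q\<^esub> z = x \<otimes>\<^bsub>Q\<^esub> (y \<otimes>\<^bsub>Q\<^esub> z)"
      using e by (simp add: Q_mult integral_iff m_assoc)
  next
    fix x y assume x: "x \<in> carrier Q" and y: "y \<in> carrier Q"
    obtain a s b t where e: "a \<in> carrier R" "s \<in> carrier R" "b \<in> carrier R" "t \<in> carrier R"
      "s \<noteq> \<zero>" "t \<noteq> \<zero>" "x = frac a s" "y = frac b t"
      using x y by (elim Q_E) blast
    show "x \<otimes>\<^bsub>Q\<^esub> y \<in> carrier Q" using e by (simp add: Q_mult integral_iff Q_I)
    show "x \<otimes>\<^bsub>Q\<^esub> y = y \<otimes>\<^bsub>Q\<^esub> x" using e by (simp add: Q_mult m_comm)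
    show "\<one>\<^bsub>Q\<^esub> \<otimes>\<^bsub>Q\<^esub> x = x" using e by (simp add: Q_simps Q_mult)
  qed (use Q_I in \<open>simp add: Q_simps(2)\<close>)
  fix x y z assume x: "x \<in> carrier Q" and y: "y \<in> carrier Q" and z: "z \<in> carrier Q"
  obtain a s b t c u where e: "a \<in> carrier R" "s \<in> carrier R" "b \<in> carrier R" "t \<in> carrier R"
    "c \<in> carrier R" "u \<in> carrier R" "s \<noteq> \<zero>" "t \<noteq> \<zero>" "u \<noteq> \<zero>" "x = frac a s" "y = frac b t" "z = frac c u"
    using x y z by (elim Q_E) blast
  have "(a \<otimes> t \<oplus> b \<otimes> s) \<otimes> c \<otimes> (s \<otimes> u \<otimes> (t \<otimes> u)) = (a \<otimes> c \<otimes> (t \<otimes> u) \<oplus> b \<otimes> c \<otimes> (s \<otimes> u)) \<otimes> (s \<otimes> t \<otimes> u)"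
    using e(1-6) by - (rule ring_eqI, (rule reify | (simp add: algebra_simps; fail))+)
  then show "(x \<oplus>\<^bsub>Q\<^esub> y) \<otimes>\<^bsub>Q\<^esub> z = x \<otimes>\<^bsub>Q\<^esub> z \<oplus>\<^bsub>Q\<^esub> y \<otimes>\<^bsub>Q\<^esub> z"
    using e by (simp add: Q_add Q_mult integral_iff frac_eq_iff)
qed

lemma Q_field: "field Q"
proof -
  interpret Q: cring Q by (rule Q_cring)
  have "x \<in> Units Q" if x: "x \<in> carrier Q" "x \<noteq> \<zero>\<^bsub>Q\<^esub>" for x
  proof -
    obtain a s where e: "a \<in> carrier R" "s \<in> carrier R" "s \<noteq> \<zero>" "x = frac a s"
      using x by (elim Q_E) blast
    then have a: "a \<noteq> \<zero>" using x by (auto simp: Q_simps frac_eq_iff)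
    then have "x \<otimes>\<^bsub>Q\<^esub> frac s a = \<one>\<^bsub>Q\<^esub>" "frac s a \<otimes>\<^bsub>Q\<^esub> x = \<one>\<^bsub>Q\<^esub>"
      using e by (simp_all add: Q_mult Q_simps integral_iff frac_eq_iff m_comm)
    then show ?thesis using Q_I[OF e(2,1) a] x unfolding Units_def by blast
  qed
  moreover have "\<zero>\<^bsub>Q\<^esub> \<notin> Units Q"
    by (auto simp: Units_def Q_simps frac_eq_iff Q_mult elim!: Q_E)
  moreover have "Units Q \<subseteq> carrier Q" by (auto simp: Units_def)
  ultimately have "Units Q = carrier Q - {\<zero>\<^bsub>Q\<^esub>}" by auto
  then show ?thesis by (rule Q.cring_fieldI)
qed

abbreviation emb where "emb a \<equiv> frac a \<one>"

lemma emb_simps: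
  assumes "a \<in> carrier R" "b \<in> carrier R"
  shows "emb a \<in> carrier Q" "emb (a \<otimes> b) = emb a \<otimes>\<^bsub>Q\<^esub> emb b" "emb (a \<oplus> b) = emb a \<oplus>\<^bsub>Q\<^esub> emb b"
    "emb a = emb b \<longleftrightarrow> a = b" "emb a = \<zero>\<^bsub>Q\<^esub> \<longleftrightarrow> a = \<zero>" "emb a = \<one>\<^bsub>Q\<^esub> \<longleftrightarrow> a = \<one>"
  using assms by (auto simp: Q_mult Q_add frac_eq_iff Q_I Q_simps(2,3))

lemma emb_consts: "emb \<zero> = \<zero>\<^bsub>Q\<^esub>" "emb \<one> = \<one>\<^bsub>Q\<^esub>"
  by (simp_all add: Q_simps)

lemma emb_hom: "ring_hom_cring R Q emb"
  using emb_simps emb_consts Q_cring is_cring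
  by (intro ring_hom_cringI ring_hom_memI) auto

lemma base_ring_iff: "x \<in> base_ring R \<longleftrightarrow> (\<exists>a \<in> carrier R. x = emb a)"
  by (auto simp: base_ring_def)

lemma emb_frac:
  assumes "a \<in> carrier R" "s \<in> carrier R" "s \<noteq> \<zero>"
  shows "emb s \<otimes>\<^bsub>Q\<^esub> frac a s = emb a"
  using assms by (simp add: Q_mult frac_eq_iff m_comm)

lemma base_ring_subring: "subring (base_ring R) Q"
proof -
  interpret Q: field Q by (rule Q_field)
  interpret h: ring_hom_cring R Q emb by (rule emb_hom)
  have "\<ominus>\<^bsub>Q\<^esub> x \<in> base_ring R" if x: "x \<in> base_ring R" for x
  proof -
    obtain a where a: "a \<in> carrier R" "x = emb a" using x by (auto simp: base_ring_iff)
    then have "\<ominus>\<^bsub>Q\<^esub> x = emb (\<ominus> a)" by (simp add: h.hom_a_inv)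
    then show ?thesis using a base_ring_iff by blast
  qed
  moreover have "x \<oplus>\<^bsub>Q\<^esub> y \<in> base_ring R \<and> x \<otimes>\<^bsub>Q\<^esub> y \<in> base_ring R" if x: "x \<in> base_ring R" "y \<in> base_ring R" for x y
  proof -
    obtain a b where a: "a \<in> carrier R" "x = emb a" "b \<in> carrier R" "y = emb b"
      using x by (auto simp: base_ring_iff)
    then have "x \<oplus>\<^bsub>Q\<^esub> y = emb (a \<oplus> b)" "x \<otimes>\<^bsub>Q\<^esub> y = emb (a \<otimes> b)" by (simp_all add: emb_simps)
    then show ?thesis using a base_ring_iff a_closed m_closed by blast
  qed
  moreover have "\<one>\<^bsub>Q\<^esub> \<in> base_ring R"
    using emb_consts(2) one_closed unfolding base_ring_iff by metis
  moreover have "base_ring R \<subseteq> carrier Q"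
    by (auto simp: base_ring_iff emb_simps)
  ultimately show ?thesis by (intro Q.subringI) auto
qed

lemma fraction_subring_Q: "fraction_subring Q (base_ring R)"
proof (intro fraction_subring.intro fraction_subring_axioms.intro Q_field base_ring_subring)
  fix x assume "x \<in> carrier Q"
  then obtain a s where e: "a \<in> carrier R" "s \<in> carrier R" "s \<noteq> \<zero>" "x = frac a s"
    by (elim Q_E) blast
  then have "emb s \<in> base_ring R" "emb s \<noteq> \<zero>\<^bsub>Q\<^esub>" "emb s \<otimes>\<^bsub>Q\<^esub> x \<in> base_ring R"
    by (auto simp: base_ring_iff emb_simps emb_frac)
  then show "\<exists>s \<in> base_ring R. s \<noteq> \<zero>\<^bsub>Q\<^esub> \<and> s \<otimes>\<^bsub>Q\<^esub> x \<in> base_ring R" by blast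
qed

lemma emb_closed [simp]: "a \<in> carrier R \<Longrightarrow> emb a \<in> carrier Q"
  by (simp add: emb_simps)

end

subsection \<open>Stable ideals\<close>

locale ideal_in_domain = domain R for R :: "('a, 'b) ring_scheme" (structure) +
  fixes I :: "'a set"
  assumes I: "ideal I R"
begin

abbreviation E where "E \<equiv> endo_ring R I"
abbreviation F where "F J \<equiv> free_module E J"

lemmas I_D = idealD[OF I]

lemma E_mem: "f \<in> carrier E \<longleftrightarrow> f \<in> I \<rightarrow>\<^sub>E I \<and> (\<forall>x \<in> I. \<forall>y \<in> I. f (x \<oplus> y) = f x \<oplus> f y) \<and>
    (\<forall>r \<in> carrier R. \<forall>x \<in> I. f (r \<otimes> x) = r \<otimes> f x)"
  by (simp add: endo_ring_def)

lemma E_D: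
  assumes "f \<in> carrier E"
  shows "\<And>x. x \<in> I \<Longrightarrow> f x \<in> I" "\<And>x y. x \<in> I \<Longrightarrow> y \<in> I \<Longrightarrow> f (x \<oplus> y) = f x \<oplus> f y"
    "\<And>r x. r \<in> carrier R \<Longrightarrow> x \<in> I \<Longrightarrow> f (r \<otimes> x) = r \<otimes> f x" "\<And>x. x \<notin> I \<Longrightarrow> f x = undefined"
    "\<And>x. x \<in> I \<Longrightarrow> f x \<in> carrier R"
  using assms I_D(1) by (auto simp: E_mem PiE_def extensional_def Pi_def)

text \<open>Both sides equal \<open>f (x \<otimes> y)\<close>. Hence \<open>f\<close> is
  multiplication by the fraction \<open>f x / x\<close> for any nonzero \<open>x\<close>, which is
  how endomorphisms of \<open>I\<close> become elements of the fraction field.\<close>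

lemma E_swap:
  assumes "f \<in> carrier E" "x \<in> I" "y \<in> I"
  shows "f x \<otimes> y = x \<otimes> f y"
proof -
  have "f x \<otimes> y = y \<otimes> f x" using assms E_D(5) I_D(1) by (simp add: m_comm)
  also have "\<dots> = f (y \<otimes> x)" using assms E_D(3)[OF assms(1)] I_D(1) by simp
  also have "\<dots> = f (x \<otimes> y)" using assms I_D(1) by (simp add: m_comm)
  also have "\<dots> = x \<otimes> f y" using assms E_D(3)[OF assms(1)] I_D(1) by simp
  finally show ?thesis .
qed

lemma E_ops:
  "\<zero>\<^bsub>E\<^esub> = (\<lambda>x \<in> I. \<zero>)" "\<one>\<^bsub>E\<^esub> = (\<lambda>x \<in> I. x)" "f \<oplus>\<^bsub>E\<^esub> g = (\<lambda>x \<in> I. f x \<oplus> g x)"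
  "f \<otimes>\<^bsub>E\<^esub> g = compose I f g"
  by (simp_all add: endo_ring_def)

lemma E_zero_closed: "\<zero>\<^bsub>E\<^esub> \<in> carrier E"
  by (auto simp: E_ops E_mem I_D)

lemma E_one_closed: "\<one>\<^bsub>E\<^esub> \<in> carrier E"
  by (auto simp: E_ops E_mem I_D)

lemma E_add_closed: "f \<in> carrier E \<Longrightarrow> g \<in> carrier E \<Longrightarrow> f \<oplus>\<^bsub>E\<^esub> g \<in> carrier E"
  by (auto simp: E_ops E_mem[of "\<lambda>x \<in> I. f x \<oplus> g x"] E_D I_D a_ac r_distr)

lemma E_mult_closed: "f \<in> carrier E \<Longrightarrow> g \<in> carrier E \<Longrightarrow> f \<otimes>\<^bsub>E\<^esub> g \<in> carrier E"
  by (auto simp: E_ops compose_def E_mem[of "\<lambda>x \<in> I. f (g x)"] E_D I_D)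

definition scalar :: "'a \<Rightarrow> 'a \<Rightarrow> 'a"
  where "scalar r = (\<lambda>x \<in> I. r \<otimes> x)"

lemma scalar_closed: "r \<in> carrier R \<Longrightarrow> scalar r \<in> carrier E"
  by (auto simp: scalar_def E_mem I_D r_distr m_lcomm)

lemma E_group: "abelian_group E"
proof (rule abelian_groupI)
  fix f g h assume fgh: "f \<in> carrier E" "g \<in> carrier E" "h \<in> carrier E"
  show "f \<oplus>\<^bsub>E\<^esub> g \<oplus>\<^bsub>E\<^esub> h = f \<oplus>\<^bsub>E\<^esub> (g \<oplus>\<^bsub>E\<^esub> h)"
    using fgh by (auto simp: E_ops E_D a_assoc intro!: restrict_ext)
next
  fix f g assume fg: "f \<in> carrier E" "g \<in> carrier E"
  show "f \<oplus>\<^bsub>E\<^esub> g = g \<oplus>\<^bsub>E\<^esub> f"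
    using fg by (auto simp: E_ops E_D a_comm intro!: restrict_ext)
  show "\<zero>\<^bsub>E\<^esub> \<oplus>\<^bsub>E\<^esub> f = f"
    by (rule ext) (use fg in \<open>auto simp: E_ops E_D\<close>)
  have "(\<lambda>x \<in> I. \<ominus> f x) \<in> carrier E"
    using fg by (auto simp: E_mem[of "\<lambda>x \<in> I. \<ominus> f x"] E_D I_D r_minus minus_add)
  moreover have "(\<lambda>x \<in> I. \<ominus> f x) \<oplus>\<^bsub>E\<^esub> f = \<zero>\<^bsub>E\<^esub>"
    using fg by (auto simp: E_ops E_D l_neg intro!: restrict_ext)
  ultimately show "\<exists>g \<in> carrier E. g \<oplus>\<^bsub>E\<^esub> f = \<zero>\<^bsub>E\<^esub>" by blast
qed (simp_all add: E_add_closed E_zero_closed)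

lemma E_distr: "e \<in> carrier E \<Longrightarrow> f \<in> carrier E \<Longrightarrow> g \<in> carrier E \<Longrightarrow>
    e \<otimes>\<^bsub>E\<^esub> (f \<oplus>\<^bsub>E\<^esub> g) = e \<otimes>\<^bsub>E\<^esub> f \<oplus>\<^bsub>E\<^esub> e \<otimes>\<^bsub>E\<^esub> g"
  by (rule ext) (auto simp: E_ops compose_def E_D)

lemma E_mult_zero: "e \<in> carrier E \<Longrightarrow> e \<otimes>\<^bsub>E\<^esub> \<zero>\<^bsub>E\<^esub> = \<zero>\<^bsub>E\<^esub>"
proof (rule ext)
  fix x assume e: "e \<in> carrier E"
  have "e (\<zero> \<otimes> \<zero>) = \<zero> \<otimes> e \<zero>" using E_D(3)[OF e _ I_D(2)] by simp
  then have "e \<zero> = \<zero>" using E_D(5)[OF e I_D(2)] by simp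
  then show "(e \<otimes>\<^bsub>E\<^esub> \<zero>\<^bsub>E\<^esub>) x = \<zero>\<^bsub>E\<^esub> x" by (auto simp: E_ops compose_def)
qed

lemma E_mult_one: "e \<in> carrier E \<Longrightarrow> e \<otimes>\<^bsub>E\<^esub> \<one>\<^bsub>E\<^esub> = e"
  by (rule ext) (auto simp: E_ops compose_def E_D)

lemma F_mem: "f \<in> carrier (F J) \<longleftrightarrow> (\<forall>i \<in> J. f i \<in> carrier E) \<and> (\<forall>i. i \<notin> J \<longrightarrow> f i = \<zero>\<^bsub>E\<^esub>) \<and>
    finite {i. f i \<noteq> \<zero>\<^bsub>E\<^esub>}"
  by (simp add: free_module_def)

lemma F_carrier_E: "f \<in> carrier (F J) \<Longrightarrow> f i \<in> carrier E"
  using E_zero_closed by (cases "i \<in> J") (auto simp: F_mem)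

lemma F_ops: "\<zero>\<^bsub>F J\<^esub> = (\<lambda>_. \<zero>\<^bsub>E\<^esub>)" "f \<oplus>\<^bsub>F J\<^esub> g = (\<lambda>i. f i \<oplus>\<^bsub>E\<^esub> g i)" "e \<odot>\<^bsub>F J\<^esub> f = (\<lambda>i. e \<otimes>\<^bsub>E\<^esub> f i)"
  by (simp_all add: free_module_def)

lemma F_group: "abelian_group (F J)"
proof -
  interpret E: abelian_group E by (rule E_group)
  show ?thesis
  proof (rule abelian_groupI)
    fix f g assume fg: "f \<in> carrier (F J)" "g \<in> carrier (F J)"
    then have "finite ({i. f i \<noteq> \<zero>\<^bsub>E\<^esub>} \<union> {i. g i \<noteq> \<zero>\<^bsub>E\<^esub>})" by (simp add: F_mem)
    then have "finite {i. f i \<oplus>\<^bsub>E\<^esub> g i \<noteq> \<zero>\<^bsub>E\<^esub>}" by (rule rev_finite_subset) auto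
    then show "f \<oplus>\<^bsub>F J\<^esub> g \<in> carrier (F J)"
      using fg by (auto simp: F_mem F_ops)
    show "f \<oplus>\<^bsub>F J\<^esub> g = g \<oplus>\<^bsub>F J\<^esub> f"
      unfolding F_ops by (rule ext) (rule E.a_comm[OF F_carrier_E[OF fg(1)] F_carrier_E[OF fg(2)]])
    show "\<zero>\<^bsub>F J\<^esub> \<oplus>\<^bsub>F J\<^esub> f = f"
      unfolding F_ops by (rule ext) (rule E.l_zero[OF F_carrier_E[OF fg(1)]])
    have "(\<lambda>i. \<ominus>\<^bsub>E\<^esub> f i) \<in> carrier (F J)"
      using fg(1) F_carrier_E[OF fg(1)] by (auto simp: F_mem intro: rev_finite_subset)
    moreover have "(\<lambda>i. \<ominus>\<^bsub>E\<^esub> f i) \<oplus>\<^bsub>F J\<^esub> f = \<zero>\<^bsub>F J\<^esub>"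
      unfolding F_ops by (rule ext) (rule E.l_neg[OF F_carrier_E[OF fg(1)]])
    ultimately show "\<exists>g \<in> carrier (F J). g \<oplus>\<^bsub>F J\<^esub> f = \<zero>\<^bsub>F J\<^esub>" by blast
  next
    fix f g h assume fg: "f \<in> carrier (F J)" "g \<in> carrier (F J)" "h \<in> carrier (F J)"
    show "f \<oplus>\<^bsub>F J\<^esub> g \<oplus>\<^bsub>F J\<^esub> h = f \<oplus>\<^bsub>F J\<^esub> (g \<oplus>\<^bsub>F J\<^esub> h)"
      unfolding F_ops
      by (rule ext) (rule E.a_assoc[OF F_carrier_E[OF fg(1)] F_carrier_E[OF fg(2)] F_carrier_E[OF fg(3)]])
  qed (auto simp: F_mem F_ops E_zero_closed)
qed

lemma F_smult_closed:
  assumes "e \<in> carrier E" "f \<in> carrier (F J)"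
  shows "e \<odot>\<^bsub>F J\<^esub> f \<in> carrier (F J)"
proof -
  have "finite {i. f i \<noteq> \<zero>\<^bsub>E\<^esub>}" using assms by (simp add: F_mem)
  then have "finite {i. e \<otimes>\<^bsub>E\<^esub> f i \<noteq> \<zero>\<^bsub>E\<^esub>}"
    by (rule rev_finite_subset) (auto simp: E_mult_zero assms)
  then show ?thesis
    using assms by (auto simp: F_mem F_ops E_mult_zero E_mult_closed)
qed

lemma endo_module_simps: "carrier (endo_module R I) = I" "x \<oplus>\<^bsub>endo_module R I\<^esub> y = x \<oplus> y"
  "e \<odot>\<^bsub>endo_module R I\<^esub> x = e x"
  by (simp_all add: endo_module_def)

text \<open>The map \<open>x \<mapsto> x / i\<close> is an isomorphism from \<open>I\<close> onto
  its endomorphism ring: multiplication by \<open>x / i\<close> maps \<open>I\<close> to itself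
  because products of elements of \<open>I\<close> lie in \<open>i I\<close>, and an endomorphism
  \<open>f\<close> comes from \<open>f i\<close>. So \<open>I\<close> is free of rank one over
  \<open>endo_ring R I\<close>.\<close>

lemma stable_if_principal_square:
  assumes i: "i \<in> I" "i \<noteq> \<zero>" and sq: "\<And>x y. x \<in> I \<Longrightarrow> y \<in> I \<Longrightarrow> \<exists>z \<in> I. x \<otimes> y = i \<otimes> z"
  shows "stable_ideal R I"
proof -
  \<comment> \<open>\<open>d x\<close> is multiplication by \<open>x / i\<close>, written without
    fractions.\<close>
  define d where "d = (\<lambda>x. \<lambda>y \<in> I. THE z. z \<in> I \<and> x \<otimes> y = i \<otimes> z)"
  have ic: "i \<in> carrier R" using i I_D by auto
  have uniq: "z = z'" if "z \<in> I" "z' \<in> I" "i \<otimes> z = i \<otimes> z'" for z z'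
    using that i I_D(1) by (metis m_lcancel)
  have d: "d x y \<in> I" "i \<otimes> d x y = x \<otimes> y" if xy: "x \<in> I" "y \<in> I" for x y
  proof -
    obtain z where z: "z \<in> I" "x \<otimes> y = i \<otimes> z" using sq xy by blast
    have "(THE z. z \<in> I \<and> x \<otimes> y = i \<otimes> z) = z"
      by (rule the_equality) (use z uniq in auto)
    then show "d x y \<in> I" "i \<otimes> d x y = x \<otimes> y" using z xy by (simp_all add: d_def)
  qed
  have dI: "d x y = z" if "x \<in> I" "y \<in> I" "z \<in> I" "i \<otimes> z = x \<otimes> y" for x y z
    using uniq[OF d(1)[OF that(1,2)] that(3)] d(2)[OF that(1,2)] that(4) by simp
  note c = I_D(1) d(1)[THEN I_D(1)]
  have dE: "d x \<in> carrier E" if x: "x \<in> I" for x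
    unfolding E_mem
  proof (intro conjI ballI)
    show "d x \<in> I \<rightarrow>\<^sub>E I" using d(1)[OF x] by (auto simp: d_def)
    fix y z assume yz: "y \<in> I" "z \<in> I"
    show "d x (y \<oplus> z) = d x y \<oplus> d x z"
      by (rule dI) (use x yz d I_D c ic in \<open>auto simp: r_distr\<close>)
  next
    fix r y assume ry: "r \<in> carrier R" "y \<in> I"
    have "i \<otimes> (r \<otimes> d x y) = r \<otimes> (i \<otimes> d x y)"
      using ic ry c(2)[OF x ry(2)] by (simp add: m_lcomm)
    also have "\<dots> = x \<otimes> (r \<otimes> y)" unfolding d(2)[OF x ry(2)] using ry c(1) x by (simp add: m_lcomm)
    finally show "d x (r \<otimes> y) = r \<otimes> d x y"
      by (intro dI) (use x ry d I_D in auto)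
  qed
  \<comment> \<open>The target is the free module with the single basis index \<open>i\<close>;
    coordinates outside the index set have to be zero.\<close>
  define \<phi> where "\<phi> = (\<lambda>x j. if j = i then d x else \<zero>\<^bsub>E\<^esub>)"
  have \<phi>_closed: "\<phi> x \<in> carrier (F {i})" if "x \<in> I" for x
    using dE[OF that] by (auto simp: F_mem \<phi>_def intro: rev_finite_subset[of "{i}"])
  have inj: "inj_on \<phi> I"
  proof (rule inj_onI)
    fix x y assume xy: "x \<in> I" "y \<in> I" "\<phi> x = \<phi> y"
    then have "d x i = d y i" by (metis \<phi>_def)
    moreover have "d x i = x" "d y i = y"
      using xy i c ic by (auto intro!: dI simp: m_comm)
    ultimately show "x = y" by simp
  qed
  have surj: "\<exists>x \<in> I. \<phi> x = f" if f: "f \<in> carrier (F {i})" for f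
  proof
    have fi: "f i \<in> carrier E" by (rule F_carrier_E[OF f])
    show fI: "f i i \<in> I" using E_D(1)[OF fi] i by simp
    have "d (f i i) y = f i y" if y: "y \<in> I" for y
      by (rule dI[OF fI y E_D(1)[OF fi y]]) (use E_swap[OF fi i(1) y] in simp)
    then have "d (f i i) = f i"
      using E_D(4)[OF fi] E_D(4)[OF dE[OF fI]] by (intro ext) metis
    then show "\<phi> (f i i) = f"
      using f by (auto simp: \<phi>_def F_mem)
  qed
  have bij: "bij_betw \<phi> I (carrier (F {i}))"
    unfolding bij_betw_def using inj surj \<phi>_closed by blast
  interpret F: abelian_group "F {i}" by (rule F_group)
  have "submodule (carrier (F {i})) E (F {i})"
    using F.add.subgroup_self by (auto simp: submodule_def submodule_axioms_def intro: F_smult_closed)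
  moreover have "submodule {\<zero>\<^bsub>F {i}\<^esub>} E (F {i})"
    using F.add.triv_subgroup by (auto simp: submodule_def submodule_axioms_def F_ops E_mult_zero)
  moreover have "carrier (F {i}) \<inter> {\<zero>\<^bsub>F {i}\<^esub>} = {\<zero>\<^bsub>F {i}\<^esub>}" by auto
  moreover have "carrier (F {i}) <+>\<^bsub>F {i}\<^esub> {\<zero>\<^bsub>F {i}\<^esub>} = carrier (F {i})"
    by (auto simp: set_add_def' F.r_zero)
  ultimately have "direct_summand (F {i}) E (carrier (F {i}))"
    unfolding direct_summand_def by blast
  moreover have "\<phi> (x \<oplus> y) = \<phi> x \<oplus>\<^bsub>F {i}\<^esub> \<phi> y" if xy: "x \<in> I" "y \<in> I" for x y
  proof -
    have "d (x \<oplus> y) z = d x z \<oplus> d y z" if z: "z \<in> I" for z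
      by (rule dI) (use xy z d I_D c ic in \<open>auto simp: r_distr l_distr\<close>)
    then have "d (x \<oplus> y) = d x \<oplus>\<^bsub>E\<^esub> d y"
      by (intro ext) (auto simp: E_ops d_def)
    moreover have "\<zero>\<^bsub>E\<^esub> = \<zero>\<^bsub>E\<^esub> \<oplus>\<^bsub>E\<^esub> \<zero>\<^bsub>E\<^esub>"
      by (auto simp: E_ops)
    ultimately show ?thesis by (auto simp: \<phi>_def F_ops)
  qed
  moreover have "\<phi> (e x) = e \<odot>\<^bsub>F {i}\<^esub> \<phi> x" if ex: "e \<in> carrier E" "x \<in> I" for e x
  proof -
    have "d (e x) z = e (d x z)" if z: "z \<in> I" for z
    proof (rule dI)
      have "i \<otimes> e (d x z) = e (i \<otimes> d x z)" using E_D(3)[OF ex(1) ic d(1)[OF ex(2) z]] by simp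
      also have "\<dots> = e (z \<otimes> x)" unfolding d(2)[OF ex(2) z] using c(1) ex z by (simp add: m_comm)
      also have "\<dots> = z \<otimes> e x" by (rule E_D(3)[OF ex(1) c(1)[OF z] ex(2)])
      also have "\<dots> = e x \<otimes> z" by (rule m_comm[OF c(1)[OF z] E_D(5)[OF ex]])
      finally show "i \<otimes> e (d x z) = e x \<otimes> z" .
    qed (use ex z d E_D in auto)
    then have "d (e x) = e \<otimes>\<^bsub>E\<^esub> d x"
      by (intro ext) (auto simp: E_ops compose_def d_def)
    then show ?thesis using E_mult_zero[OF ex(1)] by (auto simp: \<phi>_def F_ops)
  qed
  ultimately have "projective_module E (endo_module R I)"
    unfolding projective_module_def endo_module_simps using bij by blast
  then show ?thesis using I by (simp add: stable_ideal_def)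
qed

text \<open>The coordinates of \<open>\<phi> x0\<close> in the free module, as fractions with denominator \<open>x0\<^sup>2\<close>, are
  multiplication maps \<open>I \<rightarrow> (I : I)\<close>; with the components in \<open>I\<close> of the basis vectors they form a dual basis.\<close>
lemma stable_imp_trace:
  assumes st: "stable_ideal R I" and x0: "x0 \<in> I" "x0 \<noteq> \<zero>"
  shows "\<one>\<^bsub>Q\<^esub> \<in> trace_set Q (emb ` I)"
proof -
  interpret Q: field Q by (rule Q_field)
  obtain J :: "'a set" and P \<phi> where J: "direct_summand (F J) E P" "bij_betw \<phi> I P"
    "\<forall>x \<in> I. \<forall>y \<in> I. \<phi> (x \<oplus> y) = \<phi> x \<oplus>\<^bsub>F J\<^esub> \<phi> y"
    "\<forall>e \<in> carrier E. \<forall>x \<in> I. \<phi> (e x) = e \<odot>\<^bsub>F J\<^esub> \<phi> x"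
    using st unfolding stable_ideal_def projective_module_def endo_module_simps by auto
  obtain N where N: "submodule P E (F J)" "submodule N E (F J)" "P \<inter> N = {\<zero>\<^bsub>F J\<^esub>}"
    "P <+>\<^bsub>F J\<^esub> N = carrier (F J)"
    using J(1) unfolding direct_summand_def by auto
  interpret F: abelian_group "F J" by (rule F_group)
  interpret E: abelian_group E by (rule E_group)
  interpret P: submodule P E "F J" by (rule N(1))
  interpret N: submodule N E "F J" by (rule N(2))
  have x0c: "x0 \<in> carrier R" using x0 I_D by auto
  have \<phi>P: "\<phi> x \<in> P" if "x \<in> I" for x using J(2) that by (auto simp: bij_betw_def)
  have \<phi>F: "\<phi> x \<in> carrier (F J)" if "x \<in> I" for x using \<phi>P[OF that] P.subset by auto
  have NF: "q \<in> carrier (F J)" if "q \<in> N" for q using that N.subset by auto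
  have \<phi>_add: "\<phi> (x \<oplus> y) = \<phi> x \<oplus>\<^bsub>F J\<^esub> \<phi> y" if "x \<in> I" "y \<in> I" for x y
    using J(3) that by simp
  have \<phi>_E: "\<phi> (e x) = e \<odot>\<^bsub>F J\<^esub> \<phi> x" if "e \<in> carrier E" "x \<in> I" for e x
    using J(4) that by simp
  \<comment> \<open>\<open>S g x\<close> says that \<open>x\<close> is the component of
    \<open>g\<close> in \<open>I\<close>, for the decomposition of the free module into
    \<open>P\<close>, the image of \<open>I\<close>, and \<open>N\<close>.\<close>
  define S where "S = (\<lambda>g x. x \<in> I \<and> (\<exists>q \<in> N. g = \<phi> x \<oplus>\<^bsub>F J\<^esub> q))"
  have S_ex: "\<exists>x. S g x" if g: "g \<in> carrier (F J)" for g
  proof -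
    obtain p q where pq: "p \<in> P" "q \<in> N" "g = p \<oplus>\<^bsub>F J\<^esub> q"
      using g unfolding N(4)[symmetric] set_add_def' by blast
    obtain x where "x \<in> I" "\<phi> x = p" using J(2) pq(1) by (auto simp: bij_betw_def)
    then show ?thesis using pq unfolding S_def by blast
  qed
  have S_add: "S (g \<oplus>\<^bsub>F J\<^esub> h) (x \<oplus> y)" if gh: "S g x" "S h y" for g h x y
  proof -
    obtain q r where qr: "q \<in> N" "r \<in> N" "g = \<phi> x \<oplus>\<^bsub>F J\<^esub> q" "h = \<phi> y \<oplus>\<^bsub>F J\<^esub> r" "x \<in> I" "y \<in> I"
      using gh unfolding S_def by blast
    have "g \<oplus>\<^bsub>F J\<^esub> h = \<phi> (x \<oplus> y) \<oplus>\<^bsub>F J\<^esub> (q \<oplus>\<^bsub>F J\<^esub> r)"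
      using qr \<phi>F NF by (simp add: \<phi>_add F.a_ac)
    moreover have "q \<oplus>\<^bsub>F J\<^esub> r \<in> N" using N.m_closed[OF qr(1,2)] by simp
    ultimately show ?thesis using qr I_D(3) unfolding S_def by blast
  qed
  have S_smult: "S (e \<odot>\<^bsub>F J\<^esub> g) (e x)" if eg: "e \<in> carrier E" "S g x" for e g x
  proof -
    obtain q where q: "q \<in> N" "g = \<phi> x \<oplus>\<^bsub>F J\<^esub> q" "x \<in> I"
      using eg unfolding S_def by blast
    have "e \<odot>\<^bsub>F J\<^esub> g = \<phi> (e x) \<oplus>\<^bsub>F J\<^esub> (e \<odot>\<^bsub>F J\<^esub> q)"
      unfolding q(2) \<phi>_E[OF eg(1) q(3)] unfolding F_ops
      by (rule ext) (rule E_distr[OF eg(1) F_carrier_E[OF \<phi>F[OF q(3)]] F_carrier_E[OF NF[OF q(1)]]])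
    then show ?thesis using q eg E_D(1) unfolding S_def by blast
  qed
  have S_uniq: "x = y" if S: "S (\<phi> y) x" and y: "y \<in> I" for x y
  proof -
    obtain q where q: "q \<in> N" "\<phi> y = \<phi> x \<oplus>\<^bsub>F J\<^esub> q" "x \<in> I"
      using S unfolding S_def by blast
    have "\<ominus>\<^bsub>F J\<^esub> \<phi> x \<in> P" using P.m_inv_closed[OF \<phi>P[OF q(3)]] by (simp add: a_inv_def)
    then have "\<ominus>\<^bsub>F J\<^esub> \<phi> x \<oplus>\<^bsub>F J\<^esub> \<phi> y \<in> P" using P.m_closed[OF _ \<phi>P[OF y]] by simp
    moreover have "\<ominus>\<^bsub>F J\<^esub> \<phi> x \<oplus>\<^bsub>F J\<^esub> \<phi> y = q"
      unfolding q(2) using \<phi>F[OF q(3)] NF[OF q(1)] by (simp add: F.r_neg1)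
    ultimately have "q = \<zero>\<^bsub>F J\<^esub>" using q(1) N(3) by auto
    then have "\<phi> y = \<phi> x" using q \<phi>F by simp
    then show ?thesis using J(2) y q(3) by (auto simp: bij_betw_def inj_on_def)
  qed
  define g0 where "g0 = \<phi> x0"
  have g0: "g0 \<in> carrier (F J)" unfolding g0_def by (rule \<phi>F[OF x0(1)])
  note g0E = F_carrier_E[OF g0]
  \<comment> \<open>By linearity \<open>\<phi> x\<close> should be \<open>x / x0\<close> times
    \<open>\<phi> x0\<close>, and the endomorphism \<open>\<phi> x0 j\<close> is multiplication by
    \<open>\<phi> x0 j x0 / x0\<close>. Together these give the denominator
    \<open>x0 \<otimes> x0\<close> and the formula \<open>t_mult\<close>.\<close>
  define t where "t = (\<lambda>j. frac (g0 j x0) (x0 \<otimes> x0))"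
  have xx: "x0 \<otimes> x0 \<in> carrier R" "x0 \<otimes> x0 \<noteq> \<zero>" using x0 x0c by (auto simp: integral_iff)
  have t_c: "t j \<in> carrier Q" for j
    unfolding t_def by (rule Q_I[OF E_D(5)[OF g0E x0(1)] xx])
  have t_mult: "t j \<otimes>\<^bsub>Q\<^esub> emb x \<otimes>\<^bsub>Q\<^esub> emb y = emb (\<phi> x j y)" if xy: "x \<in> I" "y \<in> I" for j x y
  proof -
    have c: "x \<in> carrier R" "y \<in> carrier R" using xy I_D(1) by auto
    have "scalar x0 x = scalar x x0" using xy x0 c x0c by (simp add: scalar_def m_comm)
    then have "scalar x0 \<odot>\<^bsub>F J\<^esub> \<phi> x = scalar x \<odot>\<^bsub>F J\<^esub> \<phi> x0"
      using \<phi>_E[OF scalar_closed[OF x0c] xy(1)] \<phi>_E[OF scalar_closed[OF c(1)] x0(1)] by simp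
    then have "scalar x0 \<otimes>\<^bsub>E\<^esub> \<phi> x j = scalar x \<otimes>\<^bsub>E\<^esub> g0 j"
      unfolding F_ops g0_def by (rule fun_cong)
    then have "(scalar x0 \<otimes>\<^bsub>E\<^esub> \<phi> x j) y = (scalar x \<otimes>\<^bsub>E\<^esub> g0 j) y" by simp
    then have e: "x0 \<otimes> \<phi> x j y = x \<otimes> g0 j y"
      using xy E_D(1)[OF g0E] E_D(1)[OF F_carrier_E[OF \<phi>F[OF xy(1)]]]
      by (simp add: E_ops compose_def scalar_def)
    note c2 = c x0c E_D(5)[OF g0E x0(1)] E_D(5)[OF g0E xy(2)] E_D(5)[OF F_carrier_E[OF \<phi>F[OF xy(1)]] xy(2)]
    have "g0 j x0 \<otimes> x \<otimes> y = x \<otimes> (g0 j x0 \<otimes> y)" using c2(1,2,4)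
      by - (rule ring_eqI, (rule reify | (simp add: algebra_simps; fail))+)
    also have "\<dots> = x \<otimes> (x0 \<otimes> g0 j y)" unfolding E_swap[OF g0E x0(1) xy(2)] ..
    also have "\<dots> = x0 \<otimes> (x \<otimes> g0 j y)" using c2(1,3,5)
      by - (rule ring_eqI, (rule reify | (simp add: algebra_simps; fail))+)
    also have "\<dots> = \<phi> x j y \<otimes> (x0 \<otimes> x0)" unfolding e[symmetric] using c2(3,6)
      by - (rule ring_eqI, (rule reify | (simp add: algebra_simps; fail))+)
    finally show ?thesis using c2 xx by (simp add: t_def Q_mult frac_eq_iff)
  qed
  have t_I: "t j \<otimes>\<^bsub>Q\<^esub> u \<otimes>\<^bsub>Q\<^esub> v \<in> emb ` I" if "u \<in> emb ` I" "v \<in> emb ` I" for u v j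
    using that t_mult E_D(1)[OF F_carrier_E[OF \<phi>F]] by auto
  \<comment> \<open>For a finite set \<open>D\<close> of indices, the part of
    \<open>\<phi> x0\<close> supported on \<open>D\<close> has the component
    \<open>s \<otimes> x0\<close> in \<open>I\<close>, where \<open>s\<close> is the sum of the
    products \<open>t j \<otimes> y\<close> with \<open>y\<close> the component of the basis vector
    at \<open>j\<close>. Taking for \<open>D\<close> the support of \<open>\<phi> x0\<close> gives
    \<open>s = \<one>\<close>.\<close>
  have "\<exists>s \<in> trace_set Q (emb ` I). \<exists>x. S (\<lambda>j. if j \<in> D then g0 j else \<zero>\<^bsub>E\<^esub>) x \<and> emb x = s \<otimes>\<^bsub>Q\<^esub> emb x0"
    if "finite D" "D \<subseteq> J" for D
    using that
  proof (induction D rule: finite_induct)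
    case empty
    have "\<phi> (\<zero> \<oplus> \<zero>) = \<phi> \<zero> \<oplus>\<^bsub>F J\<^esub> \<phi> \<zero>" by (rule \<phi>_add) (use I_D in auto)
    then have "\<phi> \<zero> = \<zero>\<^bsub>F J\<^esub>" using \<phi>F[OF I_D(2)] by (simp add: F.add.l_cancel_one)
    then have "S (\<zero>\<^bsub>F J\<^esub>) \<zero>"
      using I_D(2) N.one_closed unfolding S_def by (auto intro!: bexI[of _ "\<zero>\<^bsub>F J\<^esub>"])
    then have "S (\<lambda>j. if j \<in> {} then g0 j else \<zero>\<^bsub>E\<^esub>) \<zero>" by (simp add: F_ops)
    moreover have "emb \<zero> = \<zero>\<^bsub>Q\<^esub> \<otimes>\<^bsub>Q\<^esub> emb x0"
      using emb_simps(1)[OF x0c x0c] by (simp add: emb_consts)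
    ultimately show ?case using trace_set.trace_zero by blast
  next
    case (insert j D)
    then obtain s x where s: "s \<in> trace_set Q (emb ` I)" "S (\<lambda>j. if j \<in> D then g0 j else \<zero>\<^bsub>E\<^esub>) x"
      "emb x = s \<otimes>\<^bsub>Q\<^esub> emb x0"
      by auto
    define e where "e = (\<lambda>k. if k = j then \<one>\<^bsub>E\<^esub> else \<zero>\<^bsub>E\<^esub>)"
    have "e \<in> carrier (F J)"
      using insert by (auto simp: e_def F_mem E_one_closed E_zero_closed intro: rev_finite_subset[of "{j}"])
    then obtain y where y: "S e y" using S_ex by blast
    have yI: "y \<in> I" and xI: "x \<in> I" using y s(2) by (auto simp: S_def)
    have "S (g0 j \<odot>\<^bsub>F J\<^esub> e \<oplus>\<^bsub>F J\<^esub> (\<lambda>j. if j \<in> D then g0 j else \<zero>\<^bsub>E\<^esub>)) (g0 j y \<oplus> x)"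
      by (rule S_add[OF S_smult[OF g0E y] s(2)])
    moreover have "g0 j \<odot>\<^bsub>F J\<^esub> e \<oplus>\<^bsub>F J\<^esub> (\<lambda>j. if j \<in> D then g0 j else \<zero>\<^bsub>E\<^esub>) =
        (\<lambda>k. if k \<in> insert j D then g0 k else \<zero>\<^bsub>E\<^esub>)"
      using insert(2) g0E by (auto simp: F_ops e_def E_mult_one E_mult_zero)
    moreover have "t j \<otimes>\<^bsub>Q\<^esub> emb y \<oplus>\<^bsub>Q\<^esub> s \<in> trace_set Q (emb ` I)"
      by (rule trace_set.trace_step[OF t_c _ t_I s(1)]) (use yI in auto)
    moreover have "emb (g0 j y \<oplus> x) = (t j \<otimes>\<^bsub>Q\<^esub> emb y \<oplus>\<^bsub>Q\<^esub> s) \<otimes>\<^bsub>Q\<^esub> emb x0"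
    proof -
      have sc: "s \<in> carrier Q"
        using s(1) by (induction rule: trace_set.induct) (auto simp: I_D(1))
      have ec: "emb y \<in> carrier Q" "emb x0 \<in> carrier Q"
        using emb_simps(1) I_D(1) x0c yI by auto
      have "emb (g0 j y) = t j \<otimes>\<^bsub>Q\<^esub> emb x0 \<otimes>\<^bsub>Q\<^esub> emb y"
        unfolding t_mult[OF x0(1) yI] g0_def ..
      also have "\<dots> = t j \<otimes>\<^bsub>Q\<^esub> emb y \<otimes>\<^bsub>Q\<^esub> emb x0"
        using t_c[of j] ec by (simp add: Q.m_ac)
      finally show ?thesis
        using emb_simps(3)[OF E_D(5)[OF g0E yI] I_D(1)[OF xI]] s(3) t_c[of j] ec sc by (simp add: Q.l_distr)
    qed
    ultimately show ?case by auto
  qed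
  from this[of "{j. g0 j \<noteq> \<zero>\<^bsub>E\<^esub>}"] g0 obtain s x where s: "s \<in> trace_set Q (emb ` I)"
    "S (\<lambda>j. if j \<in> {j. g0 j \<noteq> \<zero>\<^bsub>E\<^esub>} then g0 j else \<zero>\<^bsub>E\<^esub>) x" "emb x = s \<otimes>\<^bsub>Q\<^esub> emb x0"
    by (fastforce simp: F_mem)
  have "(\<lambda>j. if j \<in> {j. g0 j \<noteq> \<zero>\<^bsub>E\<^esub>} then g0 j else \<zero>\<^bsub>E\<^esub>) = \<phi> x0"
    by (auto simp: g0_def)
  then have "x = x0" using S_uniq s(2) x0(1) by simp
  moreover have sc: "s \<in> carrier Q"
    using s(1) by (induction rule: trace_set.induct) (auto simp: I_D(1))
  moreover have "emb x0 \<in> carrier Q" "emb x0 \<noteq> \<zero>\<^bsub>Q\<^esub>"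
    using emb_simps(1,5)[OF x0c x0c] x0 by auto
  ultimately have "s = \<one>\<^bsub>Q\<^esub>"
    using s(3) by (metis Q.l_one Q.m_rcancel Q.one_closed)
  then show ?thesis using s by simp
qed

end

subsection \<open>Finite normalization and dimension\<close>

context fraction_subring
begin

lemma Span_Nil': "Span B [] = {\<zero>}"
  by simp

lemma Span_Cons': "z \<in> Span B (u # us) \<longleftrightarrow> (\<exists>k \<in> B. \<exists>e \<in> Span B us. z = k \<otimes> u \<oplus> e)"
  by (auto simp: line_extension_def set_add_def' r_coset_def)

declare Span.simps [simp del]

lemma Span_submod: "set us \<subseteq> carrier K \<Longrightarrow> submod K B (Span B us)"
proof (induction us)
  case Nil
  show ?case by (rule submodI) (auto simp: Span_Nil')
next
  case (Cons u us)
  then have S: "submod K B (Span B us)" and u: "u \<in> carrier K" by auto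
  note Sc = submodD[OF S]
  show ?case
  proof (rule submodI)
    fix x y assume "x \<in> Span B (u # us)" "y \<in> Span B (u # us)"
    then obtain k e k' e' where e: "k \<in> B" "e \<in> Span B us" "x = k \<otimes> u \<oplus> e"
      "k' \<in> B" "e' \<in> Span B us" "y = k' \<otimes> u \<oplus> e'"
      by (auto simp: Span_Cons')
    have "x \<oplus> y = (k \<oplus> k') \<otimes> u \<oplus> (e \<oplus> e')"
      unfolding e(3,6) using e(1,4)[THEN B_carrier] e(2,5)[THEN Sc(1)] u
      by - (rule ring_eqI, (rule reify | (simp add: algebra_simps; fail))+)
    then show "x \<oplus> y \<in> Span B (u # us)"
      using e Sc(3)[OF e(2,5)] B_closed(3) unfolding Span_Cons' by blast
  next
    fix b x assume b: "b \<in> B" and "x \<in> Span B (u # us)"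
    then obtain k e where e: "k \<in> B" "e \<in> Span B us" "x = k \<otimes> u \<oplus> e"
      by (auto simp: Span_Cons')
    have "b \<otimes> x = (b \<otimes> k) \<otimes> u \<oplus> b \<otimes> e"
      unfolding e(3) using B_carrier[OF e(1)] Sc(1)[OF e(2)] u B_carrier[OF b]
      by - (rule ring_eqI, (rule reify | (simp add: algebra_simps; fail))+)
    then show "b \<otimes> x \<in> Span B (u # us)"
      using e b Sc(4)[OF b e(2)] B_closed(4) unfolding Span_Cons' by blast
  next
    have "\<zero> = \<zero> \<otimes> u \<oplus> \<zero>" using u by simp
    then show "\<zero> \<in> Span B (u # us)" using B_closed(1) Sc(2) unfolding Span_Cons' by blast
  next
    fix x assume "x \<in> Span B (u # us)"
    then show "x \<in> carrier K" using Sc(1) u by (auto simp: Span_Cons')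
  qed
qed

lemma Span_Cons_mem:
  assumes "set (u # us) \<subseteq> carrier K"
  shows "u \<in> Span B (u # us)" "Span B us \<subseteq> Span B (u # us)"
proof -
  have S: "submod K B (Span B us)" using assms by (intro Span_submod) auto
  have "u = \<one> \<otimes> u \<oplus> \<zero>" using assms by simp
  then show "u \<in> Span B (u # us)" using submodD(2)[OF S] B_closed(2) unfolding Span_Cons' by blast
  have "e = \<zero> \<otimes> u \<oplus> e" if "e \<in> Span B us" for e using assms submodD(1)[OF S that] by simp
  then show "Span B us \<subseteq> Span B (u # us)" using B_closed(1) unfolding Span_Cons' subset_iff by blast
qed

lemma Span_subset_V: "set us \<subseteq> V \<Longrightarrow> Span B us \<subseteq> V"
proof (induction us)
  case Nil
  then show ?case by (simp add: Span_Nil')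
next
  case (Cons u us)
  then show ?case using B_subset_V by (auto simp: Span_Cons' intro!: V_closed)
qed

lemma Span_denom:
  assumes "set us \<subseteq> carrier K"
  shows "\<exists>c \<in> B. c \<noteq> \<zero> \<and> (\<forall>z \<in> Span B us. c \<otimes> z \<in> B)"
  using assms
proof (induction us)
  case Nil
  then show ?case by (auto simp: Span_Nil' intro!: bexI[of _ \<one>])
next
  case (Cons u us)
  then obtain c where c: "c \<in> B" "c \<noteq> \<zero>" "\<forall>z \<in> Span B us. c \<otimes> z \<in> B" by auto
  obtain s where s: "s \<in> B" "s \<noteq> \<zero>" "s \<otimes> u \<in> B" using denom[of u] Cons by auto
  have S: "submod K B (Span B us)" using Cons by (intro Span_submod) auto
  have "c \<otimes> s \<otimes> z \<in> B" if z: "z \<in> Span B (u # us)" for z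
  proof -
    obtain k e where e: "k \<in> B" "e \<in> Span B us" "z = k \<otimes> u \<oplus> e"
      using z by (auto simp: Span_Cons')
    have "c \<otimes> s \<otimes> z = c \<otimes> k \<otimes> (s \<otimes> u) \<oplus> s \<otimes> (c \<otimes> e)"
      unfolding e(3) using B_carrier[OF e(1)] submodD(1)[OF S e(2)] Cons(2) B_carrier[OF c(1)] B_carrier[OF s(1)]
      by (simp add: m_assoc m_lcomm r_distr)
    then show ?thesis using c s e by simp
  qed
  then show ?case using c s by (intro bexI[of _ "c \<otimes> s"]) (auto simp: integral_iff)
qed

text \<open>A monic equation for \<open>x\<close> expresses high powers of \<open>x\<close> by lower
  ones with coefficients in \<open>B\<close>, so a denominator of the powers below its degree serves
  all powers.\<close>

lemma integral_closure_subset_V: "integral_closure K B \<subseteq> V"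
proof
  fix x assume "x \<in> integral_closure K B"
  then obtain p where x: "x \<in> carrier K" and p: "p \<noteq> []" "polynomial\<^bsub>K\<^esub> B p" "hd p = \<one>" "eval p x = \<zero>"
    unfolding integral_closure_def by blast
  define q where "q = tl p"
  have pq: "p = \<one> # q" using p by (simp add: q_def list.expand)
  have qB: "set q \<subseteq> B" using p unfolding polynomial_def pq by auto
  have "set q \<subseteq> carrier K" using qB B_carrier by blast
  then have qc: "eval q x \<in> carrier K" using eval_in_carrier x by blast
  have xn: "x [^] length q = \<ominus> eval q x"
  proof -
    have "x [^] length q \<oplus> eval q x = \<zero>" using p(4) x by (simp add: pq)
    then show ?thesis using qc x by (metis minus_equality minus_minus nat_pow_closed)
  qed
  obtain s where s: "s \<in> B" "s \<noteq> \<zero>" "s \<otimes> x \<in> B" using denom[OF x] by auto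
  have sc: "s \<in> carrier K" using s by simp
  \<comment> \<open>For \<open>k < length q\<close> the product \<open>d \<otimes> x [^] k\<close>
    is a power of \<open>s\<close> times \<open>(s \<otimes> x) [^] k\<close>, hence in
    \<open>B\<close>.\<close>
  define d where "d = s [^] length q"
  have dB: "d \<in> B" using s by (simp add: d_def)
  have dc: "d \<in> carrier K" using dB by simp
  have "s [^] (n :: nat) \<noteq> \<zero>" for n
    using s(2) sc by (induction n) (auto simp: integral_iff)
  then have d0: "d \<noteq> \<zero>" by (simp add: d_def)
  have aux: "d \<otimes> x [^] j \<otimes> eval r x \<in> B" if "set r \<subseteq> B" "\<forall>i < length r. d \<otimes> x [^] (j + i) \<in> B" for r j
    using that
  proof (induction r)
    case Nil
    then show ?case using dc x by simp
  next
    case (Cons c r)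
    have c: "c \<in> B" "c \<in> carrier K" and r: "set r \<subseteq> B" using Cons by auto
    have rc: "eval r x \<in> carrier K" using eval_in_carrier[of r x] r B_carrier x by blast
    have "d \<otimes> x [^] j \<otimes> eval (c # r) x = d \<otimes> x [^] j \<otimes> (c \<otimes> x [^] length r \<oplus> eval r x)"
      by simp
    also have "\<dots> = c \<otimes> (d \<otimes> x [^] (j + length r)) \<oplus> d \<otimes> x [^] j \<otimes> eval r x"
      using dc c(2) x rc by - (rule ring_eqI, (rule reify | (simp add: algebra_simps power_add; fail))+)
    finally show ?case using Cons c r by simp
  qed
  have "d \<otimes> x [^] k \<in> B" for k :: nat
  proof (induction k rule: less_induct)
    case (less k)
    show ?case
    proof (cases "k < length q")
      case True
      then obtain l where l: "length q = l + k" using less_imp_add_positive by (metis add.commute)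
      have "d \<otimes> x [^] k = s [^] l \<otimes> (s \<otimes> x) [^] k"
        unfolding d_def l using sc x
        by - (rule ring_eqI, (rule reify | (simp add: algebra_simps power_add power_mult_distrib; fail))+)
      then show ?thesis using s by simp
    next
      case False
      then obtain j where j: "k = j + length q" by (metis le_Suc_ex not_less add.commute)
      have "d \<otimes> x [^] j \<otimes> eval q x \<in> B"
        by (rule aux[OF qB]) (use less j in auto)
      then have "\<ominus> (d \<otimes> x [^] j \<otimes> eval q x) \<in> B" by simp
      moreover have "d \<otimes> x [^] k = d \<otimes> x [^] j \<otimes> x [^] length q"
        unfolding j using dc x by (simp add: nat_pow_mult[symmetric] m_assoc)
      ultimately show ?thesis unfolding xn using dc x qc by (simp add: r_minus)
    qed
  qed
  then show "x \<in> V" using x dB d0 unfolding almost_integral_def by blast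
qed

lemma quadratic_integral:
  assumes x: "x \<in> carrier K" and ab: "a \<in> B" "b \<in> B" "x \<otimes> x = a \<oplus> b \<otimes> x"
  shows "x \<in> integral_closure K B"
proof -
  have c: "a \<in> carrier K" "b \<in> carrier K" using ab by auto
  have "eval [\<one>, \<ominus> b, \<ominus> a] x = x \<otimes> x \<ominus> b \<otimes> x \<ominus> a"
  proof -
    have "eval [\<one>, \<ominus> b, \<ominus> a] x = \<one> \<otimes> x [^] (2::nat) \<oplus> (\<ominus> b \<otimes> x [^] (1::nat) \<oplus> (\<ominus> a \<otimes> x [^] (0::nat) \<oplus> \<zero>))"
      by (simp add: numeral_2_eq_2)
    also have "\<dots> = x \<otimes> x \<ominus> b \<otimes> x \<ominus> a"
      using c x by - (rule ring_eqI, (rule reify | (simp add: algebra_simps power2_eq_square; fail))+)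
    finally show ?thesis .
  qed
  also have "\<dots> = \<zero>" unfolding ab(3) using c x
    by - (rule ring_eqI, (rule reify | (simp add: algebra_simps; fail))+)
  finally have "eval [\<one>, \<ominus> b, \<ominus> a] x = \<zero>" .
  moreover have "polynomial\<^bsub>K\<^esub> B [\<one>, \<ominus> b, \<ominus> a]" using ab by (simp add: polynomial_def)
  ultimately show ?thesis unfolding integral_closure_def using x by fastforce
qed

end

context noetherian_fraction_subring
begin

text \<open>Multiplication by \<open>d\<close> makes \<open>V\<close> an ideal of the Noetherian
  ring \<open>B\<close>. A maximal set among the \<open>d \<otimes> Span B us\<close> is all of it,
  as adjoining one more \<open>v \<in> V\<close> to \<open>us\<close> cannot enlarge it. Read
  backwards, a \<open>V\<close> that is not finite has no common denominator.\<close>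

lemma V_finite:
  assumes d: "d \<in> B" "d \<noteq> \<zero>" "\<And>z. z \<in> V \<Longrightarrow> d \<otimes> z \<in> B"
  shows "\<exists>us. set us \<subseteq> V \<and> V = Span B us"
proof -
  define C where "C = {(\<otimes>) d ` Span B us | us. set us \<subseteq> V}"
  have VK: "set us \<subseteq> carrier K" if "set us \<subseteq> V" for us using that V_carrier by blast
  have dc: "d \<in> carrier K" using d by simp
  have "submod K B W \<and> W \<subseteq> B" if WC: "W \<in> C" for W
  proof -
    obtain us where us: "set us \<subseteq> V" "W = (\<otimes>) d ` Span B us" using WC by (auto simp: C_def)
    note S = submodD[OF Span_submod[OF VK[OF us(1)]]]
    have "W \<subseteq> B" using Span_subset_V[OF us(1)] d(3) us(2) by blast
    moreover have "submod K B W"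
    proof (rule submodI)
      fix x y assume "x \<in> W" "y \<in> W"
      then obtain x' y' where e: "x' \<in> Span B us" "y' \<in> Span B us" "x = d \<otimes> x'" "y = d \<otimes> y'"
        using us by auto
      then have "x \<oplus> y = d \<otimes> (x' \<oplus> y')" using S(1) dc by (simp add: r_distr)
      then show "x \<oplus> y \<in> W" using S(3)[OF e(1,2)] us by auto
    next
      fix b x assume b: "b \<in> B" and "x \<in> W"
      then obtain x' where e: "x' \<in> Span B us" "x = d \<otimes> x'" using us by auto
      then have "b \<otimes> x = d \<otimes> (b \<otimes> x')" using S(1) dc b by (simp add: m_lcomm)
      then show "b \<otimes> x \<in> W" using S(4)[OF b e(1)] us by auto
    next
      have "\<zero> = d \<otimes> \<zero>" using dc by simp
      then show "\<zero> \<in> W" using S(2) us(2) by blast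
    next
      show "x \<in> carrier K" if "x \<in> W" for x using that \<open>W \<subseteq> B\<close> by auto
    qed
    ultimately show ?thesis by simp
  qed
  moreover have "C \<noteq> {}" unfolding C_def using empty_subsetI[of V] by (auto intro: exI[of _ "[]"])
  ultimately obtain W where W: "W \<in> C" "\<forall>W' \<in> C. W \<subseteq> W' \<longrightarrow> W' = W"
    using noetherian[of C] by blast
  obtain us where us: "set us \<subseteq> V" "W = (\<otimes>) d ` Span B us" using W(1) by (auto simp: C_def)
  have "v \<in> Span B us" if v: "v \<in> V" for v
  proof -
    have s: "set (v # us) \<subseteq> V" using v us by simp
    note m = Span_Cons_mem[OF VK[OF s]]
    have "(\<otimes>) d ` Span B (v # us) \<in> C" using s unfolding C_def by blast
    moreover have "W \<subseteq> (\<otimes>) d ` Span B (v # us)" using m(2) us(2) by blast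
    ultimately have "(\<otimes>) d ` Span B (v # us) = W" using W(2) by blast
    then have "d \<otimes> v \<in> W" using m(1) by blast
    then obtain e where e: "e \<in> Span B us" "d \<otimes> v = d \<otimes> e" using us by auto
    then have "v = e" using d(2) dc v submodD(1)[OF Span_submod[OF VK[OF us(1)]] e(1)] by (simp add: m_lcancel)
    then show ?thesis using e by simp
  qed
  then show ?thesis using Span_subset_V[OF us(1)] us(1) by blast
qed

end

text \<open>Every element of \<open>V\<close> satisfies a monic quadratic equation and so is
  integral. This turns the lack of a finite normalization into a statement on
  \<open>V\<close>.\<close>

lemma (in stable_subring) integral_closure_eq_V: "integral_closure K B = V"
  using integral_closure_subset_V quadratic quadratic_integral[OF V_carrier] by (meson subsetI subset_antisym)

lemma krull_dim_ge: "prime_chain R n p \<Longrightarrow> enat n \<le> krull_dim R"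
  unfolding krull_dim_def by (rule SUP_upper) blast

lemma krull_dim_eq_oneI:
  assumes "prime_chain R 1 p" "\<And>p. \<not> prime_chain R 2 p"
  shows "krull_dim R = 1"
proof (rule antisym)
  show "1 \<le> krull_dim R" using krull_dim_ge[OF assms(1)] by (simp add: one_enat_def)
  show "krull_dim R \<le> 1"
    unfolding krull_dim_def
  proof (rule SUP_least)
    fix n assume "n \<in> {n. \<exists>p. prime_chain R n p}"
    then obtain p where p: "prime_chain R n p" by blast
    have "\<not> 2 \<le> n"
    proof
      assume "2 \<le> n"
      then have "prime_chain R 2 p" using p by (auto simp: prime_chain_def)
      then show False using assms(2) by blast
    qed
    then have "n \<le> 1" by simp
    then show "enat n \<le> 1" by (simp add: one_enat_def)
  qed
qed

section \<open>Submodules of the fraction field and ideals of \<open>R\<close>\<close>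

locale noetherian_local_domain = noetherian_local_ring + domain
begin

abbreviation B where "B \<equiv> base_ring R"

sublocale Q: fraction_subring Q B
  by (rule fraction_subring_Q)

lemma emb_B [simp]: "a \<in> carrier R \<Longrightarrow> emb a \<in> B"
  by (auto simp: base_ring_iff)

lemma submod_vimage:
  assumes W: "submod Q B W" "W \<subseteq> B"
  shows "ideal {a \<in> carrier R. emb a \<in> W} R" "emb ` {a \<in> carrier R. emb a \<in> W} = W"
proof -
  note Wc = Q.submodD[OF W(1)]
  show "ideal {a \<in> carrier R. emb a \<in> W} R"
    by (rule cring_idealI) (use Wc(2,3) Wc(4)[OF emb_B] in \<open>auto simp: emb_simps emb_consts\<close>)
  show "emb ` {a \<in> carrier R. emb a \<in> W} = W"
  proof
    show "W \<subseteq> emb ` {a \<in> carrier R. emb a \<in> W}"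
    proof
      fix x assume x: "x \<in> W"
      then obtain a where "a \<in> carrier R" "x = emb a" using subsetD[OF W(2) x] by (auto simp: base_ring_iff)
      then show "x \<in> emb ` {a \<in> carrier R. emb a \<in> W}" using x by blast
    qed
  qed auto
qed

lemma noetherian_Q: "noetherian_fraction_subring Q B"
proof
  fix C assume C: "\<And>W. W \<in> C \<Longrightarrow> submod Q B W \<and> W \<subseteq> B" "C \<noteq> {}"
  define pre where "pre = (\<lambda>W. {a \<in> carrier R. emb a \<in> W})"
  have pre: "ideal (pre W) R" "emb ` pre W = W" if "W \<in> C" for W
    using submod_vimage C(1)[OF that] by (simp_all add: pre_def)
  have "pre ` C \<noteq> {}" using C(2) by blast
  moreover have "ideal I R" if "I \<in> pre ` C" for I using that pre(1) by auto
  ultimately obtain I where I: "I \<in> pre ` C" "\<forall>J \<in> pre ` C. I \<subseteq> J \<longrightarrow> J = I"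
    using maximal_ideal_in_family[of "pre ` C"] by meson
  then obtain W where W: "W \<in> C" "I = pre W" by auto
  have "W' = W" if W': "W' \<in> C" "W \<subseteq> W'" for W'
  proof -
    have "pre W \<subseteq> pre W'" using W'(2) by (auto simp: pre_def)
    then have "pre W' = pre W" using I(2) W W'(1) by auto
    then show ?thesis using pre(2)[OF W(1)] pre(2)[OF W'(1)] by simp
  qed
  then show "\<exists>W \<in> C. \<forall>W' \<in> C. W \<subseteq> W' \<longrightarrow> W' = W" using W(1) by auto
qed

lemma nonunits_iff: "a \<in> carrier R \<Longrightarrow> emb a \<in> nonunits Q B \<longleftrightarrow> a \<in> \<mm>"
proof -
  assume a: "a \<in> carrier R"
  have "emb a \<in> nonunits Q B \<longleftrightarrow> (\<forall>y \<in> B. emb a \<otimes>\<^bsub>Q\<^esub> y \<noteq> \<one>\<^bsub>Q\<^esub>)"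
    using a by (simp add: nonunits_def)
  also have "\<dots> \<longleftrightarrow> (\<forall>b \<in> carrier R. emb (a \<otimes> b) \<noteq> \<one>\<^bsub>Q\<^esub>)"
    using a by (auto simp: base_ring_iff emb_simps)
  also have "\<dots> \<longleftrightarrow> (\<forall>b \<in> carrier R. a \<otimes> b \<noteq> \<one>)"
    using a emb_simps(6)[of _ \<zero>] by auto
  finally show ?thesis using unit_iff[OF a] by auto
qed

text \<open>An ideal maximal among those that contain \<open>s\<close> but no power of
  \<open>a\<close> is prime, by the usual argument for multiplicative sets. It would lie strictly
  between \<open>{\<zero>}\<close> and \<open>\<mm>\<close>, and the three primes would form a chain
  of length 2.\<close>

lemma power_in_principal:
  assumes dim: "krull_dim R = 1" and a: "a \<in> \<mm>" and s: "s \<in> carrier R" "s \<noteq> \<zero>"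
  shows "\<exists>l :: nat. \<exists>b \<in> carrier R. a [^] l = s \<otimes> b"
proof (rule ccontr)
  assume contra: "\<not> ?thesis"
  have ac: "a \<in> carrier R" using a idealD(1)[OF max_ideal_ideal] by blast
  define S where "S = {J. ideal J R \<and> s \<in> J \<and> (\<forall>l::nat. a [^] l \<notin> J)}"
  have "PIdl s \<in> S"
    using PIdl_ideal[OF s(1)] cgenideal_self[OF s(1)] contra m_comm[OF s(1)]
    by (auto simp: S_def PIdl_iff)
  then have "S \<noteq> {}" by blast
  moreover have "ideal J R" if "J \<in> S" for J using that by (simp add: S_def)
  ultimately obtain J where JS: "J \<in> S" "\<forall>L \<in> S. J \<subseteq> L \<longrightarrow> L = J"
    using maximal_ideal_in_family[of S] by metis
  have J: "ideal J R" "s \<in> J" "\<And>l::nat. a [^] l \<notin> J" using JS(1) by (auto simp: S_def)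
  note Jc = idealD[OF J(1)]
  have ext: "\<exists>l::nat. \<exists>j \<in> J. \<exists>r \<in> carrier R. a [^] l = j \<oplus> r \<otimes> u" if u: "u \<in> carrier R" "u \<notin> J" for u
  proof (rule ccontr)
    assume no: "\<not> ?thesis"
    note ip = ideal_add_principal[OF J(1) u(1)]
    have "{j \<oplus> r \<otimes> u | j r. j \<in> J \<and> r \<in> carrier R} \<in> S"
      using ip(1,2) J(2) no unfolding S_def by blast
    then have "{j \<oplus> r \<otimes> u | j r. j \<in> J \<and> r \<in> carrier R} = J"
      using JS(2) ip(2) by blast
    then show False using ip(3) u(2) by blast
  qed
  have Jprime: "primeideal J R"
  proof (rule primeidealI[OF J(1) is_cring])
    show "carrier R \<noteq> J" using J(3)[of 0] by auto
    fix u v assume uv: "u \<in> carrier R" "v \<in> carrier R" "u \<otimes> v \<in> J"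
    show "u \<in> J \<or> v \<in> J"
    proof (rule ccontr)
      assume "\<not> ?thesis"
      then obtain k l :: nat and i j r t where e: "i \<in> J" "j \<in> J" "r \<in> carrier R" "t \<in> carrier R"
        "a [^] k = i \<oplus> r \<otimes> u" "a [^] l = j \<oplus> t \<otimes> v"
        using ext[OF uv(1)] ext[OF uv(2)] by blast
      have "a [^] (k + l) = (i \<oplus> r \<otimes> u) \<otimes> (j \<oplus> t \<otimes> v)"
        unfolding e(5,6)[symmetric] using ac by (simp add: nat_pow_mult)
      also have "\<dots> = (j \<oplus> t \<otimes> v) \<otimes> i \<oplus> (r \<otimes> u) \<otimes> j \<oplus> (r \<otimes> t) \<otimes> (u \<otimes> v)"
        using Jc(1)[OF e(1)] Jc(1)[OF e(2)] e(3,4) uv(1,2)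
        by - (rule ring_eqI, (rule reify | (simp add: algebra_simps; fail))+)
      also have "\<dots> \<in> J"
        using Jc(3,4) e Jc(1)[OF e(2)] uv by simp
      finally show False using J(3) by blast
    qed
  qed
  have mprime: "primeideal \<mm> R" by (rule maximalideal_prime[OF max_ideal_maximal])
  have JM: "J \<subset> \<mm>"
    using ideal_subset_max[OF J(1)] J(3)[of 0] J(3)[of 1] a ac by auto
  have "{\<zero>} \<subset> J" using J(2) Jc(2) s(2) by auto
  then have "prime_chain R 2 (\<lambda>i. if i = 0 then {\<zero>} else if i = 1 then J else \<mm>)"
    using zeroprimeideal Jprime mprime JM unfolding prime_chain_def by (auto simp: less_2_cases_iff)
  then have "enat 2 \<le> krull_dim R" by (rule krull_dim_ge)
  then show False using dim by (simp add: one_enat_def)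
qed

lemma stable_Q:
  assumes "stable_domain R"
  shows "stable_subring Q B"
proof -
  interpret N: noetherian_fraction_subring Q B by (rule noetherian_Q)
  show ?thesis
  proof
    fix W assume W: "submod Q B W" "W \<subseteq> B" "W \<noteq> {\<zero>\<^bsub>Q\<^esub>}"
    let ?I = "{a \<in> carrier R. emb a \<in> W}"
    note v = submod_vimage[OF W(1,2)]
    interpret I: ideal_in_domain R ?I by (intro ideal_in_domain.intro ideal_in_domain_axioms.intro v(1) domain_axioms)
    obtain w where w: "w \<in> W" "w \<noteq> \<zero>\<^bsub>Q\<^esub>" using W(3) Q.submodD(2)[OF W(1)] by blast
    then obtain x where x: "x \<in> carrier R" "w = emb x" using subsetD[OF W(2) w(1)] by (auto simp: base_ring_iff)
    then have xI: "x \<in> ?I" "x \<noteq> \<zero>" using w by (auto simp: emb_consts)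
    then have "?I \<noteq> {\<zero>}" by blast
    then have "stable_ideal R ?I" using assms v(1) unfolding stable_domain_def by blast
    from I.stable_imp_trace[OF this xI] show "\<one>\<^bsub>Q\<^esub> \<in> trace_set Q W" unfolding v(2) .
  qed
qed

lemma bad_stable_Q:
  assumes bad: "bad_stable_domain R"
  shows "bad_stable_subring Q B"
proof -
  have st: "stable_domain R" and dim: "krull_dim R = 1" and nf: "\<not> finite_normalization R"
    using bad by (auto simp: bad_stable_domain_def)
  interpret S: stable_subring Q B by (rule stable_Q[OF st])
  show ?thesis
  proof
    fix x y assume "x \<in> nonunits Q B" "y \<in> nonunits Q B"
    moreover from this obtain a b where "a \<in> carrier R" "b \<in> carrier R" "x = emb a" "y = emb b"
      by (auto simp: nonunits_def base_ring_iff)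
    ultimately show "x \<oplus>\<^bsub>Q\<^esub> y \<in> nonunits Q B"
      using idealD(3)[OF max_ideal_ideal] nonunits_iff[of "a \<oplus> b"] by (simp add: nonunits_iff emb_simps)
  next
    fix x s assume xs: "x \<in> nonunits Q B" "s \<in> B" "s \<noteq> \<zero>\<^bsub>Q\<^esub>"
    then obtain a t where e: "a \<in> carrier R" "t \<in> carrier R" "x = emb a" "s = emb t"
      by (auto simp: nonunits_def base_ring_iff)
    then have "a \<in> \<mm>" "t \<noteq> \<zero>" using xs nonunits_iff[OF e(1)] by (auto simp: emb_consts)
    then obtain l :: nat and b where l: "b \<in> carrier R" "a [^] l = t \<otimes> b"
      using power_in_principal[OF dim _ e(2)] by blast
    have "emb (a [^] l) = emb a [^]\<^bsub>Q\<^esub> l" for l :: nat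
      by (induction l) (simp_all add: emb_consts emb_simps e)
    then have "x [^]\<^bsub>Q\<^esub> l = s \<otimes>\<^bsub>Q\<^esub> emb b"
      unfolding e(3,4) using l e by (metis emb_simps(2))
    then show "\<exists>l :: nat. \<exists>b \<in> B. x [^]\<^bsub>Q\<^esub> l = s \<otimes>\<^bsub>Q\<^esub> b" using l emb_B by blast
  next
    fix d assume d: "d \<in> B" "d \<noteq> \<zero>\<^bsub>Q\<^esub>"
    show "\<exists>z \<in> almost_integral Q B. d \<otimes>\<^bsub>Q\<^esub> z \<notin> B"
    proof (rule ccontr)
      assume "\<not> ?thesis"
      then obtain us where "set us \<subseteq> almost_integral Q B" "almost_integral Q B = Q.Span B us"
        using S.V_finite[OF d] by blast
      then have "finite_normalization R"
        unfolding finite_normalization_def S.integral_closure_eq_V using Q.V_carrier by blast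
      then show False using nf by simp
    qed
  qed
qed

text \<open>A finitely generated module of fractions has a common denominator. Quadratic equations
  are singled out because the fractions constructed later from an element of \<open>P\<close>
  satisfy such equations.\<close>

lemma finite_normalization_denom:
  assumes "finite_normalization R"
  shows "\<exists>c \<in> carrier R. c \<noteq> \<zero> \<and>
    (\<forall>x \<in> carrier Q. (\<exists>a \<in> B. \<exists>b \<in> B. x \<otimes>\<^bsub>Q\<^esub> x = a \<oplus>\<^bsub>Q\<^esub> b \<otimes>\<^bsub>Q\<^esub> x) \<longrightarrow> emb c \<otimes>\<^bsub>Q\<^esub> x \<in> B)"
proof -
  obtain us where us: "set us \<subseteq> carrier Q" "integral_closure Q B = Q.Span B us"
    using assms unfolding finite_normalization_def by blast
  obtain c where c: "c \<in> B" "c \<noteq> \<zero>\<^bsub>Q\<^esub>" "\<forall>z \<in> Q.Span B us. c \<otimes>\<^bsub>Q\<^esub> z \<in> B"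
    using Q.Span_denom[OF us(1)] by blast
  obtain r where r: "r \<in> carrier R" "c = emb r" using c(1) by (auto simp: base_ring_iff)
  then have r0: "r \<noteq> \<zero>" using c(2) by (auto simp: emb_consts)
  have *: "emb r \<otimes>\<^bsub>Q\<^esub> x \<in> B"
    if x: "x \<in> carrier Q" "\<exists>a \<in> B. \<exists>b \<in> B. x \<otimes>\<^bsub>Q\<^esub> x = a \<oplus>\<^bsub>Q\<^esub> b \<otimes>\<^bsub>Q\<^esub> x" for x
  proof -
    obtain a b where "a \<in> B" "b \<in> B" "x \<otimes>\<^bsub>Q\<^esub> x = a \<oplus>\<^bsub>Q\<^esub> b \<otimes>\<^bsub>Q\<^esub> x" using x(2) by blast
    from Q.quadratic_integral[OF x(1) this] have "x \<in> Q.Span B us" unfolding us(2) .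
    then show ?thesis using c(3) r(2) by simp
  qed
  show ?thesis
    by (intro bexI[OF _ r(1)] conjI ballI impI r0 *)
qed

end

subsection \<open>Adic completions\<close>

lemma (in ring) coset_mem:
  assumes "ideal J R" "a \<in> carrier R"
  shows "x \<in> J +> a \<longleftrightarrow> x \<in> carrier R \<and> x \<ominus> a \<in> J"
proof
  note Jc = idealD[OF assms(1)]
  assume "x \<in> J +> a"
  then obtain j where j: "j \<in> J" "x = j \<oplus> a" by (auto simp: a_r_coset_def')
  have "x \<ominus> a = j" unfolding j(2) using Jc(1)[OF j(1)] assms(2) by (simp add: a_minus_def a_assoc r_neg)
  then show "x \<in> carrier R \<and> x \<ominus> a \<in> J" using j Jc(1)[OF j(1)] assms(2) by simp
next
  assume x: "x \<in> carrier R \<and> x \<ominus> a \<in> J"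
  then have "x = (x \<ominus> a) \<oplus> a" using assms(2) by (simp add: a_minus_def a_assoc l_neg)
  then show "x \<in> J +> a" using x by (auto simp: a_r_coset_def')
qed

lemma (in cring) ideal_power_simps:
  assumes "ideal I R"
  shows "ideal_power R I 0 = carrier R" "ideal_power R I (Suc n) = ideal_power R I n \<cdot> I"
    "ideal (ideal_power R I n) R"
proof -
  show 0: "ideal_power R I 0 = carrier R" and S: "ideal_power R I (Suc n) = ideal_power R I n \<cdot> I" for n
    by (simp_all add: nat_pow_def ideals_set_def)
  show "ideal (ideal_power R I n) R"
  proof (induction n)
    case 0
    show ?case using oneideal by (simp add: 0 nat_pow_def ideals_set_def)
  next
    case (Suc n)
    then show ?case unfolding S by (rule ideal_prod_is_ideal[OF _ assms])
  qed
qed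

locale adic_ring = cring +
  fixes I assumes I: "ideal I R"
begin

definition pw where "pw n = ideal_power R I n"
abbreviation A where "A \<equiv> adic_completion R I"

lemmas pw_0 = ideal_power_simps(1)[OF I, folded pw_def]
lemmas pw_Suc = ideal_power_simps(2)[OF I, folded pw_def]
lemmas pw_ideal = ideal_power_simps(3)[OF I, folded pw_def]
lemmas A_def = adic_completion_def[of R I, folded pw_def]
lemmas pw_D = idealD[OF pw_ideal]

lemma pw_1: "pw 1 = I"
  using ideal_prod_one[OF I] ideal_prod_commute[OF I oneideal] pw_Suc[of 0] by (simp add: pw_0)

lemma pw_Suc_subset: "pw (Suc n) \<subseteq> pw n"
  unfolding pw_Suc using ideal_prod_inter[OF pw_ideal I] by blast

lemma pw_mono: "n \<le> k \<Longrightarrow> pw k \<subseteq> pw n"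
  by (induction k rule: dec_induct) (use pw_Suc_subset in auto)

lemma pw_mult: "a \<in> pw n \<Longrightarrow> b \<in> pw k \<Longrightarrow> a \<otimes> b \<in> pw (n + k)"
proof (induction k arbitrary: b)
  case 0
  then show ?case using pw_D(6) by (simp add: pw_0)
next
  case (Suc k)
  from Suc(3) have b: "b \<in> pw k \<cdot> I" by (simp add: pw_Suc)
  have ac: "a \<in> carrier R" using Suc pw_D(1) by blast
  from b show ?case
  proof (induction rule: ideal_prod.induct)
    case (prod i j)
    have "a \<otimes> (i \<otimes> j) = (a \<otimes> i) \<otimes> j" using prod ac pw_D(1) idealD(1)[OF I] by (simp add: m_assoc)
    then show ?case using ideal_prod.prod[OF Suc.IH[OF Suc(2) prod(1)] prod(2)] by (simp add: pw_Suc)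
  next
    case (sum s t)
    then have "s \<in> carrier R" "t \<in> carrier R" using ideal_prod_in_carrier[OF pw_ideal I] by blast+
    then have "a \<otimes> (s \<oplus> t) = a \<otimes> s \<oplus> a \<otimes> t" using ac by (simp add: r_distr)
    then show ?case using pw_D(3) sum by simp
  qed
qed

lemma pw_pow: "a \<in> I \<Longrightarrow> a [^] n \<in> pw n" for n :: nat
proof (induction n)
  case (Suc n)
  then show ?case using pw_mult[of "a [^] n" n a 1] by (simp add: pw_1[simplified])
qed (simp add: pw_0)

text \<open>Sequences of representatives for the elements of the inverse limit. The term
  \<open>r n\<close> matters modulo \<open>I^n\<close> only, so \<open>r 0\<close> carries no
  information, and the first meaningful term is \<open>r 1\<close>.\<close>

definition coherent :: "(nat \<Rightarrow> 'a) \<Rightarrow> bool"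
  where "coherent r \<longleftrightarrow> (\<forall>n. r n \<in> carrier R) \<and> (\<forall>n. r (Suc n) \<ominus> r n \<in> pw n)"

definition limit :: "(nat \<Rightarrow> 'a) \<Rightarrow> nat \<Rightarrow> 'a set"
  where "limit r = (\<lambda>n. pw n +> r n)"

lemma coherentD: "coherent r \<Longrightarrow> r n \<in> carrier R" "coherent r \<Longrightarrow> r (Suc n) \<ominus> r n \<in> pw n"
  by (auto simp: coherent_def)

lemma coherent_le: "n \<le> k \<Longrightarrow> coherent r \<Longrightarrow> r k \<ominus> r n \<in> pw n"
proof (induction k rule: dec_induct)
  case base
  then show ?case using coherentD pw_D(2) by (simp add: r_neg a_minus_def)
next
  case (step k)
  have "r (Suc k) \<ominus> r n = (r (Suc k) \<ominus> r k) \<oplus> (r k \<ominus> r n)"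
    using coherentD(1)[OF step(4), of "Suc k"] coherentD(1)[OF step(4), of k] coherentD(1)[OF step(4), of n]
    by - (rule ring_eqI, (rule reify | (simp add: algebra_simps; fail))+)
  moreover have "r (Suc k) \<ominus> r k \<in> pw n"
    using coherentD(2)[OF step(4), of k] pw_mono[OF step(1)] by auto
  ultimately show ?case using pw_D(3) step by simp
qed

lemma limit_mem: "coherent r \<Longrightarrow> x \<in> limit r n \<longleftrightarrow> x \<in> carrier R \<and> x \<ominus> r n \<in> pw n"
  by (simp add: limit_def coset_mem[OF pw_ideal] coherentD)

lemma limit_eq_iff:
  assumes "coherent r" "coherent s"
  shows "limit r = limit s \<longleftrightarrow> (\<forall>n. r n \<ominus> s n \<in> pw n)"
  unfolding limit_def fun_eq_iff
  using quotient_eq_iff_same_a_r_cos[OF pw_ideal coherentD(1)[OF assms(1)] coherentD(1)[OF assms(2)]] by simp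

lemma limit_closed:
  assumes r: "coherent r"
  shows "limit r \<in> carrier A"
proof -
  have "limit r n \<in> carrier (R Quot pw n)" for n
    using coherentD(1)[OF r, of n] by (auto simp: limit_def FactRing_def A_RCOSETS_def')
  moreover have "limit r (Suc n) \<subseteq> limit r n" for n
  proof
    fix x assume "x \<in> limit r (Suc n)"
    then have x: "x \<in> carrier R" "x \<ominus> r (Suc n) \<in> pw (Suc n)" by (simp_all add: limit_mem[OF r])
    have "x \<ominus> r n = (x \<ominus> r (Suc n)) \<oplus> (r (Suc n) \<ominus> r n)"
      using x(1) coherentD(1)[OF r, of "Suc n"] coherentD(1)[OF r, of n]
      by - (rule ring_eqI, (rule reify | (simp add: algebra_simps; fail))+)
    moreover have "x \<ominus> r (Suc n) \<in> pw n" using x(2) pw_Suc_subset by (rule subsetD[rotated])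
    ultimately show "x \<in> limit r n"
      using x(1) pw_D(3) coherentD(2)[OF r, of n] by (simp add: limit_mem[OF r])
  qed
  ultimately show ?thesis by (simp add: A_def)
qed

lemma A_E:
  assumes "\<xi> \<in> carrier A"
  obtains r where "coherent r" "\<xi> = limit r"
proof -
  have x: "\<xi> n \<in> carrier (R Quot pw n)" "\<xi> (Suc n) \<subseteq> \<xi> n" for n
    using assms by (auto simp: A_def)
  have "\<exists>a. a \<in> carrier R \<and> \<xi> n = pw n +> a" for n
    using x(1)[of n] by (auto simp: FactRing_def A_RCOSETS_def')
  then obtain r where r: "\<And>n. r n \<in> carrier R" "\<And>n. \<xi> n = pw n +> r n" by metis
  have "r (Suc n) \<ominus> r n \<in> pw n" for n
  proof -
    have "r (Suc n) \<in> \<xi> (Suc n)" unfolding r(2)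
      using r(1) pw_D(2) by (simp add: coset_mem[OF pw_ideal] a_minus_def r_neg)
    then have "r (Suc n) \<in> pw n +> r n" using x(2) r(2) by auto
    then show ?thesis using r(1) by (simp add: coset_mem[OF pw_ideal])
  qed
  then have "coherent r" using r by (simp add: coherent_def)
  moreover have "\<xi> = limit r" using r by (auto simp: limit_def)
  ultimately show thesis by (rule that)
qed

lemma coherent_add: "coherent r \<Longrightarrow> coherent s \<Longrightarrow> coherent (\<lambda>n. r n \<oplus> s n)"
  unfolding coherent_def
proof (intro conjI allI)
  fix n assume rs: "(\<forall>n. r n \<in> carrier R) \<and> (\<forall>n. r (Suc n) \<ominus> r n \<in> pw n)"
    "(\<forall>n. s n \<in> carrier R) \<and> (\<forall>n. s (Suc n) \<ominus> s n \<in> pw n)"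
  then have c: "r n \<in> carrier R" "r (Suc n) \<in> carrier R" "s n \<in> carrier R" "s (Suc n) \<in> carrier R" by auto
  then show "r n \<oplus> s n \<in> carrier R" by simp
  have "r (Suc n) \<oplus> s (Suc n) \<ominus> (r n \<oplus> s n) = (r (Suc n) \<ominus> r n) \<oplus> (s (Suc n) \<ominus> s n)"
    using c by - (rule ring_eqI, (rule reify | (simp add: algebra_simps; fail))+)
  then show "r (Suc n) \<oplus> s (Suc n) \<ominus> (r n \<oplus> s n) \<in> pw n" using rs pw_D(3) by simp
qed

lemma coherent_mult: "coherent r \<Longrightarrow> coherent s \<Longrightarrow> coherent (\<lambda>n. r n \<otimes> s n)"
  unfolding coherent_def
proof (intro conjI allI)
  fix n assume rs: "(\<forall>n. r n \<in> carrier R) \<and> (\<forall>n. r (Suc n) \<ominus> r n \<in> pw n)"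
    "(\<forall>n. s n \<in> carrier R) \<and> (\<forall>n. s (Suc n) \<ominus> s n \<in> pw n)"
  then have c: "r n \<in> carrier R" "r (Suc n) \<in> carrier R" "s n \<in> carrier R" "s (Suc n) \<in> carrier R" by auto
  then show "r n \<otimes> s n \<in> carrier R" by simp
  have "r (Suc n) \<otimes> s (Suc n) \<ominus> (r n \<otimes> s n) = s (Suc n) \<otimes> (r (Suc n) \<ominus> r n) \<oplus> r n \<otimes> (s (Suc n) \<ominus> s n)"
    using c by - (rule ring_eqI, (rule reify | (simp add: algebra_simps; fail))+)
  then show "r (Suc n) \<otimes> s (Suc n) \<ominus> (r n \<otimes> s n) \<in> pw n" using rs c pw_D(3,4) by simp
qed

lemma coherent_const: "a \<in> carrier R \<Longrightarrow> coherent (\<lambda>_. a)"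
  using pw_D(2) by (simp add: coherent_def a_minus_def r_neg)

lemma limit_ops:
  assumes "coherent r" "coherent s"
  shows "limit r \<oplus>\<^bsub>A\<^esub> limit s = limit (\<lambda>n. r n \<oplus> s n)" "limit r \<otimes>\<^bsub>A\<^esub> limit s = limit (\<lambda>n. r n \<otimes> s n)"
  using coherentD(1)[OF assms(1)] coherentD(1)[OF assms(2)] ideal.rcoset_mult_add[OF pw_ideal] ideal.a_rcos_sum[OF pw_ideal]
  by (auto simp: A_def limit_def FactRing_def)

lemma limit_consts: "\<one>\<^bsub>A\<^esub> = limit (\<lambda>_. \<one>)" "\<zero>\<^bsub>A\<^esub> = limit (\<lambda>_. \<zero>)"
proof -
  show "\<one>\<^bsub>A\<^esub> = limit (\<lambda>_. \<one>)" by (simp add: A_def limit_def FactRing_def)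
  have "pw n = pw n +> \<zero>" for n
    using pw_D(1)[of _ n] by (auto simp: coset_mem[OF pw_ideal] a_minus_def)
  then show "\<zero>\<^bsub>A\<^esub> = limit (\<lambda>_. \<zero>)" by (simp add: A_def limit_def FactRing_def)
qed

lemma limit_zero_iff: "coherent r \<Longrightarrow> limit r = \<zero>\<^bsub>A\<^esub> \<longleftrightarrow> (\<forall>n. r n \<in> pw n)"
  using limit_eq_iff[of r "\<lambda>_. \<zero>"] coherent_const[of \<zero>] coherentD(1)[of r]
  by (simp add: limit_consts a_minus_def)

lemma A_cring: "cring A"
proof (rule cringI)
  show "abelian_group A"
  proof (rule abelian_groupI)
    fix x y z assume "x \<in> carrier A" "y \<in> carrier A" "z \<in> carrier A"
    then obtain r s t where e: "coherent r" "x = limit r" "coherent s" "y = limit s" "coherent t" "z = limit t"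
      by (elim A_E) blast
    show "x \<oplus>\<^bsub>A\<^esub> y \<oplus>\<^bsub>A\<^esub> z = x \<oplus>\<^bsub>A\<^esub> (y \<oplus>\<^bsub>A\<^esub> z)"
      using e coherentD(1)[OF e(1)] coherentD(1)[OF e(3)] coherentD(1)[OF e(5)]
      by (simp add: limit_ops coherent_add a_assoc)
  next
    fix x y assume "x \<in> carrier A" "y \<in> carrier A"
    then obtain r s where e: "coherent r" "x = limit r" "coherent s" "y = limit s"
      by (elim A_E) blast
    note c = coherentD(1)[OF e(1)] coherentD(1)[OF e(3)]
    show "x \<oplus>\<^bsub>A\<^esub> y \<in> carrier A" using e by (simp add: limit_ops coherent_add limit_closed)
    show "x \<oplus>\<^bsub>A\<^esub> y = y \<oplus>\<^bsub>A\<^esub> x" using e c by (simp add: limit_ops a_comm)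
    show "\<zero>\<^bsub>A\<^esub> \<oplus>\<^bsub>A\<^esub> x = x" using e c by (simp add: limit_consts limit_ops coherent_const)
    have "coherent (\<lambda>n. \<ominus> \<one> \<otimes> r n)" by (rule coherent_mult[OF coherent_const e(1)]) simp
    then have m: "coherent (\<lambda>n. \<ominus> r n)" using c by (simp add: l_minus)
    then have "limit (\<lambda>n. \<ominus> r n) \<oplus>\<^bsub>A\<^esub> x = \<zero>\<^bsub>A\<^esub>"
      using e c by (simp add: limit_ops limit_consts l_neg)
    then show "\<exists>y \<in> carrier A. y \<oplus>\<^bsub>A\<^esub> x = \<zero>\<^bsub>A\<^esub>" using limit_closed[OF m] by blast
  qed (simp add: limit_consts limit_closed coherent_const)
  show "comm_monoid A"
  proof (rule comm_monoidI)
    fix x y z assume "x \<in> carrier A" "y \<in> carrier A" "z \<in> carrier A"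
    then obtain r s t where e: "coherent r" "x = limit r" "coherent s" "y = limit s" "coherent t" "z = limit t"
      by (elim A_E) blast
    show "x \<otimes>\<^bsub>A\<^esub> y \<otimes>\<^bsub>A\<^esub> z = x \<otimes>\<^bsub>A\<^esub> (y \<otimes>\<^bsub>A\<^esub> z)"
      using e coherentD(1)[OF e(1)] coherentD(1)[OF e(3)] coherentD(1)[OF e(5)]
      by (simp add: limit_ops coherent_mult m_assoc)
  next
    fix x y assume "x \<in> carrier A" "y \<in> carrier A"
    then obtain r s where e: "coherent r" "x = limit r" "coherent s" "y = limit s"
      by (elim A_E) blast
    note c = coherentD(1)[OF e(1)] coherentD(1)[OF e(3)]
    show "x \<otimes>\<^bsub>A\<^esub> y \<in> carrier A" using e by (simp add: limit_ops coherent_mult limit_closed)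
    show "x \<otimes>\<^bsub>A\<^esub> y = y \<otimes>\<^bsub>A\<^esub> x" using e c by (simp add: limit_ops m_comm)
    show "\<one>\<^bsub>A\<^esub> \<otimes>\<^bsub>A\<^esub> x = x" using e c by (simp add: limit_consts limit_ops coherent_const)
  qed (simp add: limit_consts limit_closed coherent_const)
  fix x y z assume "x \<in> carrier A" "y \<in> carrier A" "z \<in> carrier A"
  then obtain r s t where e: "coherent r" "x = limit r" "coherent s" "y = limit s" "coherent t" "z = limit t"
    by (elim A_E) blast
  show "(x \<oplus>\<^bsub>A\<^esub> y) \<otimes>\<^bsub>A\<^esub> z = x \<otimes>\<^bsub>A\<^esub> z \<oplus>\<^bsub>A\<^esub> y \<otimes>\<^bsub>A\<^esub> z"
    using e coherentD(1)[OF e(1)] coherentD(1)[OF e(3)] coherentD(1)[OF e(5)]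
    by (simp add: limit_ops coherent_mult coherent_add l_distr)
qed

sublocale A: cring A
  by (rule A_cring)

lemma coherent_minus: "coherent r \<Longrightarrow> coherent (\<lambda>n. \<ominus> r n)"
proof -
  assume r: "coherent r"
  have "coherent (\<lambda>n. \<ominus> \<one> \<otimes> r n)" by (rule coherent_mult[OF coherent_const r]) simp
  then show ?thesis using coherentD(1)[OF r] by (simp add: l_minus)
qed

lemma coherent_diff: "coherent r \<Longrightarrow> coherent s \<Longrightarrow> coherent (\<lambda>n. r n \<ominus> s n)"
  unfolding a_minus_def by (rule coherent_add[OF _ coherent_minus])

lemma limit_minus:
  assumes r: "coherent r"
  shows "\<ominus>\<^bsub>A\<^esub> limit r = limit (\<lambda>n. \<ominus> r n)"
proof (rule A.minus_equality)
  show "limit (\<lambda>n. \<ominus> r n) \<oplus>\<^bsub>A\<^esub> limit r = \<zero>\<^bsub>A\<^esub>"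
    using r coherent_minus[OF r] coherentD(1)[OF r] by (simp add: limit_ops limit_consts l_neg)
qed (use r coherent_minus limit_closed in auto)

lemma limit_diff:
  assumes "coherent r" "coherent s"
  shows "limit r \<ominus>\<^bsub>A\<^esub> limit s = limit (\<lambda>n. r n \<ominus> s n)"
  unfolding a_minus_def limit_minus[OF assms(2)] by (rule limit_ops(1)[OF assms(1) coherent_minus[OF assms(2)]])

abbreviation const where "const a \<equiv> limit (\<lambda>_. a)"

lemma const_simps:
  assumes "a \<in> carrier R" "b \<in> carrier R"
  shows "const a \<in> carrier A" "const (a \<oplus> b) = const a \<oplus>\<^bsub>A\<^esub> const b" "const (a \<otimes> b) = const a \<otimes>\<^bsub>A\<^esub> const b"
    "const (a \<ominus> b) = const a \<ominus>\<^bsub>A\<^esub> const b"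
  using assms by (simp_all add: limit_closed coherent_const limit_ops limit_diff)

lemma const_pow: "a \<in> carrier R \<Longrightarrow> const (a [^] n) = const a [^]\<^bsub>A\<^esub> n" for n :: nat
  by (induction n) (simp_all add: limit_consts const_simps)

end

sublocale noetherian_local_ring \<subseteq> adic_ring R \<mm>
  by (intro adic_ring.intro adic_ring_axioms.intro is_cring max_ideal_ideal)

lemma (in noetherian_local_ring) completion_eq: "completion R = A"
  by (simp add: completion_def)

subsection \<open>Recognizing discrete valuation rings\<close>

context cring
begin

lemma ideal_square_zero_iff:
  assumes P: "ideal P R"
  shows "ideal_power R P 2 = {\<zero>} \<longleftrightarrow> (\<forall>x \<in> P. \<forall>y \<in> P. x \<otimes> y = \<zero>)"
proof -
  have e: "ideal_power R P 2 = P \<cdot> P"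
    using ideal_power_simps(1,2)[OF P] ideal_prod_one[OF P] ideal_prod_commute[OF P oneideal]
    by (simp only: numeral_2_eq_2)
  have "x = \<zero>" if "x \<in> P \<cdot> P" "\<forall>x \<in> P. \<forall>y \<in> P. x \<otimes> y = \<zero>" for x
    using that(1) by (induction rule: ideal_prod.induct) (use that(2) in auto)
  moreover have "\<zero> \<in> P \<cdot> P" by (rule idealD(2)[OF ideal_prod_is_ideal[OF P P]])
  ultimately show ?thesis unfolding e using ideal_prod.prod[of _ P _ P R] by blast
qed

text \<open>No nonzero element is divisible by all powers of \<open>t\<close>, so each is
  \<open>t [^] k\<close> times a unit. Since \<open>t\<close> is regular, such products never
  vanish, which makes the ring a domain, and a nonzero ideal is generated by the smallest power of
  \<open>t\<close> in it.\<close>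

lemma dvrI:
  assumes t: "t \<in> carrier R" "t \<notin> Units R"
    and unit_or: "\<And>x. x \<in> carrier R \<Longrightarrow> x \<in> Units R \<or> (\<exists>y \<in> carrier R. x = t \<otimes> y)"
    and separated: "\<And>x. x \<in> carrier R \<Longrightarrow> (\<And>k :: nat. \<exists>y \<in> carrier R. x = t [^] k \<otimes> y) \<Longrightarrow> x = \<zero>"
    and regular: "\<And>x. x \<in> carrier R \<Longrightarrow> t \<otimes> x = \<zero> \<Longrightarrow> x = \<zero>"
  shows "dvr R"
proof -
  have one_zero: "\<one> \<noteq> \<zero>"
  proof
    assume "\<one> = \<zero>"
    then have "t = \<zero>" using t(1) r_one r_null by metis
    then show False using t Units_one_closed \<open>\<one> = \<zero>\<close> by simp
  qed
  have rep: "\<exists>k :: nat. \<exists>u \<in> Units R. x = t [^] k \<otimes> u" if x: "x \<in> carrier R" "x \<noteq> \<zero>" for x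
  proof -
    obtain n :: nat where n: "\<nexists>y. y \<in> carrier R \<and> x = t [^] n \<otimes> y" using separated x by blast
    \<comment> \<open>\<open>k\<close> is the first exponent for which \<open>t [^] k\<close> fails
      to divide \<open>x\<close>, so the exponent sought is its predecessor
      \<open>j\<close>.\<close>
    define k where "k = (LEAST n :: nat. \<nexists>y. y \<in> carrier R \<and> x = t [^] n \<otimes> y)"
    have k: "\<nexists>y. y \<in> carrier R \<and> x = t [^] k \<otimes> y"
      unfolding k_def using n by (rule LeastI)
    have "k \<noteq> 0"
    proof
      assume "k = 0"
      then have "x = t [^] k \<otimes> x" using x by simp
      then show False using k x by blast
    qed
    then obtain j where j: "k = Suc j" using not0_implies_Suc by blast
    have "\<exists>y. y \<in> carrier R \<and> x = t [^] j \<otimes> y"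
      using not_less_Least[of j "\<lambda>n :: nat. \<nexists>y. y \<in> carrier R \<and> x = t [^] n \<otimes> y"] j unfolding k_def by auto
    then obtain y where y: "y \<in> carrier R" "x = t [^] j \<otimes> y" by blast
    have "y \<in> Units R"
    proof (rule ccontr)
      assume "y \<notin> Units R"
      then obtain z where "z \<in> carrier R" "y = t \<otimes> z" using unit_or y by blast
      then have "x = t [^] k \<otimes> z" unfolding j y(2) using t by (simp add: m_assoc)
      then show False using k \<open>z \<in> carrier R\<close> by blast
    qed
    then show ?thesis using y by blast
  qed
  have nz: "t [^] k \<otimes> u \<noteq> \<zero>" if u: "u \<in> Units R" for k :: nat and u
  proof (induction k)
    case 0
    show ?case
    proof
      assume "t [^] (0::nat) \<otimes> u = \<zero>"
      then have "u = \<zero>" using Units_closed[OF u] by simp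
      then have "\<one> = \<zero>" using Units_r_inv[OF u] Units_inv_closed[OF u] by simp
      then show False using one_zero by simp
    qed
  next
    case (Suc k)
    have "t [^] Suc k \<otimes> u = t \<otimes> (t [^] k \<otimes> u)" using t(1) Units_closed[OF u]
      by - (rule ring_eqI, (rule reify | (simp add: algebra_simps; fail))+)
    then show ?case using Suc regular[of "t [^] k \<otimes> u"] t(1) Units_closed[OF u] by auto
  qed
  have dom: "domain R"
  proof (rule domainI[OF is_cring])
    show "\<one> \<noteq> \<zero>" by (rule one_zero)
    fix a b assume ab: "a \<otimes> b = \<zero>" "a \<in> carrier R" "b \<in> carrier R"
    show "a = \<zero> \<or> b = \<zero>"
    proof (rule ccontr)
      assume "\<not> ?thesis"
      then have "a \<noteq> \<zero>" "b \<noteq> \<zero>" by auto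
      then obtain k l :: nat and u v where e: "u \<in> Units R" "a = t [^] k \<otimes> u" "v \<in> Units R" "b = t [^] l \<otimes> v"
        using rep[OF ab(2)] rep[OF ab(3)] by auto
      have "a \<otimes> b = t [^] (k + l) \<otimes> (u \<otimes> v)"
        unfolding e(2,4) using t(1) Units_closed[OF e(1)] Units_closed[OF e(3)]
        by (simp add: nat_pow_mult[symmetric] m_ac)
      then show False using nz[OF Units_m_closed[OF e(1,3)], of "k + l"] ab(1) by simp
    qed
  qed
  interpret domain R by (rule dom)
  have "principal_domain R"
  proof (intro principal_domain.intro principal_domain_axioms.intro dom)
    fix I assume I: "ideal I R"
    note Ic = idealD[OF I]
    show "\<exists>a \<in> carrier R. I = PIdl a"
    proof (cases "I = {\<zero>}")
      case True
      have "x \<in> PIdl \<zero> \<longleftrightarrow> x = \<zero>" for x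
        unfolding PIdl_iff by (metis r_null zero_closed)
      then have "PIdl \<zero> = {\<zero>}" by blast
      then show ?thesis using True by auto
    next
      case False
      then obtain x where x: "x \<in> I" "x \<noteq> \<zero>" using Ic(2) by blast
      have pwI: "t [^] k \<in> I" if "u \<in> Units R" "t [^] k \<otimes> u \<in> I" for k :: nat and u
      proof -
        have "inv u \<otimes> (t [^] k \<otimes> u) \<in> I" using Ic(4)[OF Units_inv_closed[OF that(1)] that(2)] .
        moreover have "inv u \<otimes> (t [^] k \<otimes> u) = t [^] k \<otimes> (u \<otimes> inv u)"
          using t(1) Units_closed[OF that(1)] Units_inv_closed[OF that(1)]
          by - (rule ring_eqI, (rule reify | (simp add: algebra_simps; fail))+)
        ultimately show ?thesis using Units_r_inv[OF that(1)] t(1) by simp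
      qed
      obtain n :: nat where n: "t [^] n \<in> I" using rep[OF Ic(1)[OF x(1)] x(2)] pwI x(1) by blast
      define k where "k = (LEAST n :: nat. t [^] n \<in> I)"
      have k: "t [^] k \<in> I" unfolding k_def using n by (rule LeastI)
      have "I = PIdl (t [^] k)"
      proof
        show "PIdl (t [^] k) \<subseteq> I" using Ic(4) k by (auto simp: PIdl_iff)
        show "I \<subseteq> PIdl (t [^] k)"
        proof
          fix y assume y: "y \<in> I"
          show "y \<in> PIdl (t [^] k)"
          proof (cases "y = \<zero>")
            case True
            then have "y = \<zero> \<otimes> t [^] k" using t(1) by simp
            then show ?thesis unfolding PIdl_iff using zero_closed by blast
          next
            case False
            obtain j :: nat and u where u: "u \<in> Units R" "y = t [^] j \<otimes> u"
              using rep[OF Ic(1)[OF y] False] by blast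
            have "t [^] j \<in> I" using pwI[OF u(1)] y u(2) by simp
            then have "k \<le> j" unfolding k_def by (rule Least_le)
            then obtain i where i: "j = k + i" using le_Suc_ex by blast
            have "y = (t [^] i \<otimes> u) \<otimes> t [^] k"
              unfolding u(2) i using t(1) Units_closed[OF u(1)] by (simp add: nat_pow_mult[symmetric] m_ac)
            then show ?thesis unfolding PIdl_iff using t(1) Units_closed[OF u(1)] by blast
          qed
        qed
      qed
      then show ?thesis using t(1) by blast
    qed
  qed
  moreover have "quasilocal_ring R"
  proof -
    have tI: "ideal (PIdl t) R" by (rule PIdl_ideal[OF t(1)])
    have t_one: "\<one> \<notin> PIdl t"
    proof
      assume "\<one> \<in> PIdl t"
      then obtain r where "r \<in> carrier R" "\<one> = r \<otimes> t" by (auto simp: PIdl_iff)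
      then show False using t m_comm[of r t] unfolding Units_def by auto
    qed
    have sub: "J \<subseteq> PIdl t" if J: "ideal J R" "\<one> \<notin> J" for J
    proof
      fix x assume x: "x \<in> J"
      then have xc: "x \<in> carrier R" using idealD(1)[OF J(1)] by blast
      have "x \<notin> Units R"
      proof
        assume u: "x \<in> Units R"
        then have "inv x \<otimes> x \<in> J" using idealD(4)[OF J(1) Units_inv_closed[OF u] x] by simp
        then show False using J(2) Units_l_inv[OF u] by simp
      qed
      then obtain y where "y \<in> carrier R" "x = t \<otimes> y" using unit_or[OF xc] by blast
      then show "x \<in> PIdl t" unfolding PIdl_iff using t(1) m_comm by blast
    qed
    have max: "maximalideal (PIdl t) R"
    proof (rule maximalidealI[OF tI])
      show "carrier R \<noteq> PIdl t" using t_one by auto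
      fix J assume J: "ideal J R" "PIdl t \<subseteq> J" "J \<subseteq> carrier R"
      then show "J = PIdl t \<or> J = carrier R"
        using sub[OF J(1)] ideal.one_imp_carrier[OF J(1)] by blast
    qed
    moreover have "J = PIdl t" if J: "maximalideal J R" for J
    proof -
      have Ji: "ideal J R" using J by (rule maximalideal.axioms)
      have "\<one> \<notin> J" using maximalideal.I_notcarr[OF J] ideal.one_imp_carrier[OF Ji] by blast
      then have "PIdl t = J \<or> PIdl t = carrier R"
        using maximalideal.I_maximal[OF J tI] sub[OF Ji] idealD(1)[OF tI] by blast
      then show ?thesis using t_one by auto
    qed
    ultimately show ?thesis unfolding quasilocal_ring_def using is_cring by blast
  qed
  moreover have "\<not> field R"
  proof
    assume "field R"
    then have "t = \<zero>" using t field.field_Units by blast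
    then have "\<one> = \<zero>" using regular[OF one_closed] by simp
    then show False using one_zero by simp
  qed
  ultimately show ?thesis by (simp add: dvr_def)
qed

end

text \<open>\<open>dvrI\<close> for the quotient, phrased with representatives. The first
  alternative of \<open>unit_or\<close> asks for a unit of \<open>R\<close> itself, which the
  completion of a local ring can supply. Primality of \<open>P\<close> follows at the end, as a
  discrete valuation ring is a domain.\<close>

lemma (in cring) dvr_quotientI:
  assumes P: "ideal P R" and t: "t \<in> carrier R"
    and unit_or: "\<And>x. x \<in> carrier R \<Longrightarrow> x \<in> Units R \<or> (\<exists>y \<in> carrier R. x \<ominus> t \<otimes> y \<in> P)"
    and separated: "\<And>x. x \<in> carrier R \<Longrightarrow> (\<And>k :: nat. \<exists>y \<in> carrier R. x \<ominus> t [^] k \<otimes> y \<in> P) \<Longrightarrow> x \<in> P"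
    and regular: "\<And>x. x \<in> carrier R \<Longrightarrow> t \<otimes> x \<in> P \<Longrightarrow> x \<in> P"
    and proper: "\<And>y. y \<in> carrier R \<Longrightarrow> \<one> \<ominus> t \<otimes> y \<notin> P"
  shows "dvr (R Quot P)" "primeideal P R"
proof -
  interpret P: ideal P R by (rule P)
  have "carrier (R Quot P) = (\<lambda>x. P +> x) ` carrier R"
    by (auto simp: FactRing_def A_RCOSETS_def')
  then have car: "\<exists>x \<in> carrier R. w = P +> x" if "w \<in> carrier (R Quot P)" for w
    using that by blast
  interpret h: ring_hom_cring R "R Quot P" "(+>) P" by (rule P.rcos_ring_hom_cring[OF is_cring])
  have eq: "P +> x = P +> y \<longleftrightarrow> x \<ominus> y \<in> P" if "x \<in> carrier R" "y \<in> carrier R" for x y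
    using quotient_eq_iff_same_a_r_cos[OF P that] by simp
  have zero: "P +> x = \<zero>\<^bsub>R Quot P\<^esub> \<longleftrightarrow> x \<in> P" if "x \<in> carrier R" for x
    using eq[OF that zero_closed] that by (simp add: a_minus_def)
  have pow: "P +> (t [^] k) = (P +> t) [^]\<^bsub>R Quot P\<^esub> k" for k :: nat
    by (induction k) (use t in simp_all)
  show dvr: "dvr (R Quot P)"
  proof (rule cring.dvrI[OF P.quotient_is_cring[OF is_cring], of "P +> t"])
    show tc: "P +> t \<in> carrier (R Quot P)" using t by simp
    show "P +> t \<notin> Units (R Quot P)"
    proof
      assume "P +> t \<in> Units (R Quot P)"
      then obtain w where w: "w \<in> carrier (R Quot P)" "(P +> t) \<otimes>\<^bsub>R Quot P\<^esub> w = \<one>\<^bsub>R Quot P\<^esub>"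
        unfolding Units_def by blast
      then obtain y where y: "y \<in> carrier R" "w = P +> y" using car by blast
      then have "P +> \<one> = P +> (t \<otimes> y)" using w t by simp
      then show False using eq[of \<one> "t \<otimes> y"] y t proper by simp
    qed
  next
    fix w assume "w \<in> carrier (R Quot P)"
    then obtain x where x: "x \<in> carrier R" "w = P +> x" using car by blast
    show "w \<in> Units (R Quot P) \<or> (\<exists>y \<in> carrier (R Quot P). w = (P +> t) \<otimes>\<^bsub>R Quot P\<^esub> y)"
      using unit_or[OF x(1)]
    proof
      assume u: "x \<in> Units R"
      have "w \<otimes>\<^bsub>R Quot P\<^esub> (P +> inv x) = \<one>\<^bsub>R Quot P\<^esub>" "(P +> inv x) \<otimes>\<^bsub>R Quot P\<^esub> w = \<one>\<^bsub>R Quot P\<^esub>"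
        unfolding x(2) using u x(1) by (simp_all flip: h.hom_mult)
      moreover have "w \<in> carrier (R Quot P)" "P +> inv x \<in> carrier (R Quot P)" using x u by simp_all
      ultimately show ?thesis unfolding Units_def by blast
    next
      assume "\<exists>y \<in> carrier R. x \<ominus> t \<otimes> y \<in> P"
      then obtain y where y: "y \<in> carrier R" "x \<ominus> t \<otimes> y \<in> P" by blast
      then have "w = (P +> t) \<otimes>\<^bsub>R Quot P\<^esub> (P +> y)"
        using eq[of x "t \<otimes> y"] x t by simp
      then show ?thesis using y by blast
    qed
  next
    fix w assume "w \<in> carrier (R Quot P)"
      and s: "\<And>k :: nat. \<exists>y \<in> carrier (R Quot P). w = (P +> t) [^]\<^bsub>R Quot P\<^esub> k \<otimes>\<^bsub>R Quot P\<^esub> y"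
    then obtain x where x: "x \<in> carrier R" "w = P +> x" using car by blast
    have "\<exists>y \<in> carrier R. x \<ominus> t [^] k \<otimes> y \<in> P" for k :: nat
    proof -
      obtain w' where "w' \<in> carrier (R Quot P)" "w = (P +> t) [^]\<^bsub>R Quot P\<^esub> k \<otimes>\<^bsub>R Quot P\<^esub> w'"
        using s by blast
      then obtain y where y: "y \<in> carrier R" "w = P +> (t [^] k \<otimes> y)" using car t by (auto simp: pow)
      then show ?thesis using eq[of x "t [^] k \<otimes> y"] x t by auto
    qed
    then show "w = \<zero>\<^bsub>R Quot P\<^esub>" using separated[OF x(1)] zero x by simp
  next
    fix w assume "w \<in> carrier (R Quot P)" and s: "(P +> t) \<otimes>\<^bsub>R Quot P\<^esub> w = \<zero>\<^bsub>R Quot P\<^esub>"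
    then obtain x where x: "x \<in> carrier R" "w = P +> x" using car by blast
    then have "P +> (t \<otimes> x) = \<zero>\<^bsub>R Quot P\<^esub>" using s t by simp
    then have "t \<otimes> x \<in> P" using zero[of "t \<otimes> x"] x(1) t by simp
    then have "x \<in> P" by (rule regular[OF x(1)])
    then show "w = \<zero>\<^bsub>R Quot P\<^esub>" using zero[OF x(1)] x(2) by simp
  qed
  have "principal_domain (R Quot P)" using dvr unfolding dvr_def by (rule conjunct1)
  then have "domain (R Quot P)" by (rule principal_domain.axioms(1))
  then show "primeideal P R" by (rule quot_domain_imp_primeideal[OF P])
qed

subsection \<open>The square-zero prime of a bad stable domain\<close>

text \<open>From \<open>\<mm>^2 \<subseteq> m \<mm>\<close> follows
  \<open>\<mm>^(n + 1) \<subseteq> m^n \<mm>\<close>: at each step \<open>sq\<close> trades the new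
  factor for one more \<open>m\<close>. Membership in a power of \<open>\<mm>\<close> becomes
  divisibility by a power of \<open>m\<close>, at the cost of one exponent.\<close>

lemma (in noetherian_local_ring) pw_Suc_divisible:
  assumes m: "m \<in> carrier R" and sq: "\<And>a b. a \<in> \<mm> \<Longrightarrow> b \<in> \<mm> \<Longrightarrow> \<exists>c \<in> \<mm>. a \<otimes> b = m \<otimes> c"
  shows "a \<in> pw (Suc n) \<Longrightarrow> \<exists>c \<in> \<mm>. a = m [^] n \<otimes> c"
proof (induction n arbitrary: a)
  case 0
  then have "a \<in> \<mm>" using pw_1 by simp
  then show ?case using idealD(1)[OF max_ideal_ideal] by auto
next
  case (Suc n)
  note mc = idealD(1)[OF max_ideal_ideal]
  from Suc(2) have "a \<in> pw (Suc n) \<cdot> \<mm>" by (simp add: pw_Suc[of "Suc n"])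
  then show ?case
  proof (induction rule: ideal_prod.induct)
    case (prod i j)
    obtain c where c: "c \<in> \<mm>" "i = m [^] n \<otimes> c" using Suc.IH[OF prod(1)] by blast
    obtain d where d: "d \<in> \<mm>" "c \<otimes> j = m \<otimes> d" using sq[OF c(1) prod(2)] by blast
    have "i \<otimes> j = m [^] n \<otimes> (c \<otimes> j)" using c mc[OF c(1)] mc[OF prod(2)] m by (simp add: m_assoc)
    also have "\<dots> = m [^] Suc n \<otimes> d" unfolding d(2) using mc[OF d(1)] m by (simp add: m_assoc)
    finally show ?case using d by blast
  next
    case (sum s t)
    then obtain c d where cd: "c \<in> \<mm>" "s = m [^] Suc n \<otimes> c" "d \<in> \<mm>" "t = m [^] Suc n \<otimes> d" by blast
    then have "s \<oplus> t = m [^] Suc n \<otimes> (c \<oplus> d)" using mc[OF cd(1)] mc[OF cd(3)] m by (simp add: r_distr)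
    then show ?case using idealD(3)[OF max_ideal_ideal cd(1,3)] by blast
  qed
qed

section \<open>The powers of the uniformizer in \<open>V\<close> and the prime
  \<open>P\<close>\<close>

locale uniformized_domain = noetherian_local_domain +
  fixes m
  assumes bad: "bad_stable_subring Q B"
    and m: "m \<in> \<mm>" "m \<noteq> \<zero>"
    and m_divides: "a \<in> \<mm> \<Longrightarrow> \<exists>v \<in> almost_integral Q B. emb a = emb m \<otimes>\<^bsub>Q\<^esub> v"
    and V_approx: "x \<in> almost_integral Q B \<Longrightarrow>
      \<exists>t \<in> carrier R. \<exists>v \<in> almost_integral Q B. x = emb t \<oplus>\<^bsub>Q\<^esub> emb m \<otimes>\<^bsub>Q\<^esub> v"
begin

sublocale S: bad_stable_subring Q B
  by (rule bad)

abbreviation V where "V \<equiv> almost_integral Q B"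
abbreviation \<mu> where "\<mu> \<equiv> emb m"

lemma mc [simp]: "m \<in> carrier R"
  using m idealD(1)[OF max_ideal_ideal] by blast

lemma \<mu>_simps [simp]: "\<mu> \<in> carrier Q" "\<mu> \<noteq> \<zero>\<^bsub>Q\<^esub>" "\<mu> [^]\<^bsub>Q\<^esub> (n::nat) \<noteq> \<zero>\<^bsub>Q\<^esub>"
proof -
  show 1: "\<mu> \<in> carrier Q" "\<mu> \<noteq> \<zero>\<^bsub>Q\<^esub>" using m emb_simps(5)[of m m] by simp_all
  show "\<mu> [^]\<^bsub>Q\<^esub> n \<noteq> \<zero>\<^bsub>Q\<^esub>"
    using 1 by (induction n) (auto simp: Q.integral_iff)
qed

lemma emb_pow: "a \<in> carrier R \<Longrightarrow> emb (a [^] n) = emb a [^]\<^bsub>Q\<^esub> n" for n :: nat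
  by (induction n) (simp_all add: emb_consts emb_simps)

lemma emb_diff: "a \<in> carrier R \<Longrightarrow> b \<in> carrier R \<Longrightarrow> emb (a \<ominus> b) = emb a \<ominus>\<^bsub>Q\<^esub> emb b"
proof -
  interpret h: ring_hom_cring R Q emb by (rule emb_hom)
  show "a \<in> carrier R \<Longrightarrow> b \<in> carrier R \<Longrightarrow> emb (a \<ominus> b) = emb a \<ominus>\<^bsub>Q\<^esub> emb b"
    by (simp add: a_minus_def emb_simps)
qed

lemma emb_V [simp]: "a \<in> carrier R \<Longrightarrow> emb a \<in> V"
  by (rule Q.B_subset_V) simp

definition mV :: "nat \<Rightarrow> ('a \<times> 'a) set set"
  where "mV n = {\<mu> [^]\<^bsub>Q\<^esub> n \<otimes>\<^bsub>Q\<^esub> v | v. v \<in> V}"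

lemma mV_E: "x \<in> mV n \<Longrightarrow> (\<And>v. v \<in> V \<Longrightarrow> x = \<mu> [^]\<^bsub>Q\<^esub> n \<otimes>\<^bsub>Q\<^esub> v \<Longrightarrow> thesis) \<Longrightarrow> thesis"
  unfolding mV_def by blast

lemma mV_I: "v \<in> V \<Longrightarrow> \<mu> [^]\<^bsub>Q\<^esub> n \<otimes>\<^bsub>Q\<^esub> v \<in> mV n"
  unfolding mV_def by blast

lemma mV_add: "x \<in> mV n \<Longrightarrow> y \<in> mV n \<Longrightarrow> x \<oplus>\<^bsub>Q\<^esub> y \<in> mV n"
proof (elim mV_E)
  fix v w assume "v \<in> V" "w \<in> V" "x = \<mu> [^]\<^bsub>Q\<^esub> n \<otimes>\<^bsub>Q\<^esub> v" "y = \<mu> [^]\<^bsub>Q\<^esub> n \<otimes>\<^bsub>Q\<^esub> w"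
  then show ?thesis using mV_I[of "v \<oplus>\<^bsub>Q\<^esub> w" n] by (simp add: Q.r_distr)
qed

lemma mV_diff: "x \<in> mV n \<Longrightarrow> y \<in> mV n \<Longrightarrow> x \<ominus>\<^bsub>Q\<^esub> y \<in> mV n"
proof (elim mV_E)
  fix v w assume a: "v \<in> V" "w \<in> V" "x = \<mu> [^]\<^bsub>Q\<^esub> n \<otimes>\<^bsub>Q\<^esub> v" "y = \<mu> [^]\<^bsub>Q\<^esub> n \<otimes>\<^bsub>Q\<^esub> w"
  have "x \<ominus>\<^bsub>Q\<^esub> y = \<mu> [^]\<^bsub>Q\<^esub> n \<otimes>\<^bsub>Q\<^esub> (v \<ominus>\<^bsub>Q\<^esub> w)"
    unfolding a(3,4) using Q.V_carrier[OF a(1)] Q.V_carrier[OF a(2)]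
    by (simp add: a_minus_def Q.r_distr Q.r_minus)
  then show ?thesis using mV_I[of "v \<ominus>\<^bsub>Q\<^esub> w" n] a by simp
qed

lemma mV_mult: "x \<in> mV n \<Longrightarrow> y \<in> mV k \<Longrightarrow> x \<otimes>\<^bsub>Q\<^esub> y \<in> mV (n + k)"
proof (elim mV_E)
  fix v w assume a: "v \<in> V" "w \<in> V" "x = \<mu> [^]\<^bsub>Q\<^esub> n \<otimes>\<^bsub>Q\<^esub> v" "y = \<mu> [^]\<^bsub>Q\<^esub> k \<otimes>\<^bsub>Q\<^esub> w"
  have "x \<otimes>\<^bsub>Q\<^esub> y = \<mu> [^]\<^bsub>Q\<^esub> (n + k) \<otimes>\<^bsub>Q\<^esub> (v \<otimes>\<^bsub>Q\<^esub> w)"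
    unfolding a(3,4) using Q.V_carrier[OF a(1)] Q.V_carrier[OF a(2)]
    by (simp add: Q.nat_pow_mult[symmetric] Q.m_ac)
  then show ?thesis using mV_I[of "v \<otimes>\<^bsub>Q\<^esub> w"] a by simp
qed

lemma mV_0: "mV 0 = V"
proof
  show "mV 0 \<subseteq> V" by (auto simp: mV_def)
  show "V \<subseteq> mV 0"
  proof
    fix v assume v: "v \<in> V"
    then have "\<mu> [^]\<^bsub>Q\<^esub> (0::nat) \<otimes>\<^bsub>Q\<^esub> v = v" by simp
    then show "v \<in> mV 0" using mV_I[OF v, of 0] by simp
  qed
qed

lemma mV_emb_mult: "a \<in> carrier R \<Longrightarrow> x \<in> mV n \<Longrightarrow> emb a \<otimes>\<^bsub>Q\<^esub> x \<in> mV n"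
  using mV_mult[of "emb a" 0 x n] by (simp add: mV_0)

lemma mV_mono: "n \<le> k \<Longrightarrow> x \<in> mV k \<Longrightarrow> x \<in> mV n"
proof (elim mV_E)
  fix v assume n: "n \<le> k" and v: "v \<in> V" "x = \<mu> [^]\<^bsub>Q\<^esub> k \<otimes>\<^bsub>Q\<^esub> v"
  obtain i where i: "k = n + i" using n le_Suc_ex by blast
  have "x = \<mu> [^]\<^bsub>Q\<^esub> n \<otimes>\<^bsub>Q\<^esub> (\<mu> [^]\<^bsub>Q\<^esub> i \<otimes>\<^bsub>Q\<^esub> v)"
    unfolding v(2) i using v(1) by (simp add: Q.nat_pow_mult[symmetric] Q.m_assoc)
  then show ?thesis using mV_I[of "\<mu> [^]\<^bsub>Q\<^esub> i \<otimes>\<^bsub>Q\<^esub> v" n] v by simp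
qed

lemma mV_pow_cancel: "x \<in> carrier Q \<Longrightarrow> \<mu> \<otimes>\<^bsub>Q\<^esub> x \<in> mV (Suc n) \<Longrightarrow> x \<in> mV n"
proof (elim mV_E)
  fix v assume x: "x \<in> carrier Q" and v: "v \<in> V" "\<mu> \<otimes>\<^bsub>Q\<^esub> x = \<mu> [^]\<^bsub>Q\<^esub> Suc n \<otimes>\<^bsub>Q\<^esub> v"
  have "\<mu> \<otimes>\<^bsub>Q\<^esub> x = \<mu> \<otimes>\<^bsub>Q\<^esub> (\<mu> [^]\<^bsub>Q\<^esub> n \<otimes>\<^bsub>Q\<^esub> v)"
    unfolding v(2) using v(1) by (simp add: Q.m_ac)
  then have "x = \<mu> [^]\<^bsub>Q\<^esub> n \<otimes>\<^bsub>Q\<^esub> v" using x v(1) by (subst (asm) Q.m_lcancel) auto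
  then show ?thesis using mV_I v by simp
qed

lemma \<mu>_mV: "x \<in> mV n \<Longrightarrow> \<mu> \<otimes>\<^bsub>Q\<^esub> x \<in> mV (Suc n)"
proof (elim mV_E)
  fix v assume v: "v \<in> V" "x = \<mu> [^]\<^bsub>Q\<^esub> n \<otimes>\<^bsub>Q\<^esub> v"
  have "\<mu> \<otimes>\<^bsub>Q\<^esub> x = \<mu> [^]\<^bsub>Q\<^esub> Suc n \<otimes>\<^bsub>Q\<^esub> v"
    unfolding v(2) using v(1) by (simp add: Q.m_ac)
  then show ?thesis using mV_I[OF v(1), of "Suc n"] by simp
qed

text \<open>An inverse \<open>v\<close> of \<open>\<mu>\<close> would satisfy
  \<open>v^2 = a + b v\<close>. Multiplied by \<open>\<mu>^2\<close> this reads
  \<open>\<one> = \<mu>^2 a + \<mu> b\<close>, a nonunit of \<open>B\<close>.\<close>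

lemma one_notin_mV: "\<one>\<^bsub>Q\<^esub> \<notin> mV 1"
proof
  assume "\<one>\<^bsub>Q\<^esub> \<in> mV 1"
  then obtain v where v1: "v \<in> V" "\<one>\<^bsub>Q\<^esub> = \<mu> [^]\<^bsub>Q\<^esub> (1::nat) \<otimes>\<^bsub>Q\<^esub> v" by (rule mV_E)
  have "\<mu> [^]\<^bsub>Q\<^esub> (1::nat) = \<mu>" by simp
  then have v: "v \<in> V" "\<mu> \<otimes>\<^bsub>Q\<^esub> v = \<one>\<^bsub>Q\<^esub>" using v1 by (simp_all only:)
  obtain a b where ab: "a \<in> B" "b \<in> B" "v \<otimes>\<^bsub>Q\<^esub> v = a \<oplus>\<^bsub>Q\<^esub> b \<otimes>\<^bsub>Q\<^esub> v" using S.quadratic[OF v(1)] by blast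
  have M: "\<mu> \<in> nonunits Q B" using nonunits_iff[OF mc] m by simp
  note cs = Q.V_carrier[OF v(1)] ab(1,2)[THEN Q.B_carrier]
  have "\<one>\<^bsub>Q\<^esub> = \<mu> \<otimes>\<^bsub>Q\<^esub> \<mu> \<otimes>\<^bsub>Q\<^esub> (v \<otimes>\<^bsub>Q\<^esub> v)"
  proof -
    have "\<mu> \<otimes>\<^bsub>Q\<^esub> \<mu> \<otimes>\<^bsub>Q\<^esub> (v \<otimes>\<^bsub>Q\<^esub> v) = (\<mu> \<otimes>\<^bsub>Q\<^esub> v) \<otimes>\<^bsub>Q\<^esub> (\<mu> \<otimes>\<^bsub>Q\<^esub> v)" using cs(1) by (simp add: Q.m_ac)
    then show ?thesis by (simp add: v(2))
  qed
  also have "\<dots> = \<mu> \<otimes>\<^bsub>Q\<^esub> \<mu> \<otimes>\<^bsub>Q\<^esub> a \<oplus>\<^bsub>Q\<^esub> \<mu> \<otimes>\<^bsub>Q\<^esub> b \<otimes>\<^bsub>Q\<^esub> (\<mu> \<otimes>\<^bsub>Q\<^esub> v)"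
    unfolding ab(3) using cs by (simp add: Q.r_distr Q.m_ac)
  also have "\<dots> = \<mu> \<otimes>\<^bsub>Q\<^esub> \<mu> \<otimes>\<^bsub>Q\<^esub> a \<oplus>\<^bsub>Q\<^esub> \<mu> \<otimes>\<^bsub>Q\<^esub> b"
    using cs by (simp add: v(2))
  finally have "\<one>\<^bsub>Q\<^esub> \<in> nonunits Q B" using M ab by (simp add: S.local)
  then show False by simp
qed

lemma emb_mV1_iff: "a \<in> carrier R \<Longrightarrow> emb a \<in> mV 1 \<longleftrightarrow> a \<in> \<mm>"
proof
  assume a: "a \<in> carrier R" "emb a \<in> mV 1"
  show "a \<in> \<mm>"
  proof (rule ccontr)
    assume "a \<notin> \<mm>"
    then obtain b where b: "b \<in> carrier R" "a \<otimes> b = \<one>" using unit_iff a by blast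
    have "emb b \<otimes>\<^bsub>Q\<^esub> emb a \<in> mV 1" by (rule mV_emb_mult[OF b(1) a(2)])
    moreover have "emb b \<otimes>\<^bsub>Q\<^esub> emb a = \<one>\<^bsub>Q\<^esub>" using a b by (simp add: m_comm emb_consts flip: emb_simps(2))
    ultimately show False using one_notin_mV by simp
  qed
next
  assume "a \<in> \<mm>"
  then obtain v where v: "v \<in> V" "emb a = \<mu> \<otimes>\<^bsub>Q\<^esub> v" using m_divides by blast
  have "\<mu> [^]\<^bsub>Q\<^esub> (1::nat) = \<mu>" by simp
  then show "emb a \<in> mV 1" unfolding v(2) using mV_I[OF v(1), of 1] by (simp only:)
qed

lemma pw_mV: "a \<in> pw n \<Longrightarrow> emb a \<in> mV n"
proof (induction n arbitrary: a)
  case 0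
  then show ?case by (simp add: pw_0 mV_0)
next
  case (Suc n)
  from Suc(2) have "a \<in> pw n \<cdot> \<mm>" by (simp add: pw_Suc)
  then show ?case
  proof (induction rule: ideal_prod.induct)
    case (prod i j)
    then have "emb i \<otimes>\<^bsub>Q\<^esub> emb j \<in> mV (n + 1)"
      using mV_mult[OF Suc.IH] emb_mV1_iff max_carrier by blast
    then show ?case using prod pw_D(1) max_carrier by (simp add: emb_simps)
  next
    case (sum s t)
    have "s \<in> carrier R" "t \<in> carrier R" using sum ideal_prod_in_carrier[OF pw_ideal max_ideal_ideal] by blast+
    then show ?case using mV_add sum by (simp add: emb_simps)
  qed
qed

text \<open>\<open>product_in_span_scaled\<close> with the factor \<open>\<mu>^n\<close>, read back
  in \<open>R\<close>.\<close>

lemma product_divisible: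
  assumes a: "a \<in> carrier R" "emb a \<in> mV n" and b: "b \<in> carrier R" "emb b \<in> mV n"
  shows "\<exists>p \<in> carrier R. \<exists>q \<in> carrier R. \<exists>r \<in> carrier R.
    a \<otimes> b = m [^] n \<otimes> (p \<otimes> m [^] n \<oplus> q \<otimes> a \<oplus> r \<otimes> b)"
proof -
  obtain v w where v: "v \<in> V" "emb a = \<mu> [^]\<^bsub>Q\<^esub> n \<otimes>\<^bsub>Q\<^esub> v" and w: "w \<in> V" "emb b = \<mu> [^]\<^bsub>Q\<^esub> n \<otimes>\<^bsub>Q\<^esub> w"
    using a b by (auto elim!: mV_E)
  obtain p' q' r' where "p' \<in> B" "q' \<in> B" "r' \<in> B" and eq:
    "emb a \<otimes>\<^bsub>Q\<^esub> emb b = \<mu> [^]\<^bsub>Q\<^esub> n \<otimes>\<^bsub>Q\<^esub> (p' \<otimes>\<^bsub>Q\<^esub> \<mu> [^]\<^bsub>Q\<^esub> n \<oplus>\<^bsub>Q\<^esub> q' \<otimes>\<^bsub>Q\<^esub> emb a \<oplus>\<^bsub>Q\<^esub> r' \<otimes>\<^bsub>Q\<^esub> emb b)"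
    using S.product_in_span_scaled[OF _ v(1) w(1), of "\<mu> [^]\<^bsub>Q\<^esub> n"] unfolding v(2)[symmetric] w(2)[symmetric] by auto
  then obtain p q r where c: "p \<in> carrier R" "q \<in> carrier R" "r \<in> carrier R" and e: "p' = emb p" "q' = emb q" "r' = emb r"
    by (auto simp: base_ring_iff)
  have "emb (a \<otimes> b) = emb (m [^] n \<otimes> (p \<otimes> m [^] n \<oplus> q \<otimes> a \<oplus> r \<otimes> b))"
    using eq a(1) b(1) c unfolding e by (simp add: emb_simps(2,3) emb_pow)
  then have "a \<otimes> b = m [^] n \<otimes> (p \<otimes> m [^] n \<oplus> q \<otimes> a \<oplus> r \<otimes> b)"
    using a b c by (simp add: emb_simps(4))
  then show ?thesis using c by blast
qed

text \<open>\<open>product_divisible\<close> for \<open>n = 1\<close>: the cofactor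
  \<open>p m + q a + r b\<close> lies in \<open>\<mm>\<close> as \<open>m\<close>, \<open>a\<close>
  and \<open>b\<close> do.\<close>

lemma max_square: "a \<in> \<mm> \<Longrightarrow> b \<in> \<mm> \<Longrightarrow> \<exists>c \<in> \<mm>. a \<otimes> b = m \<otimes> c"
proof -
  assume ab: "a \<in> \<mm>" "b \<in> \<mm>"
  then obtain p q r where c: "p \<in> carrier R" "q \<in> carrier R" "r \<in> carrier R"
    "a \<otimes> b = m [^] (1::nat) \<otimes> (p \<otimes> m [^] (1::nat) \<oplus> q \<otimes> a \<oplus> r \<otimes> b)"
    using product_divisible[of a 1 b] emb_mV1_iff max_carrier by metis
  have "p \<otimes> m \<oplus> q \<otimes> a \<oplus> r \<otimes> b \<in> \<mm>"
    using idealD(3,4)[OF max_ideal_ideal] c(1-3) ab m(1) by simp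
  then show ?thesis using c(4) by auto
qed

lemma pw_divisible: "a \<in> pw (Suc n) \<Longrightarrow> \<exists>c \<in> \<mm>. a = m [^] n \<otimes> c"
  by (rule pw_Suc_divisible[OF mc max_square])

text \<open>Makes the completion of \<open>R\<close> surject onto that of \<open>V\<close>. An error
  \<open>\<mu>^n w\<close> is improved to \<open>\<mu>^(n + 1) v\<close> by splitting
  \<open>w\<close> as \<open>t + \<mu> v\<close> with \<open>t\<close> in \<open>R\<close>. The
  correction \<open>m^n t\<close> lies in \<open>\<mm>^n\<close>, so the approximations remain
  coherent.\<close>

lemma coherent_approximation:
  assumes u: "\<And>n. u n \<in> V" "\<And>n. u (Suc n) \<ominus>\<^bsub>Q\<^esub> u n \<in> mV n"
  obtains s where "coherent s" "\<And>n. u n \<ominus>\<^bsub>Q\<^esub> emb (s n) \<in> mV n"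
proof -
  have "\<exists>s. \<forall>n. (s n \<in> carrier R \<and> u n \<ominus>\<^bsub>Q\<^esub> emb (s n) \<in> mV n) \<and> s (Suc n) \<ominus> s n \<in> pw n"
  proof (rule dependent_nat_choice)
    have "u 0 \<ominus>\<^bsub>Q\<^esub> emb \<zero> \<in> V" using u by simp
    then show "\<exists>x. x \<in> carrier R \<and> u 0 \<ominus>\<^bsub>Q\<^esub> emb x \<in> mV 0" unfolding mV_0 by blast
  next
    fix s n assume s: "s \<in> carrier R \<and> u n \<ominus>\<^bsub>Q\<^esub> emb s \<in> mV n"
    have c: "emb s \<in> carrier Q" "u n \<in> carrier Q" "u (Suc n) \<in> carrier Q"
      using s Q.V_carrier[OF u(1)] by simp_all
    have "u (Suc n) \<ominus>\<^bsub>Q\<^esub> emb s = (u (Suc n) \<ominus>\<^bsub>Q\<^esub> u n) \<oplus>\<^bsub>Q\<^esub> (u n \<ominus>\<^bsub>Q\<^esub> emb s)"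
      using c by - (rule Q.ring_eqI, (rule Q.reify | (simp add: algebra_simps; fail))+)
    then have "u (Suc n) \<ominus>\<^bsub>Q\<^esub> emb s \<in> mV n" using mV_add u(2) s by simp
    then obtain w where w: "w \<in> V" "u (Suc n) \<ominus>\<^bsub>Q\<^esub> emb s = \<mu> [^]\<^bsub>Q\<^esub> n \<otimes>\<^bsub>Q\<^esub> w" by (elim mV_E)
    obtain t v where t: "t \<in> carrier R" "v \<in> V" "w = emb t \<oplus>\<^bsub>Q\<^esub> \<mu> \<otimes>\<^bsub>Q\<^esub> v" using V_approx[OF w(1)] by blast
    define s' where "s' = s \<oplus> m [^] n \<otimes> t"
    have s': "s' \<in> carrier R" using s t by (simp add: s'_def)
    have tc: "emb t \<in> carrier Q" "v \<in> carrier Q" using t by simp_all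
    have es: "emb s' = emb s \<oplus>\<^bsub>Q\<^esub> \<mu> [^]\<^bsub>Q\<^esub> n \<otimes>\<^bsub>Q\<^esub> emb t"
      unfolding s'_def using s t by (simp add: emb_simps(2,3) emb_pow)
    have "u (Suc n) \<ominus>\<^bsub>Q\<^esub> emb s' = (u (Suc n) \<ominus>\<^bsub>Q\<^esub> emb s) \<ominus>\<^bsub>Q\<^esub> \<mu> [^]\<^bsub>Q\<^esub> n \<otimes>\<^bsub>Q\<^esub> emb t"
      unfolding es using c tc \<mu>_simps(1)
      by - (rule Q.ring_eqI, (rule Q.reify | (simp add: algebra_simps; fail))+)
    also have "\<dots> = \<mu> [^]\<^bsub>Q\<^esub> Suc n \<otimes>\<^bsub>Q\<^esub> v"
      unfolding w(2) t(3) using tc \<mu>_simps(1)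
      by - (rule Q.ring_eqI, (rule Q.reify | (simp add: algebra_simps; fail))+)
    finally have "u (Suc n) \<ominus>\<^bsub>Q\<^esub> emb s' \<in> mV (Suc n)" using mV_I[OF t(2), of "Suc n"] by (simp only:)
    moreover have "s' \<ominus> s \<in> pw n"
    proof -
      have "s' \<ominus> s = t \<otimes> m [^] n" unfolding s'_def using s t mc
        by - (rule ring_eqI, (rule reify | (simp add: algebra_simps; fail))+)
      then show ?thesis using pw_D(4)[OF t(1) pw_pow[OF m(1)]] by simp
    qed
    ultimately show "\<exists>y. (y \<in> carrier R \<and> u (Suc n) \<ominus>\<^bsub>Q\<^esub> emb y \<in> mV (Suc n)) \<and> y \<ominus> s \<in> pw n"
      using s' by blast
  qed
  then obtain s where "\<forall>n. (s n \<in> carrier R \<and> u n \<ominus>\<^bsub>Q\<^esub> emb (s n) \<in> mV n) \<and> s (Suc n) \<ominus> s n \<in> pw n" by blast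
  then show thesis by (intro that[of s]) (auto simp: coherent_def)
qed

text \<open>The kernel of the map from the completion of \<open>R\<close> to that of
  \<open>V\<close>. Imposing the condition on all members of a coset avoids a choice of
  representatives; by \<open>limit_P_iff\<close> it can be tested on one coherent sequence.\<close>

definition P :: "(nat \<Rightarrow> 'a set) set"
  where "P = {\<xi> \<in> carrier A. \<forall>n. \<forall>x \<in> \<xi> n. emb x \<in> mV n}"

lemma limit_P_iff: "coherent r \<Longrightarrow> limit r \<in> P \<longleftrightarrow> (\<forall>n. emb (r n) \<in> mV n)"
proof
  assume r: "coherent r" "limit r \<in> P"
  have "r n \<in> limit r n" for n
    using coherentD(1)[OF r(1)] pw_D(2) by (simp add: limit_mem[OF r(1)] a_minus_def r_neg)
  then show "\<forall>n. emb (r n) \<in> mV n" using r(2) by (simp add: P_def)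
next
  assume r: "coherent r" "\<forall>n. emb (r n) \<in> mV n"
  have "emb x \<in> mV n" if x: "x \<in> limit r n" for n x
  proof -
    have x': "x \<in> carrier R" "x \<ominus> r n \<in> pw n" using x by (simp_all add: limit_mem[OF r(1)])
    have "x = (x \<ominus> r n) \<oplus> r n" using x'(1) coherentD(1)[OF r(1), of n]
      by - (rule ring_eqI, (rule reify | (simp add: algebra_simps; fail))+)
    then have "emb x = emb (x \<ominus> r n) \<oplus>\<^bsub>Q\<^esub> emb (r n)"
      using emb_simps(3)[of "x \<ominus> r n" "r n"] x'(1) coherentD(1)[OF r(1), of n] by simp
    then show ?thesis using mV_add pw_mV[OF x'(2)] r(2) by simp
  qed
  then show "limit r \<in> P" using limit_closed[OF r(1)] by (simp add: P_def)
qed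

lemma P_carrier: "\<xi> \<in> P \<Longrightarrow> \<xi> \<in> carrier A"
  by (simp add: P_def)

lemma P_ideal: "ideal P A"
proof (rule A.cring_idealI)
  show "P \<subseteq> carrier A" using P_carrier by blast
  have "\<mu> [^]\<^bsub>Q\<^esub> n \<otimes>\<^bsub>Q\<^esub> \<zero>\<^bsub>Q\<^esub> \<in> mV n" for n by (rule mV_I) simp
  then show "\<zero>\<^bsub>A\<^esub> \<in> P"
    unfolding limit_consts using limit_P_iff[OF coherent_const[of \<zero>]] by (simp add: emb_consts)
next
  fix x y assume xy: "x \<in> P" "y \<in> P"
  obtain r s where e: "coherent r" "x = limit r" "coherent s" "y = limit s"
    using P_carrier[OF xy(1)] P_carrier[OF xy(2)] by (elim A_E) blast
  then show "x \<oplus>\<^bsub>A\<^esub> y \<in> P"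
    using xy mV_add coherentD(1)[OF e(1)] coherentD(1)[OF e(3)]
    by (simp add: limit_ops limit_P_iff coherent_add emb_simps(3))
next
  fix x y assume xy: "x \<in> carrier A" "y \<in> P"
  obtain r s where e: "coherent r" "x = limit r" "coherent s" "y = limit s"
    using xy(1) P_carrier[OF xy(2)] by (elim A_E) blast
  then show "x \<otimes>\<^bsub>A\<^esub> y \<in> P"
    using xy mV_emb_mult coherentD(1)[OF e(1)] coherentD(1)[OF e(3)]
    by (simp add: limit_ops limit_P_iff coherent_mult emb_simps(2))
qed

lemma P_square: "x \<in> P \<Longrightarrow> y \<in> P \<Longrightarrow> x \<otimes>\<^bsub>A\<^esub> y = \<zero>\<^bsub>A\<^esub>"
proof -
  assume xy: "x \<in> P" "y \<in> P"
  obtain r s where e: "coherent r" "x = limit r" "coherent s" "y = limit s"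
    using P_carrier[OF xy(1)] P_carrier[OF xy(2)] by (elim A_E) blast
  note c = coherentD(1)[OF e(1)] coherentD(1)[OF e(3)]
  have "r n \<otimes> s n \<in> pw n" for n
  proof -
    have "emb (r n) \<in> mV n" "emb (s n) \<in> mV n" using xy e limit_P_iff by auto
    then obtain p q t where pq: "p \<in> carrier R" "q \<in> carrier R" "t \<in> carrier R"
      "r n \<otimes> s n = m [^] n \<otimes> (p \<otimes> m [^] n \<oplus> q \<otimes> r n \<oplus> t \<otimes> s n)"
      using product_divisible[OF c(1) _ c(2)] by blast
    show ?thesis unfolding pq(4) using pw_D(6)[OF _ pw_pow[OF m(1)]] pq(1-3) c by simp
  qed
  then show ?thesis unfolding e(2,4) limit_ops(2)[OF e(1,3)] using limit_zero_iff[OF coherent_mult[OF e(1,3)]] by simp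
qed

text \<open>An element \<open>z\<close> of \<open>V\<close> outside \<open>R\<close> has two
  descriptions: as a fraction \<open>a / m^l\<close> and as a limit of elements \<open>s n\<close>
  of \<open>R\<close>. Their difference, multiplied by \<open>m^l\<close>, is an element of
  \<open>P\<close>, and it can vanish in the completion only if \<open>z\<close> lies in
  \<open>R\<close>.\<close>

lemma P_nonzero: "P \<noteq> {\<zero>\<^bsub>A\<^esub>}"
proof -
  obtain z where z: "z \<in> V" "\<one>\<^bsub>Q\<^esub> \<otimes>\<^bsub>Q\<^esub> z \<notin> B" using S.not_finite[of "\<one>\<^bsub>Q\<^esub>"] by auto
  have zc: "z \<in> carrier Q" using z by simp
  have M: "\<mu> \<in> nonunits Q B" using nonunits_iff[OF mc] m by simp
  obtain l :: nat where "\<mu> [^]\<^bsub>Q\<^esub> l \<otimes>\<^bsub>Q\<^esub> z \<in> B" using S.power_denom[OF M zc] by blast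
  then obtain a where a: "a \<in> carrier R" "\<mu> [^]\<^bsub>Q\<^esub> l \<otimes>\<^bsub>Q\<^esub> z = emb a" by (auto simp: base_ring_iff)
  have "z \<ominus>\<^bsub>Q\<^esub> z \<in> mV n" for n
    using mV_I[of "\<zero>\<^bsub>Q\<^esub>" n] zc by (simp add: a_minus_def Q.r_neg)
  then obtain s where s: "coherent s" "\<And>n. z \<ominus>\<^bsub>Q\<^esub> emb (s n) \<in> mV n"
    using coherent_approximation[of "\<lambda>_. z"] z(1) by blast
  note sc = coherentD(1)[OF s(1)]
  define r where "r = (\<lambda>n. a \<ominus> m [^] l \<otimes> s n)"
  have r: "coherent r"
    unfolding r_def using coherent_diff[OF coherent_const coherent_mult[OF coherent_const s(1)]] a by simp
  have emb_r: "emb (r n) = \<mu> [^]\<^bsub>Q\<^esub> l \<otimes>\<^bsub>Q\<^esub> (z \<ominus>\<^bsub>Q\<^esub> emb (s n))" for n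
  proof -
    have "emb (r n) = \<mu> [^]\<^bsub>Q\<^esub> l \<otimes>\<^bsub>Q\<^esub> z \<ominus>\<^bsub>Q\<^esub> \<mu> [^]\<^bsub>Q\<^esub> l \<otimes>\<^bsub>Q\<^esub> emb (s n)"
      unfolding r_def using a sc by (simp add: emb_diff emb_simps(2) emb_pow)
    then show ?thesis using zc sc by (simp add: a_minus_def Q.r_distr Q.r_minus)
  qed
  have "emb (r n) \<in> mV n" for n
  proof -
    have "\<mu> [^]\<^bsub>Q\<^esub> l \<otimes>\<^bsub>Q\<^esub> \<one>\<^bsub>Q\<^esub> \<in> mV l" by (rule mV_I) simp
    then have "\<mu> [^]\<^bsub>Q\<^esub> l \<otimes>\<^bsub>Q\<^esub> (z \<ominus>\<^bsub>Q\<^esub> emb (s n)) \<in> mV (l + n)" using mV_mult s(2) by simp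
    then show ?thesis unfolding emb_r by (rule mV_mono[rotated]) simp
  qed
  then have "limit r \<in> P" using limit_P_iff[OF r] by blast
  moreover have "limit r \<noteq> \<zero>\<^bsub>A\<^esub>"
  proof
    assume "limit r = \<zero>\<^bsub>A\<^esub>"
    \<comment> \<open>At the index \<open>Suc l\<close>, membership in \<open>pw (Suc l)\<close>
      gives divisibility by exactly \<open>m [^] l\<close>, the power that clears the denominator of
      \<open>z\<close>.\<close>
    then have "r (Suc l) \<in> pw (Suc l)" using limit_zero_iff[OF r] by blast
    then obtain c where c: "c \<in> \<mm>" "r (Suc l) = m [^] l \<otimes> c" using pw_divisible by blast
    have cc: "c \<in> carrier R" using c max_carrier by blast
    have "\<mu> [^]\<^bsub>Q\<^esub> l \<otimes>\<^bsub>Q\<^esub> (z \<ominus>\<^bsub>Q\<^esub> emb (s (Suc l))) = \<mu> [^]\<^bsub>Q\<^esub> l \<otimes>\<^bsub>Q\<^esub> emb c"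
      unfolding emb_r[symmetric] c(2) using cc by (simp add: emb_simps(2) emb_pow)
    then have "z \<ominus>\<^bsub>Q\<^esub> emb (s (Suc l)) = emb c" using zc sc cc by (subst (asm) Q.m_lcancel) auto
    moreover have "z = (z \<ominus>\<^bsub>Q\<^esub> emb (s (Suc l))) \<oplus>\<^bsub>Q\<^esub> emb (s (Suc l))"
      using zc emb_closed[OF sc] by (simp add: a_minus_def Q.a_assoc Q.l_neg)
    ultimately have "z = emb (c \<oplus> s (Suc l))" using cc sc by (simp add: emb_simps(3))
    then show False using z(2) zc cc sc by simp
  qed
  ultimately show ?thesis by blast
qed

end

text \<open>All terms from index 1 on are units when \<open>r 1\<close> is, and their inverses are
  coherent because \<open>y' - y = - y y' (r' - r)\<close>. The term \<open>r 0\<close> may be a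
  nonunit; \<open>pw 0\<close> is the whole ring, so \<open>y 0\<close> is arbitrary.\<close>

lemma (in noetherian_local_ring) limit_unit:
  assumes r: "coherent r" "r 1 \<notin> \<mm>"
  shows "limit r \<in> Units A"
proof -
  note rc = coherentD(1)[OF r(1)]
  have nz: "r n \<notin> \<mm>" if n: "1 \<le> n" for n
  proof
    assume a: "r n \<in> \<mm>"
    have d: "r n \<ominus> r 1 \<in> \<mm>" using coherent_le[OF n r(1)] unfolding pw_1 .
    have "r 1 = r n \<ominus> (r n \<ominus> r 1)" using rc[of n] rc[of 1]
      by - (rule ring_eqI, (rule reify | (simp add: algebra_simps; fail))+)
    then have "r 1 \<in> \<mm>" using idealD(5)[OF max_ideal_ideal a d] by simp
    then show False using r(2) by simp
  qed
  have "\<exists>b. b \<in> carrier R \<and> (1 \<le> n \<longrightarrow> r n \<otimes> b = \<one>)" for n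
    using nz unit_iff[OF rc, of n] by (cases "1 \<le> n") auto
  then obtain y where y: "\<And>n. y n \<in> carrier R" "\<And>n. 1 \<le> n \<Longrightarrow> r n \<otimes> y n = \<one>" by metis
  have yc: "coherent y"
    unfolding coherent_def
  proof (intro conjI allI)
    fix n
    show "y n \<in> carrier R" by (rule y)
    show "y (Suc n) \<ominus> y n \<in> pw n"
    proof (cases "1 \<le> n")
      case False
      then have "n = 0" by simp
      then show ?thesis using y(1)[of 1] y(1)[of 0] by (simp add: pw_0)
    next
      case True
      note cs = y(1)[of n] y(1)[of "Suc n"] rc[of n] rc[of "Suc n"]
      have "y (Suc n) \<ominus> y n = y (Suc n) \<otimes> (r n \<otimes> y n) \<ominus> y n \<otimes> (r (Suc n) \<otimes> y (Suc n))"
        using y(2)[OF True] y(2)[of "Suc n"] cs by simp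
      also have "\<dots> = (\<ominus> (y n \<otimes> y (Suc n))) \<otimes> (r (Suc n) \<ominus> r n)"
        using cs by - (rule ring_eqI, (rule reify | (simp add: algebra_simps; fail))+)
      finally show ?thesis using pw_D(4)[OF _ coherentD(2)[OF r(1), of n]] cs by simp
    qed
  qed
  have "r n \<otimes> y n \<ominus> \<one> \<in> pw n" for n
  proof (cases "1 \<le> n")
    case False
    then have "n = 0" by simp
    then show ?thesis using y(1) rc by (simp add: pw_0)
  next
    case True
    then show ?thesis using y(2)[OF True] pw_D(2) by (simp add: a_minus_def r_neg)
  qed
  then have "limit r \<otimes>\<^bsub>A\<^esub> limit y = \<one>\<^bsub>A\<^esub>"
    unfolding limit_ops(2)[OF r(1) yc] limit_consts
    using limit_eq_iff[OF coherent_mult[OF r(1) yc] coherent_const[OF one_closed]] by simp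
  moreover from this have "limit y \<otimes>\<^bsub>A\<^esub> limit r = \<one>\<^bsub>A\<^esub>"
    using A.m_comm[OF limit_closed[OF r(1)] limit_closed[OF yc]] by simp
  ultimately show ?thesis
    using limit_closed[OF r(1)] limit_closed[OF yc] unfolding Units_def by blast
qed

section \<open>The residue ring of \<open>P\<close>\<close>

context uniformized_domain
begin

lemma completion_dvr: "dvr (A Quot P)" "primeideal P A"
proof -
  have t: "const m \<in> carrier A" by (rule limit_closed[OF coherent_const[OF mc]])
  have mult_m: "\<exists>s. coherent s \<and> y = limit s \<and> coherent (\<lambda>n. r n \<ominus> m [^] k \<otimes> s n) \<and>
      limit r \<ominus>\<^bsub>A\<^esub> const m [^]\<^bsub>A\<^esub> k \<otimes>\<^bsub>A\<^esub> y = limit (\<lambda>n. r n \<ominus> m [^] k \<otimes> s n)"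
    if r: "coherent r" and y: "y \<in> carrier A" for r y and k :: nat
  proof -
    obtain s where s: "coherent s" "y = limit s" using y by (rule A_E)
    have mk: "coherent (\<lambda>_. m [^] k)" by (rule coherent_const) simp
    have "const m [^]\<^bsub>A\<^esub> k \<otimes>\<^bsub>A\<^esub> y = limit (\<lambda>n. m [^] k \<otimes> s n)"
      unfolding s(2) const_pow[OF mc, symmetric] by (rule limit_ops(2)[OF mk s(1)])
    then show ?thesis
      using limit_diff[OF r coherent_mult[OF mk s(1)]] coherent_diff[OF r coherent_mult[OF mk s(1)]] s by auto
  qed
  have unit_or: "x \<in> Units A \<or> (\<exists>y \<in> carrier A. x \<ominus>\<^bsub>A\<^esub> const m \<otimes>\<^bsub>A\<^esub> y \<in> P)" if x: "x \<in> carrier A" for x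
  proof -
    obtain r where r: "coherent r" "x = limit r" using x by (rule A_E)
    note rc = coherentD(1)[OF r(1)]
    show ?thesis
    proof (cases "r 1 \<in> \<mm>")
      case False
      then show ?thesis using limit_unit r by blast
    next
      case True
      have rm: "r (Suc n) \<in> \<mm>" for n
      proof -
        have d: "r (Suc n) \<ominus> r 1 \<in> \<mm>" using coherent_le[OF _ r(1), of 1 "Suc n"] unfolding pw_1 by simp
        have "r (Suc n) = r 1 \<oplus> (r (Suc n) \<ominus> r 1)" using rc[of 1] rc[of "Suc n"]
          by - (rule ring_eqI, (rule reify | (simp add: algebra_simps; fail))+)
        then show ?thesis using idealD(3)[OF max_ideal_ideal True d] by simp
      qed
      \<comment> \<open>Division by \<open>\<mu>\<close> costs one exponent, hence the shift to
        \<open>r (Suc n)\<close>: the quotients \<open>u n\<close> then satisfy the hypothesis of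
        \<open>coherent_approximation\<close>.\<close>
      then have "\<exists>v. v \<in> V \<and> emb (r (Suc n)) = \<mu> \<otimes>\<^bsub>Q\<^esub> v" for n using m_divides by blast
      then obtain u where u: "\<And>n. u n \<in> V" "\<And>n. emb (r (Suc n)) = \<mu> \<otimes>\<^bsub>Q\<^esub> u n" by metis
      have uc: "u n \<in> carrier Q" for n using u(1) by simp
      have ud: "u (Suc n) \<ominus>\<^bsub>Q\<^esub> u n \<in> mV n" for n
      proof (rule mV_pow_cancel)
        show "u (Suc n) \<ominus>\<^bsub>Q\<^esub> u n \<in> carrier Q" using uc by simp
        have "\<mu> \<otimes>\<^bsub>Q\<^esub> (u (Suc n) \<ominus>\<^bsub>Q\<^esub> u n) = emb (r (Suc (Suc n)) \<ominus> r (Suc n))"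
          unfolding emb_diff[OF rc rc] u(2) using uc[of n] uc[of "Suc n"] by (simp add: a_minus_def Q.r_distr Q.r_minus)
        then show "\<mu> \<otimes>\<^bsub>Q\<^esub> (u (Suc n) \<ominus>\<^bsub>Q\<^esub> u n) \<in> mV (Suc n)"
          using pw_mV[OF coherentD(2)[OF r(1), of "Suc n"]] by simp
      qed
      obtain s where s: "coherent s" "\<And>n. u n \<ominus>\<^bsub>Q\<^esub> emb (s n) \<in> mV n"
        by (rule coherent_approximation[of u, OF u(1) ud]) (rule that)
      note sc = coherentD(1)[OF s(1)]
      have co: "coherent (\<lambda>n. r n \<ominus> m \<otimes> s n)"
        by (rule coherent_diff[OF r(1) coherent_mult[OF coherent_const[OF mc] s(1)]])
      have eq: "x \<ominus>\<^bsub>A\<^esub> const m \<otimes>\<^bsub>A\<^esub> limit s = limit (\<lambda>n. r n \<ominus> m \<otimes> s n)"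
        unfolding r(2) limit_ops(2)[OF coherent_const[OF mc] s(1)]
        by (rule limit_diff[OF r(1) coherent_mult[OF coherent_const[OF mc] s(1)]])
      have "emb (r n \<ominus> m \<otimes> s n) \<in> mV n" for n
      proof -
        have "r n \<ominus> m \<otimes> s n = (r (Suc n) \<ominus> m \<otimes> s n) \<ominus> (r (Suc n) \<ominus> r n)"
          using rc[of n] rc[of "Suc n"] sc[of n] mc
          by - (rule ring_eqI, (rule reify | (simp add: algebra_simps; fail))+)
        then have "emb (r n \<ominus> m \<otimes> s n) = emb (r (Suc n) \<ominus> m \<otimes> s n) \<ominus>\<^bsub>Q\<^esub> emb (r (Suc n) \<ominus> r n)"
          using emb_diff[of "r (Suc n) \<ominus> m \<otimes> s n" "r (Suc n) \<ominus> r n"] rc sc by simp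
        moreover have "emb (r (Suc n) \<ominus> m \<otimes> s n) = \<mu> \<otimes>\<^bsub>Q\<^esub> (u n \<ominus>\<^bsub>Q\<^esub> emb (s n))"
        proof -
          have "emb (r (Suc n) \<ominus> m \<otimes> s n) = \<mu> \<otimes>\<^bsub>Q\<^esub> u n \<ominus>\<^bsub>Q\<^esub> \<mu> \<otimes>\<^bsub>Q\<^esub> emb (s n)"
            using rc[of "Suc n"] sc[of n] by (simp add: emb_diff emb_simps(2) u(2))
          then show ?thesis using sc[of n] uc[of n] by (simp add: a_minus_def Q.r_distr Q.r_minus)
        qed
        moreover have "\<mu> \<otimes>\<^bsub>Q\<^esub> (u n \<ominus>\<^bsub>Q\<^esub> emb (s n)) \<in> mV n"
          by (rule mV_mono[OF _ \<mu>_mV[OF s(2)]]) simp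
        ultimately show ?thesis using mV_diff pw_mV[OF coherentD(2)[OF r(1), of n]] by simp
      qed
      then have "x \<ominus>\<^bsub>A\<^esub> const m \<otimes>\<^bsub>A\<^esub> limit s \<in> P" unfolding eq using limit_P_iff[OF co] by blast
      then show ?thesis using limit_closed[OF s(1)] by blast
    qed
  qed
  have separated: "x \<in> P" if x: "x \<in> carrier A"
    and s: "\<And>k :: nat. \<exists>y \<in> carrier A. x \<ominus>\<^bsub>A\<^esub> const m [^]\<^bsub>A\<^esub> k \<otimes>\<^bsub>A\<^esub> y \<in> P" for x
  proof -
    obtain r where r: "coherent r" "x = limit r" using x by (rule A_E)
    have "emb (r k) \<in> mV k" for k
    proof -
      obtain y where y: "y \<in> carrier A" "x \<ominus>\<^bsub>A\<^esub> const m [^]\<^bsub>A\<^esub> k \<otimes>\<^bsub>A\<^esub> y \<in> P" using s by blast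
      obtain s where s: "coherent s" "coherent (\<lambda>n. r n \<ominus> m [^] k \<otimes> s n)"
        "x \<ominus>\<^bsub>A\<^esub> const m [^]\<^bsub>A\<^esub> k \<otimes>\<^bsub>A\<^esub> y = limit (\<lambda>n. r n \<ominus> m [^] k \<otimes> s n)"
        using mult_m[OF r(1) y(1), of k] unfolding r(2) by blast
      have cs: "r k \<in> carrier R" "s k \<in> carrier R" using coherentD(1)[OF r(1)] coherentD(1)[OF s(1)] by simp_all
      have 1: "emb (r k \<ominus> m [^] k \<otimes> s k) \<in> mV k" using y(2) limit_P_iff[OF s(2)] unfolding s(3) by blast
      have 2: "\<mu> [^]\<^bsub>Q\<^esub> k \<otimes>\<^bsub>Q\<^esub> emb (s k) \<in> mV k" by (rule mV_I) (simp add: cs)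
      have "r k = (r k \<ominus> m [^] k \<otimes> s k) \<oplus> m [^] k \<otimes> s k" using cs mc
        by - (rule ring_eqI, (rule reify | (simp add: algebra_simps; fail))+)
      then have "emb (r k) = emb (r k \<ominus> m [^] k \<otimes> s k) \<oplus>\<^bsub>Q\<^esub> \<mu> [^]\<^bsub>Q\<^esub> k \<otimes>\<^bsub>Q\<^esub> emb (s k)"
        using emb_simps(3)[of "r k \<ominus> m [^] k \<otimes> s k" "m [^] k \<otimes> s k"] cs by (simp add: emb_simps(2) emb_pow)
      then show ?thesis using mV_add[OF 1 2] by simp
    qed
    then show ?thesis unfolding r(2) using limit_P_iff[OF r(1)] by blast
  qed
  have regular: "x \<in> P" if x: "x \<in> carrier A" and mx: "const m \<otimes>\<^bsub>A\<^esub> x \<in> P" for x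
  proof -
    obtain r where r: "coherent r" "x = limit r" using x by (rule A_E)
    note rc = coherentD(1)[OF r(1)]
    have "limit (\<lambda>n. m \<otimes> r n) \<in> P" using mx unfolding r(2) limit_ops(2)[OF coherent_const[OF mc] r(1)] .
    then have 1: "emb (m \<otimes> r n) \<in> mV n" for n
      using limit_P_iff[OF coherent_mult[OF coherent_const[OF mc] r(1)]] by blast
    \<comment> \<open>Cancelling \<open>\<mu>\<close> loses one exponent. The next term
      \<open>r (Suc n)\<close> has one to spare and agrees with \<open>r n\<close> modulo
      \<open>pw n\<close>.\<close>
    have "emb (r n) \<in> mV n" for n
    proof -
      have "\<mu> \<otimes>\<^bsub>Q\<^esub> emb (r (Suc n)) \<in> mV (Suc n)" using 1[of "Suc n"] emb_simps(2)[OF mc rc] by simp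
      then have "emb (r (Suc n)) \<in> mV n" by (rule mV_pow_cancel[OF emb_closed[OF rc]])
      moreover have "r n = r (Suc n) \<ominus> (r (Suc n) \<ominus> r n)" using rc[of n] rc[of "Suc n"]
        by - (rule ring_eqI, (rule reify | (simp add: algebra_simps; fail))+)
      then have "emb (r n) = emb (r (Suc n)) \<ominus>\<^bsub>Q\<^esub> emb (r (Suc n) \<ominus> r n)"
        using emb_diff[of "r (Suc n)" "r (Suc n) \<ominus> r n"] rc by simp
      ultimately show ?thesis using mV_diff pw_mV[OF coherentD(2)[OF r(1), of n]] by simp
    qed
    then show ?thesis unfolding r(2) using limit_P_iff[OF r(1)] by blast
  qed
  have proper: "\<one>\<^bsub>A\<^esub> \<ominus>\<^bsub>A\<^esub> const m \<otimes>\<^bsub>A\<^esub> y \<notin> P" if y: "y \<in> carrier A" for y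
  proof
    assume a: "\<one>\<^bsub>A\<^esub> \<ominus>\<^bsub>A\<^esub> const m \<otimes>\<^bsub>A\<^esub> y \<in> P"
    obtain s where s: "coherent s" "y = limit s" using y by (rule A_E)
    note sc = coherentD(1)[OF s(1)]
    have ms: "coherent (\<lambda>n. m \<otimes> s n)" by (rule coherent_mult[OF coherent_const[OF mc] s(1)])
    have "\<one>\<^bsub>A\<^esub> \<ominus>\<^bsub>A\<^esub> const m \<otimes>\<^bsub>A\<^esub> y = limit (\<lambda>n. \<one> \<ominus> m \<otimes> s n)"
      unfolding s(2) limit_ops(2)[OF coherent_const[OF mc] s(1)] limit_consts
      by (rule limit_diff[OF coherent_const[OF one_closed] ms])
    then have "emb (\<one> \<ominus> m \<otimes> s 1) \<in> mV 1"
      using a limit_P_iff[OF coherent_diff[OF coherent_const[OF one_closed] ms]] by simp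
    then have 1: "\<one> \<ominus> m \<otimes> s 1 \<in> \<mm>" using emb_mV1_iff[of "\<one> \<ominus> m \<otimes> s 1"] sc by simp
    have "(\<one> \<ominus> m \<otimes> s 1) \<oplus> m \<otimes> s 1 = \<one>" using sc[of 1] mc
      by - (rule ring_eqI, (rule reify | (simp add: algebra_simps; fail))+)
    then have "\<one> \<in> \<mm>"
      using idealD(3)[OF max_ideal_ideal 1 idealD(6)[OF max_ideal_ideal sc[of 1] m(1)]] by (simp only:)
    then show False using one_notin_max by simp
  qed
  show "dvr (A Quot P)" "primeideal P A"
    by (rule A.dvr_quotientI[OF P_ideal t unit_or separated regular proper]; assumption)+
qed

end

theorem (in noetherian_local_domain) bad_stable_imp_prime:
  assumes "bad_stable_domain R"
  shows "\<exists>P. primeideal P A \<and> P \<noteq> {\<zero>\<^bsub>A\<^esub>} \<and> ideal_power A P 2 = {\<zero>\<^bsub>A\<^esub>} \<and> dvr (A Quot P)"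
proof -
  interpret S: bad_stable_subring Q B by (rule bad_stable_Q[OF assms])
  obtain y where y: "y \<in> nonunits Q B" "y \<noteq> \<zero>\<^bsub>Q\<^esub>"
    "\<forall>x \<in> nonunits Q B. \<exists>v \<in> almost_integral Q B. x = y \<otimes>\<^bsub>Q\<^esub> v"
    "\<forall>x \<in> almost_integral Q B. \<exists>t \<in> B. \<exists>v \<in> almost_integral Q B. x = t \<oplus>\<^bsub>Q\<^esub> y \<otimes>\<^bsub>Q\<^esub> v"
    using S.uniformizer_exists by blast
  obtain m where m: "m \<in> carrier R" "y = emb m" using y(1) by (auto simp: nonunits_def base_ring_iff)
  have "uniformized_domain R m"
  proof (intro uniformized_domain.intro uniformized_domain_axioms.intro noetherian_local_domain_axioms)
    show "bad_stable_subring Q B" by (rule bad_stable_Q[OF assms])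
    show "m \<in> \<mm>" using nonunits_iff[OF m(1)] y(1) m(2) by simp
    show "m \<noteq> \<zero>" using y(2) m(2) by (auto simp: emb_consts)
  next
    fix a assume "a \<in> \<mm>"
    then have "emb a \<in> nonunits Q B" using nonunits_iff idealD(1)[OF max_ideal_ideal] by blast
    then show "\<exists>v \<in> almost_integral Q B. emb a = emb m \<otimes>\<^bsub>Q\<^esub> v" using y(3) m(2) by blast
  next
    fix x assume "x \<in> almost_integral Q B"
    then obtain t v where "t \<in> B" "v \<in> almost_integral Q B" "x = t \<oplus>\<^bsub>Q\<^esub> y \<otimes>\<^bsub>Q\<^esub> v" using y(4) by blast
    then show "\<exists>t \<in> carrier R. \<exists>v \<in> almost_integral Q B. x = emb t \<oplus>\<^bsub>Q\<^esub> emb m \<otimes>\<^bsub>Q\<^esub> v"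
      using m(2) by (auto simp: base_ring_iff)
  qed
  then interpret U: uniformized_domain R m .
  have "ideal_power A U.P 2 = {\<zero>\<^bsub>A\<^esub>}"
    using A.ideal_square_zero_iff[OF U.P_ideal] U.P_square by blast
  then show ?thesis using U.completion_dvr U.P_nonzero by blast
qed

subsection \<open>Domains whose completion has a square-zero prime\<close>

text \<open>Krull's intersection theorem for a principal ideal. If \<open>x\<close> is nonzero, its
  quotients \<open>a k\<close> by \<open>m^k\<close> satisfy \<open>a k = m a (k + 1)\<close>, so
  their ideals increase and become stationary. There \<open>a (k + 1)\<close> is a multiple of
  \<open>m a (k + 1)\<close>, which would make \<open>m\<close> a unit.\<close>

lemma (in noetherian_domain) infinitely_divisible_zero:
  assumes m: "m \<in> carrier R" "m \<notin> Units R" and x: "x \<in> carrier R" "\<And>k :: nat. \<exists>a \<in> carrier R. x = m [^] k \<otimes> a"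
  shows "x = \<zero>"
proof (rule ccontr)
  assume x0: "x \<noteq> \<zero>"
  obtain a where a: "\<And>k. a k \<in> carrier R" "\<And>k :: nat. x = m [^] k \<otimes> a k" using x(2) by metis
  have "m \<noteq> \<zero>" using a(2)[of 1] a(1)[of 1] x0 by auto
  then have mk: "m [^] k \<noteq> \<zero>" for k :: nat using m(1) by (induction k) (auto simp: integral_iff)
  have step: "a k = m \<otimes> a (Suc k)" for k
  proof -
    have "m [^] k \<otimes> a k = m [^] k \<otimes> (m \<otimes> a (Suc k))"
      using a(2)[of k] a(2)[of "Suc k"] a(1) m(1) by (simp add: m_assoc)
    then show ?thesis using mk a(1) m(1) by (simp add: m_lcancel)
  qed
  have "ideal I R" if "I \<in> range (\<lambda>k. PIdl (a k))" for I using that PIdl_ideal[OF a(1)] by auto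
  then obtain I where I: "I \<in> range (\<lambda>k. PIdl (a k))" "\<forall>J \<in> range (\<lambda>k. PIdl (a k)). I \<subseteq> J \<longrightarrow> J = I"
    using maximal_ideal_in_family[of "range (\<lambda>k. PIdl (a k))"] by blast
  then obtain k where k: "I = PIdl (a k)" by blast
  have "PIdl (a k) \<subseteq> PIdl (a (Suc k))"
  proof
    fix y assume "y \<in> PIdl (a k)"
    then obtain r where r: "r \<in> carrier R" "y = r \<otimes> a k" by (auto simp: PIdl_iff)
    then have "y = r \<otimes> m \<otimes> a (Suc k)" using step[of k] a(1) m(1) by (simp add: m_assoc)
    then show "y \<in> PIdl (a (Suc k))" unfolding PIdl_iff using r m(1) by blast
  qed
  then have "PIdl (a (Suc k)) = PIdl (a k)" using I(2) k by blast
  then have "a (Suc k) \<in> PIdl (a k)" using cgenideal_self[OF a(1)] by blast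
  then obtain c where c: "c \<in> carrier R" "a (Suc k) = c \<otimes> a k" by (auto simp: PIdl_iff)
  have "a (Suc k) \<otimes> \<one> = a (Suc k) \<otimes> (c \<otimes> m)"
    using c step[of k] a(1)[of "Suc k"] m(1) by (metis m_assoc m_comm m_closed r_one)
  moreover have "a (Suc k) \<noteq> \<zero>" using a(2)[of "Suc k"] m(1) x0 by auto
  ultimately have "\<one> = c \<otimes> m" using c(1) m(1) a(1) by (subst (asm) m_lcancel) auto
  then show False using m c(1) m_comm[of c m] unfolding Units_def by auto
qed

section \<open>Divisibility in discrete valuation rings, and modulo an ideal with such a residue
  ring\<close>

context cring
begin

lemma dvr_noetherian_local: "dvr R \<Longrightarrow> noetherian_local_domain R"
proof -
  assume d: "dvr R"
  then interpret principal_domain R by (simp add: dvr_def)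
  show ?thesis
    using d by unfold_locales (simp add: dvr_def)
qed

text \<open>The ideal of \<open>x\<close> and \<open>y\<close> has a generator \<open>g\<close>.
  Writing a nonzero \<open>g\<close> as a combination of \<open>x = x' g\<close> and
  \<open>y = y' g\<close> and cancelling it shows, by locality, that \<open>x'\<close> or
  \<open>y'\<close> is a unit.\<close>

lemma dvr_total:
  assumes d: "dvr R" and x: "x \<in> carrier R" and y: "y \<in> carrier R"
  shows "(\<exists>a \<in> carrier R. x = y \<otimes> a) \<or> (\<exists>a \<in> carrier R. y = x \<otimes> a)"
proof -
  interpret L: noetherian_local_domain R by (rule dvr_noetherian_local[OF d])
  interpret D: principal_domain R using d by (simp add: dvr_def)
  let ?J = "{j \<oplus> r \<otimes> y | j r. j \<in> PIdl x \<and> r \<in> carrier R}"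
  note J = ideal_add_principal[OF PIdl_ideal[OF x] y]
  obtain g where g: "g \<in> carrier R" "?J = PIdl g" using D.exists_gen[OF J(1)] by blast
  have m: "x \<in> PIdl g" "y \<in> PIdl g" "g \<in> ?J"
    using J(2,3) cgenideal_self[OF x] cgenideal_self[OF g(1)] unfolding g(2) by auto
  obtain x' y' where c1: "x' \<in> carrier R" "x = x' \<otimes> g" "y' \<in> carrier R" "y = y' \<otimes> g"
    using m(1,2) unfolding PIdl_iff by blast
  obtain j \<beta> where c2: "j \<in> PIdl x" "\<beta> \<in> carrier R" "g = j \<oplus> \<beta> \<otimes> y" using m(3) by blast
  obtain \<alpha> where c3: "\<alpha> \<in> carrier R" "j = \<alpha> \<otimes> x" using c2(1) unfolding PIdl_iff by blast
  have c7: "g = \<alpha> \<otimes> x \<oplus> \<beta> \<otimes> y" using c2(3) c3(2) by simp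
  note c = c1 c3(1) c2(2) c7
  show ?thesis
  proof (cases "g = \<zero>")
    case True
    then have "x = y \<otimes> \<zero>" using c(1,2) y by simp
    then show ?thesis using zero_closed by blast
  next
    case False
    have "g \<otimes> (\<alpha> \<otimes> x' \<oplus> \<beta> \<otimes> y') = \<alpha> \<otimes> (x' \<otimes> g) \<oplus> \<beta> \<otimes> (y' \<otimes> g)"
      using c(1,3,5,6) g(1) by - (rule ring_eqI, (rule reify | (simp add: algebra_simps; fail))+)
    also have "\<dots> = g" unfolding c(2)[symmetric] c(4)[symmetric] by (rule c(7)[symmetric])
    also have "\<dots> = g \<otimes> \<one>" using g(1) by simp
    finally have e: "\<alpha> \<otimes> x' \<oplus> \<beta> \<otimes> y' = \<one>" using False c(1,3,5,6) g(1) by (subst (asm) L.m_lcancel) auto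
    have "x' \<notin> L.\<mm> \<or> y' \<notin> L.\<mm>"
    proof (rule ccontr)
      assume "\<not> ?thesis"
      then have "\<alpha> \<otimes> x' \<oplus> \<beta> \<otimes> y' \<in> L.\<mm>" using idealD(3,4)[OF L.max_ideal_ideal] c(5,6) by simp
      then show False using e L.one_notin_max by simp
    qed
    then show ?thesis
    proof
      assume "x' \<notin> L.\<mm>"
      then obtain u where u: "u \<in> carrier R" "x' \<otimes> u = \<one>" using L.unit_iff c(1) by blast
      have "y = y' \<otimes> g \<otimes> (x' \<otimes> u)" using u(2) y by (simp flip: c(4))
      also have "\<dots> = x' \<otimes> g \<otimes> (u \<otimes> y')" using u(1) c(1,3) g(1)
        by - (rule ring_eqI, (rule reify | (simp add: algebra_simps; fail))+)
      finally have "y = x \<otimes> (u \<otimes> y')" by (simp flip: c(2))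
      then show ?thesis using u(1) c(3) m_closed by blast
    next
      assume "y' \<notin> L.\<mm>"
      then obtain u where u: "u \<in> carrier R" "y' \<otimes> u = \<one>" using L.unit_iff c(3) by blast
      have "x = x' \<otimes> g \<otimes> (y' \<otimes> u)" using u(2) x by (simp flip: c(2))
      also have "\<dots> = y' \<otimes> g \<otimes> (u \<otimes> x')" using u(1) c(1,3) g(1)
        by - (rule ring_eqI, (rule reify | (simp add: algebra_simps; fail))+)
      finally have "x = y \<otimes> (u \<otimes> x')" by (simp flip: c(4))
      then show ?thesis using u(1) c(1) m_closed by blast
    qed
  qed
qed

text \<open>An element of least value, found without a valuation: among the principal ideals of
  members of \<open>I\<close> there is a maximal one by the chain condition, and as divisibility is
  total it contains all others.\<close>

lemma dvr_minimal:
  assumes d: "dvr R" and I: "I \<subseteq> carrier R" "I \<noteq> {}"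
  shows "\<exists>i \<in> I. \<forall>x \<in> I. \<exists>a \<in> carrier R. x = i \<otimes> a"
proof -
  interpret L: noetherian_local_domain R by (rule dvr_noetherian_local[OF d])
  have "ideal J R" if "J \<in> (\<lambda>x. PIdl x) ` I" for J using that I(1) PIdl_ideal by auto
  then obtain J where J: "J \<in> (\<lambda>x. PIdl x) ` I" "\<forall>L \<in> (\<lambda>x. PIdl x) ` I. J \<subseteq> L \<longrightarrow> L = J"
    using L.maximal_ideal_in_family[of "(\<lambda>x. PIdl x) ` I"] I(2) by blast
  then obtain i where i: "i \<in> I" "J = PIdl i" by blast
  have ic: "i \<in> carrier R" using i I by blast
  have "\<exists>a \<in> carrier R. x = i \<otimes> a" if x: "x \<in> I" for x
  proof -
    have xc: "x \<in> carrier R" using x I by blast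
    from dvr_total[OF d xc ic] show ?thesis
    proof
      assume "\<exists>a \<in> carrier R. i = x \<otimes> a"
      then obtain a where a: "a \<in> carrier R" "i = x \<otimes> a" by blast
      have "PIdl i \<subseteq> PIdl x"
      proof
        fix y assume "y \<in> PIdl i"
        then obtain r where r: "r \<in> carrier R" "y = r \<otimes> i" by (auto simp: PIdl_iff)
        have "y = (r \<otimes> a) \<otimes> x" unfolding r(2) a(2) using r(1) a(1) xc by (simp add: m_ac)
        then show "y \<in> PIdl x" unfolding PIdl_iff using r(1) a(1) by blast
      qed
      then have "PIdl x = PIdl i" using J(2) i(2) x by blast
      then have "x \<in> PIdl i" using cgenideal_self[OF xc] by blast
      then obtain r where "r \<in> carrier R" "x = r \<otimes> i" by (auto simp: PIdl_iff)
      then show ?thesis using m_comm ic by blast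
    qed
  qed
  then show ?thesis using i(1) by blast
qed

text \<open>If \<open>x\<close> divides no power of \<open>m\<close>, then by
  \<open>dvr_total\<close> every power of \<open>m\<close> divides \<open>x\<close>, and
  \<open>infinitely_divisible_zero\<close> applies.\<close>

lemma dvr_power:
  assumes d: "dvr R" and m: "m \<in> carrier R" "m \<notin> Units R" and x: "x \<in> carrier R" "x \<noteq> \<zero>"
  shows "\<exists>k :: nat. \<exists>a \<in> carrier R. m [^] k = x \<otimes> a"
proof (rule ccontr)
  interpret L: noetherian_local_domain R by (rule dvr_noetherian_local[OF d])
  interpret N: noetherian_domain R ..
  assume no: "\<not> ?thesis"
  have "\<exists>a \<in> carrier R. x = m [^] k \<otimes> a" for k :: nat
    using dvr_total[OF d x(1), of "m [^] k"] no m(1) by auto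
  then show False using N.infinitely_divisible_zero[OF m x(1)] x(2) by blast
qed

lemma quot_carrier: "w \<in> carrier (R Quot P) \<Longrightarrow> \<exists>x \<in> carrier R. w = P +> x"
  by (auto simp: FactRing_def A_RCOSETS_def')

context
  fixes P assumes P: "ideal P R" and dvr: "dvr (R Quot P)"
begin

interpretation P: ideal P R by (rule P)

interpretation h: ring_hom_cring R "R Quot P" "(+>) P"
  by (rule P.rcos_ring_hom_cring[OF is_cring])

lemma quot_eq: "x \<in> carrier R \<Longrightarrow> y \<in> carrier R \<Longrightarrow> P +> x = P +> y \<longleftrightarrow> x \<ominus> y \<in> P"
  using quotient_eq_iff_same_a_r_cos[OF P] by simp

lemma quot_divides:
  assumes x: "x \<in> carrier R" and y: "y \<in> carrier R"
    and w: "\<exists>w \<in> carrier (R Quot P). P +> x = (P +> y) \<otimes>\<^bsub>R Quot P\<^esub> w"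
  shows "\<exists>a \<in> carrier R. x \<ominus> y \<otimes> a \<in> P"
proof -
  obtain w where w: "w \<in> carrier (R Quot P)" "P +> x = (P +> y) \<otimes>\<^bsub>R Quot P\<^esub> w" using w by blast
  obtain a where a: "a \<in> carrier R" "w = P +> a" using quot_carrier[OF w(1)] by blast
  have "P +> x = P +> (y \<otimes> a)" using w(2) a y by simp
  then show ?thesis using quot_eq[of x "y \<otimes> a"] x y a by blast
qed

lemma dvr_quotient_total:
  assumes "x \<in> carrier R" "y \<in> carrier R"
  shows "(\<exists>a \<in> carrier R. x \<ominus> y \<otimes> a \<in> P) \<or> (\<exists>a \<in> carrier R. y \<ominus> x \<otimes> a \<in> P)"
  using cring.dvr_total[OF P.quotient_is_cring[OF is_cring] dvr h.hom_closed[OF assms(1)] h.hom_closed[OF assms(2)]]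
    quot_divides[OF assms] quot_divides[OF assms(2,1)] by blast

lemma dvr_quotient_minimal:
  assumes I: "I \<subseteq> carrier R" "I \<noteq> {}"
  shows "\<exists>i \<in> I. \<forall>x \<in> I. \<exists>a \<in> carrier R. x \<ominus> i \<otimes> a \<in> P"
proof -
  define I' where "I' = (\<lambda>x. P +> x) ` I"
  have s: "I' \<subseteq> carrier (R Quot P)" "I' \<noteq> {}" using I h.hom_closed by (auto simp: I'_def)
  have "\<exists>w \<in> I'. \<forall>x \<in> I'. \<exists>a \<in> carrier (R Quot P). x = w \<otimes>\<^bsub>R Quot P\<^esub> a"
    by (rule cring.dvr_minimal[OF P.quotient_is_cring[OF is_cring] dvr s])
  then obtain w where w: "w \<in> I'" "\<forall>x \<in> I'. \<exists>a \<in> carrier (R Quot P). x = w \<otimes>\<^bsub>R Quot P\<^esub> a" by blast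
  obtain i where i: "i \<in> I" "w = P +> i" using w(1) unfolding I'_def by blast
  have "\<exists>a \<in> carrier R. x \<ominus> i \<otimes> a \<in> P" if x: "x \<in> I" for x
  proof (rule quot_divides)
    show "x \<in> carrier R" "i \<in> carrier R" using x i(1) I(1) by auto
    have "P +> x \<in> I'" using x by (simp add: I'_def)
    then show "\<exists>w \<in> carrier (R Quot P). P +> x = (P +> i) \<otimes>\<^bsub>R Quot P\<^esub> w"
      using w(2) i(2) by simp
  qed
  then show ?thesis using i(1) by blast
qed

lemma dvr_quotient_power:
  assumes m: "m \<in> carrier R" "\<And>a. a \<in> carrier R \<Longrightarrow> \<one> \<ominus> m \<otimes> a \<notin> P" and x: "x \<in> carrier R" "x \<notin> P"
  shows "\<exists>k :: nat. \<exists>a \<in> carrier R. m [^] k \<ominus> x \<otimes> a \<in> P"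
proof -
  have "P +> m \<notin> Units (R Quot P)"
  proof
    assume "P +> m \<in> Units (R Quot P)"
    then obtain w where "w \<in> carrier (R Quot P)" "(P +> m) \<otimes>\<^bsub>R Quot P\<^esub> w = \<one>\<^bsub>R Quot P\<^esub>"
      unfolding Units_def by blast
    then have "\<exists>w \<in> carrier (R Quot P). P +> \<one> = (P +> m) \<otimes>\<^bsub>R Quot P\<^esub> w" by (metis h.hom_one)
    then show False using quot_divides[OF one_closed m(1)] m(2) by blast
  qed
  moreover have "P +> x \<noteq> \<zero>\<^bsub>R Quot P\<^esub>"
  proof
    assume "P +> x = \<zero>\<^bsub>R Quot P\<^esub>"
    then have "P +> x = P +> \<zero>" by simp
    then show False using quot_eq[OF x(1) zero_closed] x by (simp add: a_minus_def)
  qed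
  ultimately have "\<exists>k :: nat. \<exists>w \<in> carrier (R Quot P). (P +> m) [^]\<^bsub>R Quot P\<^esub> k = (P +> x) \<otimes>\<^bsub>R Quot P\<^esub> w"
    by (rule cring.dvr_power[OF P.quotient_is_cring[OF is_cring] dvr h.hom_closed[OF m(1)] _ h.hom_closed[OF x(1)]])
  then obtain k :: nat and w where w: "w \<in> carrier (R Quot P)" "(P +> m) [^]\<^bsub>R Quot P\<^esub> k = (P +> x) \<otimes>\<^bsub>R Quot P\<^esub> w"
    by blast
  have "P +> (m [^] k) = (P +> m) [^]\<^bsub>R Quot P\<^esub> k" by (induction k) (use m(1) in simp_all)
  then have "\<exists>w \<in> carrier (R Quot P). P +> (m [^] k) = (P +> x) \<otimes>\<^bsub>R Quot P\<^esub> w" using w by auto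
  then have "\<exists>a \<in> carrier R. m [^] k \<ominus> x \<otimes> a \<in> P"
    by (rule quot_divides[OF nat_pow_closed[OF m(1)] x(1)])
  then show ?thesis by blast
qed

end

end

text \<open>The hypothesis \<open>sub\<close> says \<open>I \<subseteq> N + I \<mm>\<close>. Take
  \<open>L\<close> maximal among the ideals above \<open>N\<close> that do not contain
  \<open>I\<close>. A product \<open>y u\<close> outside \<open>L\<close> would give
  \<open>y = j + r y u\<close> with \<open>j \<in> L\<close>, and as \<open>1 - r u\<close> is a
  unit, \<open>y \<in> L\<close>. So \<open>I \<mm> \<subseteq> L\<close>, and then
  \<open>I \<subseteq> L\<close>.\<close>

lemma (in noetherian_local_ring) nakayama:
  assumes I: "ideal I R" and N: "ideal N R"
    and sub: "\<And>x. x \<in> I \<Longrightarrow> \<exists>y \<in> N. x \<ominus> y \<in> I \<cdot> \<mm>"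
  shows "I \<subseteq> N"
proof (rule ccontr)
  assume "\<not> I \<subseteq> N"
  define S where "S = {L. ideal L R \<and> N \<subseteq> L \<and> \<not> I \<subseteq> L}"
  have "S \<noteq> {}" using N \<open>\<not> I \<subseteq> N\<close> by (auto simp: S_def)
  moreover have "ideal L R" if "L \<in> S" for L using that by (simp add: S_def)
  ultimately obtain L where LS: "L \<in> S" "\<forall>J \<in> S. L \<subseteq> J \<longrightarrow> J = L"
    using maximal_ideal_in_family[of S] by metis
  have L: "ideal L R" "N \<subseteq> L" "\<not> I \<subseteq> L" using LS(1) by (simp_all add: S_def)
  note Ic = idealD[OF I] and Lc = idealD[OF L(1)] and mc = idealD[OF max_ideal_ideal]
  have prod: "y \<otimes> u \<in> L" if y: "y \<in> I" and u: "u \<in> \<mm>" for y u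
  proof (rule ccontr)
    assume yu: "y \<otimes> u \<notin> L"
    have c: "y \<in> carrier R" "u \<in> carrier R" using Ic(1)[OF y] mc(1)[OF u] .
    let ?J = "{j \<oplus> r \<otimes> (y \<otimes> u) | j r. j \<in> L \<and> r \<in> carrier R}"
    have yuc: "y \<otimes> u \<in> carrier R" using c by simp
    note J = ideal_add_principal[OF L(1) yuc]
    have "?J \<noteq> L" using J(3) yu by blast
    then have "?J \<notin> S" using LS(2) J(2) by blast
    then have "I \<subseteq> ?J" using J(1,2) L(2) by (auto simp: S_def)
    then obtain j r where jr: "j \<in> L" "r \<in> carrier R" "y = j \<oplus> r \<otimes> (y \<otimes> u)" using y by blast
    have jc: "j \<in> carrier R" using Lc(1)[OF jr(1)] .
    have "(\<one> \<ominus> r \<otimes> u) \<otimes> y = y \<ominus> r \<otimes> (y \<otimes> u)" using c jr(2)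
      by - (rule ring_eqI, (rule reify | (simp add: algebra_simps; fail))+)
    also have "\<dots> = j" using jr(3) c jr(2) jc by (metis a_minus_def a_assoc a_inv_closed m_closed r_neg r_zero)
    finally have e: "(\<one> \<ominus> r \<otimes> u) \<otimes> y = j" .
    have "\<one> \<ominus> r \<otimes> u \<notin> \<mm>"
    proof
      assume a: "\<one> \<ominus> r \<otimes> u \<in> \<mm>"
      have "(\<one> \<ominus> r \<otimes> u) \<oplus> r \<otimes> u = \<one>" using c jr(2)
        by - (rule ring_eqI, (rule reify | (simp add: algebra_simps; fail))+)
      then show False using mc(3)[OF a mc(4)[OF jr(2) u]] one_notin_max by simp
    qed
    then obtain v where v: "v \<in> carrier R" "(\<one> \<ominus> r \<otimes> u) \<otimes> v = \<one>" using unit_iff[of "\<one> \<ominus> r \<otimes> u"] c jr(2) by auto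
    have "v \<otimes> j = ((\<one> \<ominus> r \<otimes> u) \<otimes> v) \<otimes> y" unfolding e[symmetric] using v(1) c jr(2)
      by - (rule ring_eqI, (rule reify | (simp add: algebra_simps; fail))+)
    then have "y = v \<otimes> j" using v(2) c by simp
    then have "y \<in> L" using Lc(4)[OF v(1) jr(1)] by simp
    then show False using Lc(6)[OF c(2)] yu by blast
  qed
  have "z \<in> L" if "z \<in> I \<cdot> \<mm>" for z
    using that by (induction rule: ideal_prod.induct) (use prod Lc(3) in auto)
  then have "x \<in> L" if x: "x \<in> I" for x
  proof -
    obtain y where y: "y \<in> N" "x \<ominus> y \<in> I \<cdot> \<mm>" using sub x by blast
    have yc: "y \<in> carrier R" using y(1) idealD(1)[OF N] by blast
    have "x = (x \<ominus> y) \<oplus> y" using Ic(1)[OF x] yc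
      by - (rule ring_eqI, (rule reify | (simp add: algebra_simps; fail))+)
    then show ?thesis using Lc(3)[of "x \<ominus> y" y] y L(2) \<open>\<And>z. z \<in> I \<cdot> \<mm> \<Longrightarrow> z \<in> L\<close> by auto
  qed
  then show False using L(3) by blast
qed

sublocale noetherian_local_domain \<subseteq> noetherian_domain ..

section \<open>Local domains with a square-zero prime in the completion\<close>

locale square_zero_dvr = noetherian_local_domain +
  fixes P
  assumes prime: "primeideal P A" and nonzero: "P \<noteq> {\<zero>\<^bsub>A\<^esub>}"
    and square: "x \<in> P \<Longrightarrow> y \<in> P \<Longrightarrow> x \<otimes>\<^bsub>A\<^esub> y = \<zero>\<^bsub>A\<^esub>"
    and dvr: "dvr (A Quot P)"
begin

lemma P_ideal: "ideal P A"
  using prime by (rule primeideal.axioms)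

text \<open>The form in which \<open>P^2 = 0\<close> is brought down to \<open>R\<close>, as a
  congruence at each finite level.\<close>

lemma square_limit:
  assumes r: "coherent r" "limit r \<in> P" and s: "coherent s" "limit s \<in> P"
  shows "r n \<otimes> s n \<in> pw n"
proof -
  have "limit (\<lambda>n. r n \<otimes> s n) = \<zero>\<^bsub>A\<^esub>"
    using square[OF r(2) s(2)] unfolding limit_ops(2)[OF r(1) s(1)] .
  then show ?thesis using limit_zero_iff[OF coherent_mult[OF r(1) s(1)]] by blast
qed

text \<open>Divisibility of \<open>a\<close> by \<open>b\<close> in the completion modulo
  \<open>P\<close>, unfolded to sequences so that \<open>square_limit\<close> can be applied to the
  terms \<open>a \<ominus> b \<otimes> s n\<close>.\<close>

definition divides_mod :: "'a \<Rightarrow> 'a \<Rightarrow> bool"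
  where "divides_mod b a \<longleftrightarrow> (\<exists>s. coherent s \<and> coherent (\<lambda>n. a \<ominus> b \<otimes> s n) \<and> limit (\<lambda>n. a \<ominus> b \<otimes> s n) \<in> P)"

lemma divides_modI:
  assumes ab: "a \<in> carrier R" "b \<in> carrier R" and x: "x \<in> carrier A" "const a \<ominus>\<^bsub>A\<^esub> const b \<otimes>\<^bsub>A\<^esub> x \<in> P"
  shows "divides_mod b a"
proof -
  obtain s where s: "coherent s" "x = limit s" using x(1) by (rule A_E)
  note bs = coherent_mult[OF coherent_const[OF ab(2)] s(1)]
  have "const a \<ominus>\<^bsub>A\<^esub> const b \<otimes>\<^bsub>A\<^esub> x = limit (\<lambda>n. a \<ominus> b \<otimes> s n)"
    unfolding s(2) limit_ops(2)[OF coherent_const[OF ab(2)] s(1)] by (rule limit_diff[OF coherent_const[OF ab(1)] bs])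
  then show ?thesis
    unfolding divides_mod_def using s(1) coherent_diff[OF coherent_const[OF ab(1)] bs] x(2) by auto
qed

lemma divides_mod_total: "a \<in> carrier R \<Longrightarrow> b \<in> carrier R \<Longrightarrow> divides_mod b a \<or> divides_mod a b"
  using A.dvr_quotient_total[OF P_ideal dvr, of "const a" "const b"] const_simps(1)
    divides_modI[of a b] divides_modI[of b a] by blast

lemma divides_mod_minimal:
  assumes I: "I \<subseteq> carrier R" "I \<noteq> {}"
  shows "\<exists>i \<in> I. \<forall>x \<in> I. divides_mod i x"
proof -
  have "(\<lambda>a. const a) ` I \<subseteq> carrier A" "(\<lambda>a. const a) ` I \<noteq> {}" using I const_simps(1) by auto
  from A.dvr_quotient_minimal[OF P_ideal dvr this]
  obtain i where i: "i \<in> I" "\<forall>x \<in> I. \<exists>a \<in> carrier A. const x \<ominus>\<^bsub>A\<^esub> const i \<otimes>\<^bsub>A\<^esub> a \<in> P" by auto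
  then have "divides_mod i x" if "x \<in> I" for x using that I(1) divides_modI[of x i] by blast
  then show ?thesis using i(1) by blast
qed

text \<open>Here \<open>i s\<close> and \<open>i t\<close> are congruent to \<open>x\<close> and \<open>y\<close> modulo \<open>P\<close>, so \<open>(x - i s)(y - i t) = 0\<close> in the
  completion.\<close>
lemma product_congruence:
  assumes i: "i \<in> carrier R" and x: "x \<in> carrier R" "divides_mod i x" and y: "y \<in> carrier R" "divides_mod i y"
  shows "\<exists>s t. (\<forall>n. s n \<in> carrier R) \<and> (\<forall>n. t n \<in> carrier R) \<and>
    (\<forall>n. x \<otimes> y \<ominus> i \<otimes> (s n \<otimes> y \<oplus> t n \<otimes> x \<ominus> i \<otimes> (s n \<otimes> t n)) \<in> pw n)"
proof -
  obtain s where s: "coherent s" "coherent (\<lambda>n. x \<ominus> i \<otimes> s n)" "limit (\<lambda>n. x \<ominus> i \<otimes> s n) \<in> P"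
    using x(2) unfolding divides_mod_def by blast
  obtain t where t: "coherent t" "coherent (\<lambda>n. y \<ominus> i \<otimes> t n)" "limit (\<lambda>n. y \<ominus> i \<otimes> t n) \<in> P"
    using y(2) unfolding divides_mod_def by blast
  have "x \<otimes> y \<ominus> i \<otimes> (s n \<otimes> y \<oplus> t n \<otimes> x \<ominus> i \<otimes> (s n \<otimes> t n)) \<in> pw n" for n
  proof -
    have "x \<otimes> y \<ominus> i \<otimes> (s n \<otimes> y \<oplus> t n \<otimes> x \<ominus> i \<otimes> (s n \<otimes> t n)) = (x \<ominus> i \<otimes> s n) \<otimes> (y \<ominus> i \<otimes> t n)"
      using i x(1) y(1) coherentD(1)[OF s(1), of n] coherentD(1)[OF t(1), of n]
      by - (rule ring_eqI, (rule reify | (simp add: algebra_simps; fail))+)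
    then show ?thesis using square_limit[OF s(2,3) t(2,3)] by simp
  qed
  then show ?thesis using coherentD(1)[OF s(1)] coherentD(1)[OF t(1)] by blast
qed

text \<open>For \<open>m\<close> of least value in \<open>\<mm>\<close>,
  \<open>product_congruence\<close> at level 3 puts every product of two elements of
  \<open>\<mm>\<close> into \<open>m \<mm> + \<mm>^3\<close>. Since \<open>\<mm>^3\<close> is
  \<open>\<mm>^2 \<mm>\<close>, Nakayama's lemma removes the error and gives
  \<open>\<mm>^2 \<subseteq> m \<mm>\<close>.\<close>

lemma reduction_exists:
  "\<exists>m \<in> \<mm>. (\<forall>x \<in> \<mm>. divides_mod m x) \<and> (\<forall>a \<in> \<mm>. \<forall>b \<in> \<mm>. \<exists>c \<in> \<mm>. a \<otimes> b = m \<otimes> c)"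
proof -
  note mi = idealD[OF max_ideal_ideal]
  have "\<mm> \<subseteq> carrier R" "\<mm> \<noteq> {}" using mi(1,2) by auto
  then obtain m where m: "m \<in> \<mm>" "\<And>x. x \<in> \<mm> \<Longrightarrow> divides_mod m x" using divides_mod_minimal by meson
  have mc: "m \<in> carrier R" using m max_carrier by blast
  define N where "N = (\<lambda>c. m \<otimes> c) ` \<mm>"
  have N: "ideal N R"
  proof (rule cring_idealI)
    show "N \<subseteq> carrier R" using mc max_carrier by (auto simp: N_def)
    have "\<zero> = m \<otimes> \<zero>" using mc by simp
    then show "\<zero> \<in> N" using mi(2) unfolding N_def by blast
  next
    fix x y assume "x \<in> N" "y \<in> N"
    then obtain c d where e: "c \<in> \<mm>" "x = m \<otimes> c" "d \<in> \<mm>" "y = m \<otimes> d" by (auto simp: N_def)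
    then have "x \<oplus> y = m \<otimes> (c \<oplus> d)" using mc max_carrier by (simp add: r_distr)
    then show "x \<oplus> y \<in> N" using mi(3)[OF e(1,3)] by (simp add: N_def)
  next
    fix r x assume r: "r \<in> carrier R" and "x \<in> N"
    then obtain c where e: "c \<in> \<mm>" "x = m \<otimes> c" by (auto simp: N_def)
    then have "r \<otimes> x = m \<otimes> (r \<otimes> c)" using mc r max_carrier by (simp add: m_lcomm)
    then show "r \<otimes> x \<in> N" using mi(4)[OF r e(1)] by (simp add: N_def)
  qed
  note Nc = idealD[OF N]
  have pw3: "pw 3 = \<mm> \<cdot> \<mm> \<cdot> \<mm>"
    using pw_Suc[of 2] pw_Suc[of 1] pw_1 by (simp add: numeral_3_eq_3 numeral_2_eq_2)
  have "\<mm> \<cdot> \<mm> \<subseteq> N"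
  proof (rule nakayama[OF ideal_prod_is_ideal[OF max_ideal_ideal max_ideal_ideal] N])
    fix z assume "z \<in> \<mm> \<cdot> \<mm>"
    then show "\<exists>y \<in> N. z \<ominus> y \<in> \<mm> \<cdot> \<mm> \<cdot> \<mm>"
    proof (induction rule: ideal_prod.induct)
      case (prod x y)
      have xc: "x \<in> carrier R" "y \<in> carrier R" using prod max_carrier by auto
      obtain s t where st: "\<And>n. s n \<in> carrier R" "\<And>n. t n \<in> carrier R"
        "\<And>n. x \<otimes> y \<ominus> m \<otimes> (s n \<otimes> y \<oplus> t n \<otimes> x \<ominus> m \<otimes> (s n \<otimes> t n)) \<in> pw n"
        using product_congruence[OF mc xc(1) m(2)[OF prod(1)] xc(2) m(2)[OF prod(2)]] by blast
      have "s 3 \<otimes> y \<oplus> t 3 \<otimes> x \<ominus> m \<otimes> (s 3 \<otimes> t 3) \<in> \<mm>"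
        using mi(3)[OF mi(4)[OF st(1) prod(2)] mi(4)[OF st(2) prod(1)]] mi(5) mi(6)[OF _ m(1)] st by simp
      then show ?case using st(3)[of 3] unfolding pw3 N_def by blast
    next
      case (sum u v)
      then obtain y z where yz: "y \<in> N" "z \<in> N" "u \<ominus> y \<in> \<mm> \<cdot> \<mm> \<cdot> \<mm>" "v \<ominus> z \<in> \<mm> \<cdot> \<mm> \<cdot> \<mm>" by blast
      have uc: "u \<in> carrier R" "v \<in> carrier R"
        using sum(1,2) ideal_prod_in_carrier[OF max_ideal_ideal max_ideal_ideal] by auto
      have "(u \<oplus> v) \<ominus> (y \<oplus> z) = (u \<ominus> y) \<oplus> (v \<ominus> z)"
        using uc Nc(1)[OF yz(1)] Nc(1)[OF yz(2)]
        by - (rule ring_eqI, (rule reify | (simp add: algebra_simps; fail))+)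
      then have "(u \<oplus> v) \<ominus> (y \<oplus> z) \<in> \<mm> \<cdot> \<mm> \<cdot> \<mm>" using ideal_prod.sum[OF yz(3,4)] by simp
      then show ?case using Nc(3)[OF yz(1,2)] by blast
    qed
  qed
  then have "\<exists>c \<in> \<mm>. a \<otimes> b = m \<otimes> c" if "a \<in> \<mm>" "b \<in> \<mm>" for a b
    using ideal_prod.prod[OF that, of R] unfolding N_def by blast
  then show ?thesis using m by blast
qed

definition m :: 'a
  where "m = (SOME m. m \<in> \<mm> \<and> (\<forall>x \<in> \<mm>. divides_mod m x) \<and> (\<forall>a \<in> \<mm>. \<forall>b \<in> \<mm>. \<exists>c \<in> \<mm>. a \<otimes> b = m \<otimes> c))"

lemma m: "m \<in> \<mm>" "x \<in> \<mm> \<Longrightarrow> divides_mod m x" "a \<in> \<mm> \<Longrightarrow> b \<in> \<mm> \<Longrightarrow> \<exists>c \<in> \<mm>. a \<otimes> b = m \<otimes> c"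
proof -
  have *: "m \<in> \<mm> \<and> (\<forall>x \<in> \<mm>. divides_mod m x) \<and> (\<forall>a \<in> \<mm>. \<forall>b \<in> \<mm>. \<exists>c \<in> \<mm>. a \<otimes> b = m \<otimes> c)"
    unfolding m_def by (rule someI_ex) (use reduction_exists in blast)
  show "m \<in> \<mm>" using * by (rule conjunct1)
  show "x \<in> \<mm> \<Longrightarrow> divides_mod m x" using * by blast
  show "a \<in> \<mm> \<Longrightarrow> b \<in> \<mm> \<Longrightarrow> \<exists>c \<in> \<mm>. a \<otimes> b = m \<otimes> c" using * by blast
qed

lemma mc [simp]: "m \<in> carrier R"
  using m(1) by (rule max_carrier)

lemma pw_divisible: "a \<in> pw (Suc n) \<Longrightarrow> \<exists>c \<in> \<mm>. a = m [^] n \<otimes> c"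
  by (rule pw_Suc_divisible[OF mc m(3)])

text \<open>With \<open>m = \<zero>\<close> the squares of elements of \<open>\<mm>\<close> vanish,
  so \<open>\<mm>\<close> is zero. A sequence with limit in \<open>P\<close>, whose squares lie in
  \<open>\<mm>^n\<close>, is then zero from index 1 on, against
  \<open>P \<noteq> {\<zero>}\<close>.\<close>

lemma m_nonzero: "m \<noteq> \<zero>"
proof
  assume m0: "m = \<zero>"
  obtain p where p: "p \<in> P" "p \<noteq> \<zero>\<^bsub>A\<^esub>" using nonzero A.idealD(2)[OF P_ideal] by blast
  obtain r where r: "coherent r" "p = limit r" using A_E[OF A.idealD(1)[OF P_ideal p(1)]] by blast
  have pw0: "a = \<zero>" if a: "a \<in> pw (Suc n)" for a n
  proof -
    have a1: "a \<in> \<mm>" using a pw_mono[of 1 "Suc n"] pw_1 by auto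
    obtain c where "c \<in> \<mm>" "a \<otimes> a = m \<otimes> c" using m(3)[OF a1 a1] by blast
    then have "a \<otimes> a = \<zero>" using m0 max_carrier by simp
    then show ?thesis using max_carrier[OF a1] by (simp add: integral_iff)
  qed
  have "r n \<in> pw n" for n
  proof (cases n)
    case 0
    then show ?thesis using coherentD(1)[OF r(1)] by (simp add: pw_0)
  next
    case (Suc k)
    have "r n \<otimes> r n \<in> pw n" using square_limit[OF r(1) _ r(1)] p(1) r(2) by simp
    then have "r n \<otimes> r n = \<zero>" using pw0 Suc by simp
    then have "r n = \<zero>" using coherentD(1)[OF r(1)] by (simp add: integral_iff)
    then show ?thesis using pw_D(2) by simp
  qed
  then show False using limit_zero_iff[OF r(1)] p(2) r(2) by blast
qed

lemma m_nonunit: "m \<notin> Units R"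
proof
  assume "m \<in> Units R"
  then have "\<exists>b \<in> carrier R. m \<otimes> b = \<one>" unfolding Units_def using m_comm by auto
  then show False using unit_iff[OF mc] m(1) by blast
qed

lemma m_pow_nonzero: "m [^] (n :: nat) \<noteq> \<zero>"
  using m_nonzero by (induction n) (auto simp: integral_iff)

text \<open>\<open>R\<close> embeds into the residue ring of \<open>P\<close>: a constant in
  \<open>P\<close> has its square in all powers of \<open>\<mm>\<close>, hence divisible by all
  powers of \<open>m\<close>, and \<open>infinitely_divisible_zero\<close> applies.\<close>

lemma const_P_zero:
  assumes a: "a \<in> carrier R" "const a \<in> P"
  shows "a = \<zero>"
proof -
  have "a \<otimes> a \<in> pw n" for n
    using square_limit[OF coherent_const[OF a(1)] a(2) coherent_const[OF a(1)] a(2)] .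
  then have "\<exists>c \<in> carrier R. a \<otimes> a = m [^] k \<otimes> c" for k :: nat
    using pw_divisible[of "a \<otimes> a" k] max_carrier by blast
  then have "a \<otimes> a = \<zero>"
    using infinitely_divisible_zero[OF mc m_nonunit] a(1) by simp
  then show ?thesis using a(1) by (simp add: integral_iff)
qed

lemma divides_mod_P:
  assumes x: "x \<in> carrier R" "divides_mod \<zero> x"
  shows "x = \<zero>"
proof -
  obtain s where s: "coherent s" "limit (\<lambda>n. x \<ominus> \<zero> \<otimes> s n) \<in> P"
    using x(2) unfolding divides_mod_def by blast
  have "(\<lambda>n. x \<ominus> \<zero> \<otimes> s n) = (\<lambda>_. x)" using coherentD(1)[OF s(1)] x(1) by (simp add: a_minus_def)
  then show ?thesis using const_P_zero[OF x(1)] s(2) by simp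
qed

text \<open>In the residue ring of \<open>P\<close> some \<open>m^k\<close> is a multiple of
  \<open>r\<close>, so a difference \<open>m^k - r s n\<close> squares into \<open>\<mm>^n\<close>.
  Expanding the square, \<open>m^(2 k)\<close> is a multiple of \<open>r\<close> up to an element of
  \<open>\<mm>^n\<close>, and for suitable \<open>n\<close> this error is absorbed by a
  unit.\<close>

lemma power_divisible:
  assumes r: "r \<in> carrier R" "r \<noteq> \<zero>"
  shows "\<exists>k :: nat. \<exists>b \<in> carrier R. m [^] k = r \<otimes> b"
proof -
  \<comment> \<open>\<open>m\<close> is no unit modulo \<open>P\<close>: otherwise the unit
    \<open>\<one> \<ominus> m \<otimes> s 1\<close> of \<open>R\<close> would have its square in
    \<open>pw 1\<close>, which is \<open>\<mm>\<close>.\<close>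
  have "\<one>\<^bsub>A\<^esub> \<ominus>\<^bsub>A\<^esub> const m \<otimes>\<^bsub>A\<^esub> x \<notin> P" if x: "x \<in> carrier A" for x
  proof
    assume "\<one>\<^bsub>A\<^esub> \<ominus>\<^bsub>A\<^esub> const m \<otimes>\<^bsub>A\<^esub> x \<in> P"
    then have "divides_mod m \<one>" using divides_modI[OF one_closed mc x] by (simp add: limit_consts)
    then obtain s where s: "coherent s" "coherent (\<lambda>n. \<one> \<ominus> m \<otimes> s n)" "limit (\<lambda>n. \<one> \<ominus> m \<otimes> s n) \<in> P"
      unfolding divides_mod_def by blast
    have sc: "s 1 \<in> carrier R" using coherentD(1)[OF s(1)] .
    have ms: "m \<otimes> s 1 \<in> \<mm>" using idealD(6)[OF max_ideal_ideal sc m(1)] .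
    obtain b where b: "b \<in> carrier R" "(\<one> \<ominus> m \<otimes> s 1) \<otimes> b = \<one>" using one_minus_max[OF ms] by blast
    have sq: "(\<one> \<ominus> m \<otimes> s 1) \<otimes> (\<one> \<ominus> m \<otimes> s 1) \<in> \<mm>"
      using square_limit[OF s(2,3) s(2,3), of 1] unfolding pw_1 .
    have "b \<otimes> b \<otimes> ((\<one> \<ominus> m \<otimes> s 1) \<otimes> (\<one> \<ominus> m \<otimes> s 1)) = ((\<one> \<ominus> m \<otimes> s 1) \<otimes> b) \<otimes> ((\<one> \<ominus> m \<otimes> s 1) \<otimes> b)"
      using b(1) sc mc by - (rule ring_eqI, (rule reify | (simp add: algebra_simps; fail))+)
    then have "b \<otimes> b \<otimes> ((\<one> \<ominus> m \<otimes> s 1) \<otimes> (\<one> \<ominus> m \<otimes> s 1)) = \<one>" unfolding b(2) by simp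
    then show False using idealD(4)[OF max_ideal_ideal _ sq, of "b \<otimes> b"] b(1) one_notin_max by simp
  qed
  moreover have "const r \<notin> P" using const_P_zero[OF r(1)] r(2) by blast
  ultimately obtain k :: nat and x where x: "x \<in> carrier A" "const m [^]\<^bsub>A\<^esub> k \<ominus>\<^bsub>A\<^esub> const r \<otimes>\<^bsub>A\<^esub> x \<in> P"
    using A.dvr_quotient_power[OF P_ideal dvr, of "const m" "const r"] const_simps(1)[OF mc mc] const_simps(1)[OF r(1) r(1)]
    by blast
  have "divides_mod r (m [^] k)"
    using divides_modI[OF _ r(1) x(1), of "m [^] k"] x(2) by (simp add: const_pow)
  then obtain s where s: "coherent s" "coherent (\<lambda>n. m [^] k \<ominus> r \<otimes> s n)" "limit (\<lambda>n. m [^] k \<ominus> r \<otimes> s n) \<in> P"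
    unfolding divides_mod_def by blast
  \<comment> \<open>For this \<open>n\<close>, elements of \<open>pw n\<close> are multiples of
    \<open>m [^] Suc (2 * k)\<close>, one power beyond \<open>m [^] (2 * k)\<close>, so the error
    turns into the unit \<open>\<one> \<ominus> m \<otimes> c\<close>.\<close>
  define n where "n = Suc (Suc (2 * k))"
  have sc: "s n \<in> carrier R" using coherentD(1)[OF s(1)] .
  have "(m [^] k \<ominus> r \<otimes> s n) \<otimes> (m [^] k \<ominus> r \<otimes> s n) \<in> pw n" by (rule square_limit[OF s(2,3) s(2,3)])
  then obtain c where c: "c \<in> \<mm>" "(m [^] k \<ominus> r \<otimes> s n) \<otimes> (m [^] k \<ominus> r \<otimes> s n) = m [^] Suc (2 * k) \<otimes> c"
    unfolding n_def using pw_divisible by blast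
  have cc: "c \<in> carrier R" using max_carrier[OF c(1)] .
  \<comment> \<open>Chosen so that \<open>(m^k - r s)^2 = m^(2 k) - r b\<close>, with
    \<open>s\<close> for \<open>s n\<close>.\<close>
  define b where "b = s n \<otimes> (m [^] k \<oplus> m [^] k \<ominus> r \<otimes> s n)"
  have bc: "b \<in> carrier R" using sc r by (simp add: b_def)
  have "m [^] (2 * k) \<otimes> (\<one> \<ominus> m \<otimes> c) = r \<otimes> b \<oplus> ((m [^] k \<ominus> r \<otimes> s n) \<otimes> (m [^] k \<ominus> r \<otimes> s n) \<ominus> m [^] Suc (2 * k) \<otimes> c)"
    unfolding b_def mult_2 using sc r(1) mc cc
    by - (rule ring_eqI, (rule reify | (simp add: algebra_simps power_add; fail))+)
  also have "\<dots> = r \<otimes> b" unfolding c(2) using bc r(1) cc by (simp add: a_minus_def r_neg)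
  finally have e: "m [^] (2 * k) \<otimes> (\<one> \<ominus> m \<otimes> c) = r \<otimes> b" .
  obtain d where d: "d \<in> carrier R" "(\<one> \<ominus> m \<otimes> c) \<otimes> d = \<one>"
    using one_minus_max[OF idealD(4)[OF max_ideal_ideal mc c(1)]] by blast
  have "m [^] (2 * k) = m [^] (2 * k) \<otimes> ((\<one> \<ominus> m \<otimes> c) \<otimes> d)" using d by simp
  also have "\<dots> = (m [^] (2 * k) \<otimes> (\<one> \<ominus> m \<otimes> c)) \<otimes> d" using cc d(1) by (simp add: m_assoc)
  also have "\<dots> = r \<otimes> (b \<otimes> d)" unfolding e using r(1) bc d(1) by (simp add: m_assoc)
  finally show ?thesis using bc d(1) by blast
qed

lemma stable: "stable_domain R"
  unfolding stable_domain_def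
proof (intro conjI allI impI)
  show "domain R" by (rule domain_axioms)
  fix I assume "ideal I R \<and> I \<noteq> {\<zero>}"
  then have I: "ideal I R" "I \<noteq> {\<zero>}" by auto
  note Ic = idealD[OF I(1)]
  obtain i where i: "i \<in> I" "\<forall>x \<in> I. divides_mod i x" using divides_mod_minimal[of I] Ic(1,2) by auto
  have ic: "i \<in> carrier R" using Ic(1)[OF i(1)] .
  have i0: "i \<noteq> \<zero>"
  proof
    assume "i = \<zero>"
    then have "x = \<zero>" if "x \<in> I" for x using divides_mod_P[of x] i(2) that Ic(1) by blast
    then show False using I(2) Ic(2) by blast
  qed
  \<comment> \<open>This exponent makes the congruence exact: an element of
    \<open>pw (Suc k)\<close> is a multiple of \<open>m [^] k\<close>, hence of
    \<open>i \<otimes> i\<close>, and so lies in \<open>i I\<close>.\<close>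
  obtain k :: nat and b where b: "b \<in> carrier R" "m [^] k = (i \<otimes> i) \<otimes> b"
    using power_divisible[of "i \<otimes> i"] ic i0 by (auto simp: integral_iff)
  interpret D: ideal_in_domain R I by (intro ideal_in_domain.intro ideal_in_domain_axioms.intro I(1) domain_axioms)
  show "stable_ideal R I"
  proof (rule D.stable_if_principal_square[OF i(1) i0])
    fix x y assume xy: "x \<in> I" "y \<in> I"
    have c: "x \<in> carrier R" "y \<in> carrier R" using xy Ic(1) by auto
    obtain s t where st: "\<And>n. s n \<in> carrier R" "\<And>n. t n \<in> carrier R"
      "\<And>n. x \<otimes> y \<ominus> i \<otimes> (s n \<otimes> y \<oplus> t n \<otimes> x \<ominus> i \<otimes> (s n \<otimes> t n)) \<in> pw n"
      using product_congruence[OF ic c(1) _ c(2)] i(2) xy by blast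
    define z where "z = s (Suc k) \<otimes> y \<oplus> t (Suc k) \<otimes> x \<ominus> i \<otimes> (s (Suc k) \<otimes> t (Suc k))"
    have z: "z \<in> I"
      unfolding z_def using Ic(3)[OF Ic(4)[OF st(1) xy(2)] Ic(4)[OF st(2) xy(1)]] Ic(5) Ic(6)[OF _ i(1)] st by simp
    obtain d where d: "d \<in> \<mm>" "x \<otimes> y \<ominus> i \<otimes> z = m [^] k \<otimes> d"
      using pw_divisible[OF st(3)[of "Suc k"]] unfolding z_def by blast
    have dc: "d \<in> carrier R" using max_carrier[OF d(1)] .
    have zc: "z \<in> carrier R" using Ic(1)[OF z] .
    have "x \<otimes> y = i \<otimes> z \<oplus> (x \<otimes> y \<ominus> i \<otimes> z)" using c ic zc
      by - (rule ring_eqI, (rule reify | (simp add: algebra_simps; fail))+)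
    also have "\<dots> = i \<otimes> z \<oplus> i \<otimes> i \<otimes> b \<otimes> d" unfolding d(2) b(2) ..
    also have "\<dots> = i \<otimes> (z \<oplus> (b \<otimes> d) \<otimes> i)" using ic zc dc b(1)
      by - (rule ring_eqI, (rule reify | (simp add: algebra_simps; fail))+)
    finally have "x \<otimes> y = i \<otimes> (z \<oplus> (b \<otimes> d) \<otimes> i)" .
    moreover have "z \<oplus> (b \<otimes> d) \<otimes> i \<in> I" using Ic(3)[OF z Ic(4)[OF _ i(1)]] b(1) dc by simp
    ultimately show "\<exists>z \<in> I. x \<otimes> y = i \<otimes> z" by blast
  qed
qed

text \<open>A nonzero prime contains some nonzero \<open>r\<close>, hence by
  \<open>power_divisible\<close> a power of \<open>m\<close> and \<open>m\<close> itself, and then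
  every \<open>x \<in> \<mm>\<close>, as the square of \<open>x\<close> is a multiple of
  \<open>m\<close>. So \<open>\<mm>\<close> is the only nonzero prime.\<close>

lemma dimension_one: "krull_dim R = 1"
proof (rule krull_dim_eq_oneI)
  have mp: "primeideal \<mm> R" by (rule maximalideal_prime[OF max_ideal_maximal])
  have "{\<zero>} \<subset> \<mm>" using m(1) m_nonzero idealD(2)[OF max_ideal_ideal] by blast
  then show "prime_chain R 1 (\<lambda>i. if i = 0 then {\<zero>} else \<mm>)"
    using zeroprimeideal mp by (simp add: prime_chain_def)
  have eq: "p = \<mm>" if p: "primeideal p R" "p \<noteq> {\<zero>}" for p
  proof
    have pI: "ideal p R" using p(1) by (rule primeideal.axioms)
    have "\<one> \<notin> p" using primeideal.I_notcarr[OF p(1)] ideal.one_imp_carrier[OF pI] by blast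
    then show "p \<subseteq> \<mm>" by (rule ideal_subset_max[OF pI])
    obtain r where r: "r \<in> p" "r \<noteq> \<zero>" using p(2) idealD(2)[OF pI] by blast
    obtain k :: nat and b where b: "b \<in> carrier R" "m [^] k = r \<otimes> b"
      using power_divisible[OF idealD(1)[OF pI r(1)] r(2)] by blast
    have "m [^] k \<in> p" unfolding b(2) using idealD(6)[OF pI b(1) r(1)] .
    then have mp: "m \<in> p"
    proof (induction k)
      case 0
      then show ?case using \<open>\<one> \<notin> p\<close> by simp
    next
      case (Suc k)
      then show ?case using primeideal.I_prime[OF p(1), of "m [^] k" m] by auto
    qed
    show "\<mm> \<subseteq> p"
    proof
      fix x assume x: "x \<in> \<mm>"
      obtain c where c: "c \<in> \<mm>" "x \<otimes> x = m \<otimes> c" using m(3)[OF x x] by blast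
      have "x \<otimes> x \<in> p" unfolding c(2) using idealD(6)[OF pI max_carrier[OF c(1)] mp] .
      then show "x \<in> p" using primeideal.I_prime[OF p(1) max_carrier[OF x] max_carrier[OF x]] by blast
    qed
  qed
  fix p show "\<not> prime_chain R 2 p"
  proof
    assume c: "prime_chain R 2 p"
    have pr: "primeideal (p 0) R" "primeideal (p 1) R" "primeideal (p 2) R" "p 0 \<subset> p 1" "p 1 \<subset> p 2"
      using c unfolding prime_chain_def by (simp_all add: numeral_2_eq_2)
    have z: "\<zero> \<in> p 0" using idealD(2)[OF primeideal.axioms(1)[OF pr(1)]] .
    have "p 1 \<noteq> {\<zero>}" "p 2 \<noteq> {\<zero>}" using pr(4,5) z by auto
    then have "p 1 = \<mm>" "p 2 = \<mm>" using eq pr(2,3) by blast+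
    then show False using pr(5) by simp
  qed
qed

text \<open>If \<open>r n\<close> converges to an element of \<open>P\<close>, then for large \<open>n\<close> the fractions \<open>r n / m^j\<close> are integral; a common
  denominator of all of them would force the limit to be \<open>0\<close>.\<close>
lemma not_finite: "\<not> finite_normalization R"
proof
  assume "finite_normalization R"
  then obtain c where c: "c \<in> carrier R" "c \<noteq> \<zero>" and denom:
    "\<And>x a b. x \<in> carrier Q \<Longrightarrow> a \<in> B \<Longrightarrow> b \<in> B \<Longrightarrow> x \<otimes>\<^bsub>Q\<^esub> x = a \<oplus>\<^bsub>Q\<^esub> b \<otimes>\<^bsub>Q\<^esub> x \<Longrightarrow> emb c \<otimes>\<^bsub>Q\<^esub> x \<in> B"
    using finite_normalization_denom by blast
  obtain N :: nat and e where e: "e \<in> carrier R" "m [^] N = c \<otimes> e" using power_divisible[OF c] by blast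
  obtain p where p: "p \<in> P" "p \<noteq> \<zero>\<^bsub>A\<^esub>" using nonzero A.idealD(2)[OF P_ideal] by blast
  obtain r where r: "coherent r" "p = limit r" using A_E[OF A.idealD(1)[OF P_ideal p(1)]] by blast
  note rc = coherentD(1)[OF r(1)]
  have "r i \<in> pw i" for i
  proof -
    \<comment> \<open>The supposed common denominator \<open>c\<close> divides
      \<open>m [^] N\<close>. If it carries the fraction \<open>r n / m^(N + i)\<close> into
      \<open>R\<close>, then \<open>m^i\<close> has to divide \<open>r n\<close>.\<close>
    define j where "j = N + i"
    \<comment> \<open>As in \<open>power_divisible\<close>, elements of \<open>pw n\<close> are
      multiples of \<open>m [^] Suc (2 * j)\<close>.\<close>
    define n where "n = Suc (Suc (2 * j))"
    have bc: "r n \<in> carrier R" using rc .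
    have mj: "m [^] j \<in> carrier R" by simp
    \<comment> \<open>Otherwise, adding the element \<open>limit r \<otimes> limit s\<close> of
      \<open>P\<close> gives a sequence with limit in \<open>P\<close> whose term at index
      \<open>n\<close> is \<open>m [^] j\<close> itself. Its square \<open>m [^] (2 * j)\<close>
      would then be a multiple of \<open>m [^] Suc (2 * j)\<close>.\<close>
    have "\<not> divides_mod (r n) (m [^] j)"
    proof
      assume "divides_mod (r n) (m [^] j)"
      then obtain s where s: "coherent s" "coherent (\<lambda>k. m [^] j \<ominus> r n \<otimes> s k)" "limit (\<lambda>k. m [^] j \<ominus> r n \<otimes> s k) \<in> P"
        unfolding divides_mod_def by blast
      note rs = coherent_mult[OF r(1) s(1)]
      have "limit r \<otimes>\<^bsub>A\<^esub> limit s \<in> P" using A.idealD(6)[OF P_ideal limit_closed[OF s(1)] p(1)] r(2) by simp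
      then have q: "limit (\<lambda>k. r k \<otimes> s k) \<in> P" unfolding limit_ops(2)[OF r(1) s(1)] .
      have co: "coherent (\<lambda>k. (m [^] j \<ominus> r n \<otimes> s k) \<oplus> r k \<otimes> s k)" by (rule coherent_add[OF s(2) rs])
      have "limit (\<lambda>k. (m [^] j \<ominus> r n \<otimes> s k) \<oplus> r k \<otimes> s k) \<in> P"
        using A.idealD(3)[OF P_ideal s(3) q] unfolding limit_ops(1)[OF s(2) rs] .
      from square_limit[OF co this co this, of n]
      have "((m [^] j \<ominus> r n \<otimes> s n) \<oplus> r n \<otimes> s n) \<otimes> ((m [^] j \<ominus> r n \<otimes> s n) \<oplus> r n \<otimes> s n) \<in> pw n" .
      moreover have "((m [^] j \<ominus> r n \<otimes> s n) \<oplus> r n \<otimes> s n) \<otimes> ((m [^] j \<ominus> r n \<otimes> s n) \<oplus> r n \<otimes> s n) = m [^] (2 * j)"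
        unfolding mult_2 using bc mc coherentD(1)[OF s(1), of n]
        by - (rule ring_eqI, (rule reify | (simp add: algebra_simps power_add; fail))+)
      ultimately obtain d where d: "d \<in> \<mm>" "m [^] (2 * j) = m [^] Suc (2 * j) \<otimes> d"
        unfolding n_def using pw_divisible by metis
      have dc: "d \<in> carrier R" using max_carrier[OF d(1)] .
      have "m [^] (2 * j) \<otimes> \<one> = m [^] (2 * j) \<otimes> (m \<otimes> d)" using d(2) dc by (simp add: m_assoc)
      then have "\<one> = m \<otimes> d" using m_pow_nonzero dc by (subst (asm) m_lcancel) auto
      then show False using one_notin_max idealD(6)[OF max_ideal_ideal dc m(1)] by simp
    qed
    then have "divides_mod (m [^] j) (r n)" using divides_mod_total[OF bc mj] by blast
    then obtain s where s: "coherent s" "coherent (\<lambda>k. r n \<ominus> m [^] j \<otimes> s k)" "limit (\<lambda>k. r n \<ominus> m [^] j \<otimes> s k) \<in> P"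
      unfolding divides_mod_def by blast
    have sc: "s n \<in> carrier R" using coherentD(1)[OF s(1)] .
    have "(r n \<ominus> m [^] j \<otimes> s n) \<otimes> (r n \<ominus> m [^] j \<otimes> s n) \<in> pw n" by (rule square_limit[OF s(2,3) s(2,3)])
    then obtain d where d: "d \<in> \<mm>" "(r n \<ominus> m [^] j \<otimes> s n) \<otimes> (r n \<ominus> m [^] j \<otimes> s n) = m [^] Suc (2 * j) \<otimes> d"
      unfolding n_def using pw_divisible by blast
    have dc: "d \<in> carrier R" using max_carrier[OF d(1)] .
    \<comment> \<open>Read off from \<open>(r n - m^j s)^2 = m^(2 j + 1) d\<close>, with
      \<open>s\<close> for \<open>s n\<close>: divided by \<open>m^(2 j)\<close>, this says that
      \<open>x = r n / m^j\<close> satisfies \<open>(x - s)^2 = m d\<close>.\<close>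
    define a' where "a' = m \<otimes> d \<ominus> s n \<otimes> s n"
    define b' where "b' = s n \<oplus> s n"
    have ab: "a' \<in> carrier R" "b' \<in> carrier R" using dc sc by (simp_all add: a'_def b'_def)
    have "r n \<otimes> r n = (r n \<ominus> m [^] j \<otimes> s n) \<otimes> (r n \<ominus> m [^] j \<otimes> s n) \<oplus> m [^] j \<otimes> b' \<otimes> r n \<ominus> m [^] j \<otimes> m [^] j \<otimes> (s n \<otimes> s n)"
      unfolding b'_def using bc sc mc by - (rule ring_eqI, (rule reify | (simp add: algebra_simps; fail))+)
    also have "\<dots> = m [^] j \<otimes> m [^] j \<otimes> a' \<oplus> m [^] j \<otimes> b' \<otimes> r n"
      unfolding d(2) a'_def b'_def mult_2 using bc sc mc dc
      by - (rule ring_eqI, (rule reify | (simp add: algebra_simps power_add; fail))+)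
    finally have sq: "r n \<otimes> r n = m [^] j \<otimes> m [^] j \<otimes> a' \<oplus> m [^] j \<otimes> b' \<otimes> r n" .
    define x where "x = frac (r n) (m [^] j)"
    have xc: "x \<in> carrier Q" unfolding x_def by (rule Q_I[OF bc mj m_pow_nonzero])
    have "x \<otimes>\<^bsub>Q\<^esub> x = emb a' \<oplus>\<^bsub>Q\<^esub> emb b' \<otimes>\<^bsub>Q\<^esub> x"
    proof -
      have l: "x \<otimes>\<^bsub>Q\<^esub> x = frac (r n \<otimes> r n) (m [^] j \<otimes> m [^] j)"
        unfolding x_def by (rule Q_mult) (use bc m_pow_nonzero in auto)
      have rr: "emb b' \<otimes>\<^bsub>Q\<^esub> x = frac (b' \<otimes> r n) (m [^] j)"
        unfolding x_def using Q_mult[OF ab(2) bc one_closed one_not_zero mj m_pow_nonzero] by simp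
      have "emb a' \<oplus>\<^bsub>Q\<^esub> frac (b' \<otimes> r n) (m [^] j) = frac (a' \<otimes> m [^] j \<oplus> b' \<otimes> r n) (m [^] j)"
        using Q_add[OF ab(1) _ one_closed one_not_zero mj m_pow_nonzero, of "b' \<otimes> r n"] ab bc by simp
      moreover have "frac (r n \<otimes> r n) (m [^] j \<otimes> m [^] j) = frac (a' \<otimes> m [^] j \<oplus> b' \<otimes> r n) (m [^] j)"
      proof (subst frac_eq_iff)
        have "r n \<otimes> r n \<otimes> m [^] j = (m [^] j \<otimes> m [^] j \<otimes> a' \<oplus> m [^] j \<otimes> b' \<otimes> r n) \<otimes> m [^] j" unfolding sq ..
        also have "\<dots> = (a' \<otimes> m [^] j \<oplus> b' \<otimes> r n) \<otimes> (m [^] j \<otimes> m [^] j)" using ab bc mc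
          by - (rule ring_eqI, (rule reify | (simp add: algebra_simps; fail))+)
        finally show "r n \<otimes> r n \<otimes> m [^] j = (a' \<otimes> m [^] j \<oplus> b' \<otimes> r n) \<otimes> (m [^] j \<otimes> m [^] j)" .
      qed (use ab bc m_pow_nonzero in \<open>auto simp: integral_iff\<close>)
      ultimately show ?thesis unfolding l rr by simp
    qed
    then have "emb c \<otimes>\<^bsub>Q\<^esub> x \<in> B" using denom[OF xc emb_B[OF ab(1)] emb_B[OF ab(2)]] by blast
    then obtain f where f: "f \<in> carrier R" "emb c \<otimes>\<^bsub>Q\<^esub> x = emb f" by (auto simp: base_ring_iff)
    have "emb c \<otimes>\<^bsub>Q\<^esub> x = frac (c \<otimes> r n) (m [^] j)"
      unfolding x_def using Q_mult[OF c(1) bc one_closed one_not_zero mj m_pow_nonzero] by simp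
    then have "frac (c \<otimes> r n) (m [^] j) = frac f \<one>" using f(2) by simp
    then have cr: "c \<otimes> r n = f \<otimes> m [^] j"
      using frac_eq_iff[of "c \<otimes> r n" f "m [^] j" \<one>] c(1) bc f(1) m_pow_nonzero by simp
    have "m [^] N \<otimes> r n = e \<otimes> (c \<otimes> r n)" unfolding e(2) using c(1) e(1) bc
      by - (rule ring_eqI, (rule reify | (simp add: algebra_simps; fail))+)
    also have "\<dots> = m [^] N \<otimes> ((f \<otimes> e) \<otimes> m [^] i)"
      unfolding cr j_def using e(1) f(1) mc
      by - (rule ring_eqI, (rule reify | (simp add: algebra_simps power_add; fail))+)
    finally have "r n = (f \<otimes> e) \<otimes> m [^] i"
      using m_pow_nonzero bc e(1) f(1) by (subst (asm) m_lcancel) auto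
    then have rn: "r n \<in> pw i" using pw_D(4)[OF _ pw_pow[OF m(1)], of "f \<otimes> e"] e(1) f(1) by simp
    have "i \<le> n" by (simp add: n_def j_def)
    then have dif: "r n \<ominus> r i \<in> pw i" using coherent_le[OF _ r(1)] by blast
    have "r i = r n \<ominus> (r n \<ominus> r i)" using rc[of i] bc
      by - (rule ring_eqI, (rule reify | (simp add: algebra_simps; fail))+)
    then show ?thesis using pw_D(5)[OF rn dif] by simp
  qed
  then show False using limit_zero_iff[OF r(1)] p(2) r(2) by blast
qed

theorem bad_stable: "bad_stable_domain R"
  using quasilocal stable dimension_one not_finite by (simp add: bad_stable_domain_def)

end

theorem corollary3p5:
  fixes R :: "('a, 'b) ring_scheme" (structure)
  assumes "noetherian_domain R" and "quasilocal_ring R"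
  shows "bad_stable_domain R \<longleftrightarrow>
    (\<exists>P. primeideal P (completion R) \<and> P \<noteq> {\<zero>\<^bsub>completion R\<^esub>} \<and>
         ideal_power (completion R) P 2 = {\<zero>\<^bsub>completion R\<^esub>} \<and>
         dvr (completion R Quot P))"
proof -
  interpret noetherian_domain R by fact
  interpret noetherian_local_domain R
    by (intro noetherian_local_domain.intro noetherian_local_ring.intro noetherian_local_ring_axioms.intro
        noetherian_ring_axioms domain_axioms cring_axioms assms(2))
  show ?thesis
  proof
    assume "bad_stable_domain R"
    then show "\<exists>P. primeideal P (completion R) \<and> P \<noteq> {\<zero>\<^bsub>completion R\<^esub>} \<and>
         ideal_power (completion R) P 2 = {\<zero>\<^bsub>completion R\<^esub>} \<and> dvr (completion R Quot P)"
      unfolding completion_eq by (rule bad_stable_imp_prime)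
  next
    assume "\<exists>P. primeideal P (completion R) \<and> P \<noteq> {\<zero>\<^bsub>completion R\<^esub>} \<and>
         ideal_power (completion R) P 2 = {\<zero>\<^bsub>completion R\<^esub>} \<and> dvr (completion R Quot P)"
    then obtain P where P: "primeideal P A" "P \<noteq> {\<zero>\<^bsub>A\<^esub>}" "ideal_power A P 2 = {\<zero>\<^bsub>A\<^esub>}" "dvr (A Quot P)"
      unfolding completion_eq by blast
    have sq: "\<forall>x \<in> P. \<forall>y \<in> P. x \<otimes>\<^bsub>A\<^esub> y = \<zero>\<^bsub>A\<^esub>"
      using P(3) A.ideal_square_zero_iff[OF primeideal.axioms(1)[OF P(1)]] by blast
    interpret square_zero_dvr R P
      by (intro square_zero_dvr.intro square_zero_dvr_axioms.intro noetherian_local_domain_axioms P(1,2,4))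
        (use sq in blast)
    show "bad_stable_domain R" by (rule bad_stable)
  qed
qed

end
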